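(* Assume that Hypothesis (H) (stated in the context) holds. Let $\mathsf a_{\mathsf m},\mathsf b_{\mathsf m}\in\mathbb R^d$ ($\mathsf m\in\mathbb N^d$) be arbitrary points and, for every $\mathsf m$, let $$\varphi_{\mathsf m,0}(\mathsf x)=\frac{\delta(\mathsf x-\mathsf a_{\mathsf m})}{g^{1/2}(\mathsf a_{\mathsf m},T,\mathsf b_{\mathsf m})},\qquad \psi_{\mathsf m,T}(\mathsf x)=\frac{\delta(\mathsf x-\mathsf b_{\mathsf m})}{g^{1/2}(\mathsf a_{\mathsf m},T,\mathsf b_{\mathsf m})},$$ with $\delta$ the Dirac measure, let $\mu_{\mathsf m}$ be the probability measure on $\mathcal B_d\times\mathcal B_d$ with joint density $\mu_{\mathsf m}(\mathsf x,\mathsf y)=\varphi_{\mathsf m,0}(\mathsf x)g(\mathsf x,T,\mathsf y)\psi_{\mathsf m,T}(\mathsf y)$, and let $$u_{\mathsf m}(\mathsf x,t)=\int_{\mathbb R^d}d\mathsf y\,g(\mathsf x,t,\mathsf y)\varphi_{\mathsf m,0}(\mathsf y)>0,\qquad v_{\mathsf m}(\mathsf x,t)=\int_{\mathbb R^d}d\mathsf y\,g(\mathsf x,T-t,\mathsf y)\psi_{\mathsf m,T}(\mathsf y)>0 .$$ Then for every $\mathsf m\in\mathbb N^d$ there exists a non-stationary Bernstein process $Z^{\mathsf m}_{\tau\in[0,T]}$ in $\mathbb R^d$ (namely the Bernstein process associated with $\mu_{\mathsf m}$ in the sense of the context, on a probability space with probability $\mathbb P_{\mu_{\mathsf m}}$)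 such that the following statements are valid. (a) The process $Z^{\mathsf m}_{\tau\in[0,T]}$ is a forward Markov process whose finite-dimensional distributions are $$\mathbb P_{\mu_{\mathsf m}}\left(Z^{\mathsf m}_{t_1}\in F_1,\dots,Z^{\mathsf m}_{t_n}\in F_n\right)=\int_{\mathbb R^d}d\mathsf x\,\rho_{\mathsf m,0}(\mathsf x)\int_{F_1}d\mathsf x_1\cdots\int_{F_n}d\mathsf x_n\prod_{k=1}^n w^*_{\mathsf m}(\mathsf x_{k-1},t_{k-1};\mathsf x_k,t_k)$$ for every $n\in\mathbb N^+$, all $F_1,\dots,F_n\in\mathcal B_d$ and all $0=t_0<t_1<\dots<t_n<T$, with $\mathsf x_0=\mathsf x$. Here the density of the forward Markov transition function is $$w^*_{\mathsf m}(\mathsf x,s;\mathsf y,t)=g(\mathsf x,t-s,\mathsf y)\frac{v_{\mathsf m}(\mathsf y,t)}{v_{\mathsf m}(\mathsf x,s)}$$ for all $\mathsf x,\mathsf y\in\mathbb R^d$ and all $s,t\in[0,T]$ with $t>s$, and the initial distribution is $\rho_{\mathsf m,0}(\mathsf x)=\varphi_{\mathsf m,0}(\mathsf x)v_{\mathsf m}(\mathsf x,0)$. (b) The process $Z^{\mathsf m}_{\tau\in[0,T]}$ may also be viewed as a backward Markov process, since its finite-dimensional distributions may also be written as $$\mathbb P_{\mu_{\mathsf m}}\left(Z^{\mathsf m}_{t_1}\in F_1,\dots,Z^{\mathsf m}_{t_n}\in F_n\right)=\int_{\mathbb R^d}d\mathsf x\,\rho_{\mathsf m,T}(\mathsf x)\int_{F_1}d\mathsf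 x_1\cdots\int_{F_n}d\mathsf x_n\prod_{k=1}^n w_{\mathsf m}(\mathsf x_{k+1},t_{k+1};\mathsf x_k,t_k)$$ for every $n\in\mathbb N^+$, all $F_1,\dots,F_n\in\mathcal B_d$ and all $0<t_1<\dots<t_n<t_{n+1}=T$, with $\mathsf x_{n+1}=\mathsf x$. Here the density of the backward Markov transition function is $$w_{\mathsf m}(\mathsf x,t;\mathsf y,s)=g(\mathsf x,t-s,\mathsf y)\frac{u_{\mathsf m}(\mathsf y,s)}{u_{\mathsf m}(\mathsf x,t)}$$ for all $\mathsf x,\mathsf y\in\mathbb R^d$ and all $s,t\in[0,T]$ with $t>s$, and the final distribution is $\rho_{\mathsf m,T}(\mathsf x)=\psi_{\mathsf m,T}(\mathsf x)u_{\mathsf m}(\mathsf x,T)$. (c) We have $\mathbb P_{\mu_{\mathsf m}}(Z^{\mathsf m}_0=\mathsf a_{\mathsf m})=\mathbb P_{\mu_{\mathsf m}}(Z^{\mathsf m}_T=\mathsf b_{\mathsf m})=1$ and $$\mathbb P_{\mu_{\mathsf m}}(Z^{\mathsf m}_t\in F)=\int_F d\mathsf x\,u_{\mathsf m}(\mathsf x,t)v_{\mathsf m}(\mathsf x,t)$$ for each $t\in(0,T)$ and every $F\in\mathcal B_d$. (d) Finally, $$\mathbb E_{\mu_{\mathsf m}}\left(b(Z^{\mathsf m}_t)\right)=\int_{\mathbb R^d}d\mathsf x\,b(\mathsf x)u_{\mathsf m}(\mathsf x,t)v_{\mathsf m}(\mathsf x,t)$$ for each bounded Borel measurable function $b:\mathbb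 R^d\to\mathbb C$ and every $t\in(0,T)$.
   Context: Fix $d\in\mathbb N^+$ and $T\in(0,+\infty)$; $\mathcal B_d$ is the Borel $\sigma$-algebra of $\mathbb R^d$; $\mathbb N=\{0,1,2,\dots\}$. Hypothesis (H): the real-valued function $V$ on $\mathbb R^d$ is bounded from below, $V\in L^\infty_{loc}(\mathbb R^d)$, and $V(\mathsf x)\to+\infty$ as $|\mathsf x|\to+\infty$. $H=-\frac12\Delta_{\mathsf x}+V$ denotes the self-adjoint operator in $L^2(\mathbb R^d)$ associated with the closure of the quadratic form $\mathsf Q(f)=\frac12\sum_{j=1}^d\int|\partial_{x_j}f|^2d\mathsf x+\int V|f|^2d\mathsf x$ defined first on smooth compactly supported complex-valued $f$. It has compact resolvent; its eigenvalues $(E_{\mathsf m})_{\mathsf m\in\mathbb N^d}$ satisfy $E_{\mathsf m}\to+\infty$ as $|\mathsf m|\to+\infty$. Standing assumption: $\mathcal Z(t)=\sum_{\mathsf m\in\mathbb N^d}\exp[-tE_{\mathsf m}]<+\infty$ for every $t\in(0,T]$. Green's function $g(\mathsf x,t,\mathsf y)$ is the (continuous, strictly positive, symmetric in $\mathsf x,\mathsf y$) integral kernel of the semigroup $\exp[-tH]$, $t\in(0,T]$. Bernstein process: an $\mathbb R^d$-valued process $Z_{\tau\in[0,T]}$ on a complete probability space $(\Omega,\mathcal F,\mathbb P)$ such that $\mathbb E(b(Z_r)\mid\mathcal F_s^+\vee\mathcal F_t^-)=\mathbb E(b(Z_r)\mid Z_s,Z_t)$ $\mathbb P$-a.e. for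 every bounded Borel $b:\mathbb R^d\to\mathbb C$ and all $r\in(s,t)\subset[0,T]$, where $\mathcal F_s^+=\sigma\{Z_\tau^{-1}(F):\tau\le s,F\in\mathcal B_d\}$ and $\mathcal F_t^-=\sigma\{Z_\tau^{-1}(F):\tau\ge t,F\in\mathcal B_d\}$. Given a probability measure $\mu$ on $\mathcal B_d\times\mathcal B_d$, the Bernstein process associated with $\mu$ is the Bernstein process on a probability space $(\Omega,\mathcal F,\mathbb P_\mu)$ whose law is determined by $$\mathbb P_\mu(Z_0\in F_0,Z_{t_1}\in F_1,\dots,Z_{t_n}\in F_n,Z_T\in F_T)=\int_{F_0\times F_T}\frac{d\mu(\mathsf x,\mathsf y)}{g(\mathsf x,T,\mathsf y)}\int_{F_1}d\mathsf x_1\cdots\int_{F_n}d\mathsf x_n\prod_{k=1}^n g(\mathsf x_k,t_k-t_{k-1},\mathsf x_{k-1})\,g(\mathsf y,T-t_n,\mathsf x_n)$$ for all Borel $F_0,\dots,F_n,F_T$ and $t_0=0<t_1<\dots<t_n<T$, with $\mathsf x_0=\mathsf x$. In particular $\mu$ is the joint law of $(Z_0,Z_T)$. $\mathbb E_\mu$ is expectation under $\mathbb P_\mu$. A process is non-stationary if its finite-dimensional distributions are not invariant under time translations (within the time interval). *)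

theory Defs
  imports "HOL-Probability.Probability"
begin


section \<open>Schroedinger operators\<close>

(* L^infinity_loc functions are Lebesgue measurable, hence lebesgue rather than lborel. *)
definition hypothesis_H :: "(real ^ 'd \<Rightarrow> real) \<Rightarrow> bool" where
  "hypothesis_H V \<longleftrightarrow>
     (\<exists>c. \<forall>x. c \<le> V x) \<and>
     V \<in> borel_measurable lebesgue \<and>
     (\<forall>K. compact K \<longrightarrow> (\<exists>C. AE x in lebesgue. x \<in> K \<longrightarrow> \<bar>V x\<bar> \<le> C)) \<and>
     filterlim V at_top at_infinity"

(* Elements of the Hilbert space L^2 are represented by Borel functions; every class contains one. *)
definition L2 :: "(real ^ 'd \<Rightarrow> complex) set" where
  "L2 = {f \<in> borel_measurable borel. integrable lborel (\<lambda>x. (cmod (f x))\<^sup>2)}"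

definition L2_inner :: "(real ^ 'd \<Rightarrow> complex) \<Rightarrow> (real ^ 'd \<Rightarrow> complex) \<Rightarrow> complex" where
  "L2_inner f h = (LINT x|lborel. cnj (f x) * h x)"

definition L2_norm :: "(real ^ 'd \<Rightarrow> complex) \<Rightarrow> real" where
  "L2_norm f = sqrt (LINT x|lborel. (cmod (f x))\<^sup>2)"

definition partial :: "'d \<Rightarrow> (real ^ 'd \<Rightarrow> complex) \<Rightarrow> real ^ 'd \<Rightarrow> complex" where
  "partial j f x = frechet_derivative f (at x) (axis j 1)"

fun Ck :: "nat \<Rightarrow> (real ^ 'd \<Rightarrow> complex) \<Rightarrow> bool" where
  "Ck 0 f \<longleftrightarrow> continuous_on UNIV f"
| "Ck (Suc k) f \<longleftrightarrow> f differentiable_on UNIV \<and> (\<forall>j. Ck k (partial j f))"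

definition test_functions :: "(real ^ 'd \<Rightarrow> complex) set" where
  "test_functions = {f. (\<forall>k. Ck k f) \<and> compact (closure {x. f x \<noteq> 0})}"

definition energy :: "(real ^ 'd \<Rightarrow> real) \<Rightarrow> (real ^ 'd \<Rightarrow> complex) \<Rightarrow> real" where
  "energy V f =
     1 / 2 * (\<Sum>j\<in>UNIV. LINT x|lebesgue. (cmod (partial j f x))\<^sup>2)
     + (LINT x|lebesgue. V x * (cmod (f x))\<^sup>2)"

(* The sesquilinear form with diagonal energy V, antilinear in its first argument. *)
definition energy_form ::
  "(real ^ 'd \<Rightarrow> real) \<Rightarrow> (real ^ 'd \<Rightarrow> complex) \<Rightarrow> (real ^ 'd \<Rightarrow> complex) \<Rightarrow> complex" where
  "energy_form V h f =
     1 / 2 * (\<Sum>j\<in>UNIV. LINT x|lebesgue. cnj (partial j h x) * partial j f x)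
     + (LINT x|lebesgue. of_real (V x) * cnj (h x) * f x)"

(* F converges to f in L^2 and is Cauchy for the form. As V is bounded below, the energy is
   bounded below by a multiple of the squared L^2 norm, so this is being Cauchy in form norm. *)
definition form_approx ::
  "(real ^ 'd \<Rightarrow> real) \<Rightarrow> (nat \<Rightarrow> real ^ 'd \<Rightarrow> complex) \<Rightarrow> (real ^ 'd \<Rightarrow> complex) \<Rightarrow> bool" where
  "form_approx V F f \<longleftrightarrow>
     (\<forall>n. F n \<in> test_functions) \<and>
     (\<lambda>n. L2_norm (\<lambda>x. F n x - f x)) \<longlonglongrightarrow> 0 \<and>
     (\<forall>e>0. \<exists>N. \<forall>m\<ge>N. \<forall>n\<ge>N. \<bar>energy V (\<lambda>x. F m x - F n x)\<bar> < e)"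

definition form_domain :: "(real ^ 'd \<Rightarrow> real) \<Rightarrow> (real ^ 'd \<Rightarrow> complex) set" where
  "form_domain V = {f \<in> L2. \<exists>F. form_approx V F f}"

(* The limit does not depend on the approximating sequences, because the form is closable. *)
definition closed_form ::
  "(real ^ 'd \<Rightarrow> real) \<Rightarrow> (real ^ 'd \<Rightarrow> complex) \<Rightarrow> (real ^ 'd \<Rightarrow> complex) \<Rightarrow> complex" where
  "closed_form V h f =
     (THE z. \<forall>G F. form_approx V G h \<longrightarrow> form_approx V F f \<longrightarrow>
        (\<lambda>n. energy_form V (G n) (F n)) \<longlonglongrightarrow> z)"

(* The graph of H: f lies in the domain of H and H f = k. *)
definition schroedinger ::
  "(real ^ 'd \<Rightarrow> real) \<Rightarrow> (real ^ 'd \<Rightarrow> complex) \<Rightarrow> (real ^ 'd \<Rightarrow> complex) \<Rightarrow> bool" where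
  "schroedinger V f k \<longleftrightarrow>
     f \<in> form_domain V \<and> k \<in> L2 \<and> (\<forall>h \<in> form_domain V. closed_form V h f = L2_inner h k)"

(* An orthonormal basis e of L^2 with H (e m) = E m * e m. By completeness E lists all
   eigenvalues of H with their multiplicities. *)
definition eigenbasis ::
  "(real ^ 'd \<Rightarrow> real) \<Rightarrow> (nat ^ 'd \<Rightarrow> real) \<Rightarrow> (nat ^ 'd \<Rightarrow> real ^ 'd \<Rightarrow> complex) \<Rightarrow> bool" where
  "eigenbasis V E e \<longleftrightarrow>
     (\<forall>m. schroedinger V (e m) (\<lambda>x. of_real (E m) * e m x)) \<and>
     (\<forall>m n. L2_inner (e m) (e n) = (if m = n then 1 else 0)) \<and>
     (\<forall>f \<in> L2. (\<forall>m. L2_inner (e m) f = 0) \<longrightarrow> (AE x in lborel. f x = 0))"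

(* Functional calculus in the eigenbasis: exp(-tH) f = h as elements of L^2, where the
   eigenfunction expansion converges unconditionally in L^2. *)
definition exp_minus_tH ::
  "(nat ^ 'd \<Rightarrow> real) \<Rightarrow> (nat ^ 'd \<Rightarrow> real ^ 'd \<Rightarrow> complex) \<Rightarrow> real \<Rightarrow>
   (real ^ 'd \<Rightarrow> complex) \<Rightarrow> (real ^ 'd \<Rightarrow> complex) \<Rightarrow> bool" where
  "exp_minus_tH E e t f h \<longleftrightarrow>
     f \<in> L2 \<and> h \<in> L2 \<and>
     ((\<lambda>M. L2_norm (\<lambda>x. (\<Sum>m\<in>M. of_real (exp (- t * E m)) * L2_inner (e m) f * e m x) - h x))
        \<longlongrightarrow> 0) (finite_subsets_at_top UNIV)"

definition green_function ::
  "(nat ^ 'd \<Rightarrow> real) \<Rightarrow> (nat ^ 'd \<Rightarrow> real ^ 'd \<Rightarrow> complex) \<Rightarrow> real \<Rightarrow>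
   (real ^ 'd \<Rightarrow> real \<Rightarrow> real ^ 'd \<Rightarrow> real) \<Rightarrow> bool" where
  "green_function E e T g \<longleftrightarrow>
     continuous_on (UNIV \<times> {0<..T} \<times> UNIV) (\<lambda>(x, t, y). g x t y) \<and>
     (\<forall>t\<in>{0<..T}. \<forall>x y. 0 < g x t y \<and> g x t y = g y t x) \<and>
     (\<forall>t\<in>{0<..T}. \<forall>f\<in>L2.
        (AE x in lborel. integrable lborel (\<lambda>y. of_real (g x t y) * f y)) \<and>
        exp_minus_tH E e t f (\<lambda>x. LINT y|lborel. of_real (g x t y) * f y))"

section \<open>Processes on a time interval\<close>

definition process ::
  "real \<Rightarrow> 'w measure \<Rightarrow> (real \<Rightarrow> 'w \<Rightarrow> 'a::euclidean_space) \<Rightarrow> bool" where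
  "process T P Z \<longleftrightarrow>
     prob_space P \<and> complete_measure P \<and> (\<forall>\<tau>\<in>{0..T}. Z \<tau> \<in> borel_measurable P)"

definition generated ::
  "'w measure \<Rightarrow> (real \<Rightarrow> 'w \<Rightarrow> 'a::euclidean_space) \<Rightarrow> real set \<Rightarrow> 'w measure" where
  "generated P Z I = sigma (space P) {Z \<tau> -` F \<inter> space P | \<tau> F. \<tau> \<in> I \<and> F \<in> sets borel}"

definition complex_cond_exp ::
  "'w measure \<Rightarrow> 'w measure \<Rightarrow> ('w \<Rightarrow> complex) \<Rightarrow> 'w \<Rightarrow> complex" where
  "complex_cond_exp P G f \<omega> =
     Complex (real_cond_exp P G (\<lambda>\<omega>. Re (f \<omega>)) \<omega>) (real_cond_exp P G (\<lambda>\<omega>. Im (f \<omega>)) \<omega>)"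

definition bounded_borel :: "('a::euclidean_space \<Rightarrow> complex) set" where
  "bounded_borel = {b \<in> borel_measurable borel. bounded (range b)}"

(* Observing Z on the union of two time sets generates the join of the two sigma-algebras. *)
definition bernstein_process ::
  "real \<Rightarrow> 'w measure \<Rightarrow> (real \<Rightarrow> 'w \<Rightarrow> 'a::euclidean_space) \<Rightarrow> bool" where
  "bernstein_process T P Z \<longleftrightarrow>
     process T P Z \<and>
     (\<forall>b\<in>bounded_borel. \<forall>s r t. 0 \<le> s \<and> s < r \<and> r < t \<and> t \<le> T \<longrightarrow>
        (AE \<omega> in P.
           complex_cond_exp P (generated P Z ({0..s} \<union> {t..T})) (\<lambda>\<omega>. b (Z r \<omega>)) \<omega>
           = complex_cond_exp P (generated P Z {s, t}) (\<lambda>\<omega>. b (Z r \<omega>)) \<omega>))"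

definition forward_markov_process ::
  "real \<Rightarrow> 'w measure \<Rightarrow> (real \<Rightarrow> 'w \<Rightarrow> 'a::euclidean_space) \<Rightarrow> bool" where
  "forward_markov_process T P Z \<longleftrightarrow>
     process T P Z \<and>
     (\<forall>b\<in>bounded_borel. \<forall>s t. 0 \<le> s \<and> s < t \<and> t \<le> T \<longrightarrow>
        (AE \<omega> in P.
           complex_cond_exp P (generated P Z {0..s}) (\<lambda>\<omega>. b (Z t \<omega>)) \<omega>
           = complex_cond_exp P (generated P Z {s}) (\<lambda>\<omega>. b (Z t \<omega>)) \<omega>))"

definition backward_markov_process ::
  "real \<Rightarrow> 'w measure \<Rightarrow> (real \<Rightarrow> 'w \<Rightarrow> 'a::euclidean_space) \<Rightarrow> bool" where
  "backward_markov_process T P Z \<longleftrightarrow>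
     process T P Z \<and>
     (\<forall>b\<in>bounded_borel. \<forall>s t. 0 \<le> s \<and> s < t \<and> t \<le> T \<longrightarrow>
        (AE \<omega> in P.
           complex_cond_exp P (generated P Z {t..T}) (\<lambda>\<omega>. b (Z s \<omega>)) \<omega>
           = complex_cond_exp P (generated P Z {t}) (\<lambda>\<omega>. b (Z s \<omega>)) \<omega>))"

(* K s t x is the law of Z t given Z s = x; Chapman-Kolmogorov is stated with the Giry bind. *)
definition forward_transition_function ::
  "real \<Rightarrow> 'w measure \<Rightarrow> (real \<Rightarrow> 'w \<Rightarrow> 'a::euclidean_space) \<Rightarrow>
   (real \<Rightarrow> real \<Rightarrow> 'a \<Rightarrow> 'a measure) \<Rightarrow> bool" where
  "forward_transition_function T P Z K \<longleftrightarrow>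
     (\<forall>s t. 0 \<le> s \<and> s < t \<and> t \<le> T \<longrightarrow>
        K s t \<in> borel \<rightarrow>\<^sub>M prob_algebra borel \<and>
        (\<forall>F\<in>sets borel. AE \<omega> in P.
           real_cond_exp P (generated P Z {0..s}) (indicator (Z t -` F \<inter> space P)) \<omega>
           = measure (K s t (Z s \<omega>)) F)) \<and>
     (\<forall>r s t x. 0 \<le> r \<and> r < s \<and> s < t \<and> t \<le> T \<longrightarrow>
        K r t x = K r s x \<bind> K s t)"

(* K t s x is the law of Z s given Z t = x, for s < t. *)
definition backward_transition_function ::
  "real \<Rightarrow> 'w measure \<Rightarrow> (real \<Rightarrow> 'w \<Rightarrow> 'a::euclidean_space) \<Rightarrow>
   (real \<Rightarrow> real \<Rightarrow> 'a \<Rightarrow> 'a measure) \<Rightarrow> bool" where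
  "backward_transition_function T P Z K \<longleftrightarrow>
     (\<forall>s t. 0 \<le> s \<and> s < t \<and> t \<le> T \<longrightarrow>
        K t s \<in> borel \<rightarrow>\<^sub>M prob_algebra borel \<and>
        (\<forall>F\<in>sets borel. AE \<omega> in P.
           real_cond_exp P (generated P Z {t..T}) (indicator (Z s -` F \<inter> space P)) \<omega>
           = measure (K t s (Z t \<omega>)) F)) \<and>
     (\<forall>r s t x. 0 \<le> r \<and> r < s \<and> s < t \<and> t \<le> T \<longrightarrow>
        K t r x = K t s x \<bind> K s r)"

definition stationary ::
  "real \<Rightarrow> 'w measure \<Rightarrow> (real \<Rightarrow> 'w \<Rightarrow> 'a::euclidean_space) \<Rightarrow> bool" where
  "stationary T P Z \<longleftrightarrow>
     (\<forall>n t h F.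
        (\<forall>k\<in>{1..n}. t k \<in> {0..T} \<and> t k + h \<in> {0..T} \<and> F k \<in> sets borel) \<and>
        (\<forall>k\<in>{1..<n}. t k < t (Suc k)) \<longrightarrow>
        measure P {\<omega> \<in> space P. \<forall>k\<in>{1..n}. Z (t k + h) \<omega> \<in> F k}
        = measure P {\<omega> \<in> space P. \<forall>k\<in>{1..n}. Z (t k) \<omega> \<in> F k})"

(* xi k stands for x_k with 1 <= k <= n, and (xi(0 := x)) supplies x_0 = x. For n = 0 the
   condition says that mu is the joint law of Z 0 and Z T. *)
definition bernstein_process_associated ::
  "('a::euclidean_space \<Rightarrow> real \<Rightarrow> 'a \<Rightarrow> real) \<Rightarrow> real \<Rightarrow> ('a \<times> 'a) measure \<Rightarrow>
   'w measure \<Rightarrow> (real \<Rightarrow> 'w \<Rightarrow> 'a) \<Rightarrow> bool" where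
  "bernstein_process_associated g T \<mu> P Z \<longleftrightarrow>
     prob_space \<mu> \<and> sets \<mu> = sets (borel \<Otimes>\<^sub>M borel) \<and>
     bernstein_process T P Z \<and>
     (\<forall>n t F F0 FT.
        t 0 = 0 \<and> (\<forall>k<n. t k < t (Suc k)) \<and> t n < T \<and>
        F0 \<in> sets borel \<and> (\<forall>k\<in>{1..n}. F k \<in> sets borel) \<and> FT \<in> sets borel \<longrightarrow>
        emeasure P {\<omega> \<in> space P.
          Z 0 \<omega> \<in> F0 \<and> (\<forall>k\<in>{1..n}. Z (t k) \<omega> \<in> F k) \<and> Z T \<omega> \<in> FT}
        = (\<integral>\<^sup>+ (x, y). indicator (F0 \<times> FT) (x, y) * ennreal (1 / g x T y) *
            (\<integral>\<^sup>+ \<xi>. (\<Prod>k\<in>{1..n}. indicator (F k) (\<xi> k) *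
                         ennreal (g (\<xi> k) (t k - t (k - 1)) ((\<xi>(0 := x)) (k - 1))))
                  * ennreal (g y (T - t n) ((\<xi>(0 := x)) n))
              \<partial>Pi\<^sub>M {1..n} (\<lambda>_. lborel)) \<partial>\<mu>))"

section \<open>Dirac boundary data\<close>

(* The generalized functions phi_0 and psi_T are measures: integrating against
   phi_0(x) dx is integrating against initial_datum. *)
definition initial_datum ::
  "('a::euclidean_space \<Rightarrow> real \<Rightarrow> 'a \<Rightarrow> real) \<Rightarrow> real \<Rightarrow> 'a \<Rightarrow> 'a \<Rightarrow> 'a measure" where
  "initial_datum g T a b = scale_measure (ennreal (1 / sqrt (g a T b))) (return borel a)"

definition final_datum ::
  "('a::euclidean_space \<Rightarrow> real \<Rightarrow> 'a \<Rightarrow> real) \<Rightarrow> real \<Rightarrow> 'a \<Rightarrow> 'a \<Rightarrow> 'a measure" where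
  "final_datum g T a b = scale_measure (ennreal (1 / sqrt (g a T b))) (return borel b)"

definition joint_law ::
  "('a::euclidean_space \<Rightarrow> real \<Rightarrow> 'a \<Rightarrow> real) \<Rightarrow> real \<Rightarrow> 'a measure \<Rightarrow> 'a measure \<Rightarrow>
   ('a \<times> 'a) measure" where
  "joint_law g T \<phi> \<psi> = density (\<phi> \<Otimes>\<^sub>M \<psi>) (\<lambda>(x, y). ennreal (g x T y))"

definition forward_solution ::
  "('a::euclidean_space \<Rightarrow> real \<Rightarrow> 'a \<Rightarrow> real) \<Rightarrow> 'a measure \<Rightarrow> 'a \<Rightarrow> real \<Rightarrow> real" where
  "forward_solution g \<phi> x t = (LINT y|\<phi>. g x t y)"

definition backward_solution ::
  "('a::euclidean_space \<Rightarrow> real \<Rightarrow> 'a \<Rightarrow> real) \<Rightarrow> real \<Rightarrow> 'a measure \<Rightarrow> 'a \<Rightarrow> real \<Rightarrow> real" where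
  "backward_solution g T \<psi> x t = (LINT y|\<psi>. g x (T - t) y)"

(* forward_density g v x s y t is w^*(x,s;y,t), backward_density g u x t y s is w(x,t;y,s). *)
definition forward_density ::
  "('a \<Rightarrow> real \<Rightarrow> 'a \<Rightarrow> real) \<Rightarrow> ('a \<Rightarrow> real \<Rightarrow> real) \<Rightarrow> 'a \<Rightarrow> real \<Rightarrow> 'a \<Rightarrow> real \<Rightarrow> real" where
  "forward_density g v x s y t = g x (t - s) y * (v y t / v x s)"

definition backward_density ::
  "('a \<Rightarrow> real \<Rightarrow> 'a \<Rightarrow> real) \<Rightarrow> ('a \<Rightarrow> real \<Rightarrow> real) \<Rightarrow> 'a \<Rightarrow> real \<Rightarrow> 'a \<Rightarrow> real \<Rightarrow> real" where
  "backward_density g u x t y s = g x (t - s) y * (u y s / u x t)"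

(* At t = T the function v(.,T) is the generalized function psi_T, so v(y,T) dy is read as the
   measure psi; likewise u(y,0) dy is read as phi. *)
definition forward_kernel ::
  "('a::euclidean_space \<Rightarrow> real \<Rightarrow> 'a \<Rightarrow> real) \<Rightarrow> real \<Rightarrow> 'a measure \<Rightarrow>
   real \<Rightarrow> real \<Rightarrow> 'a \<Rightarrow> 'a measure" where
  "forward_kernel g T \<psi> s t x =
     (let v = backward_solution g T \<psi> in
      if t < T then density lborel (\<lambda>y. ennreal (forward_density g v x s y t))
      else density \<psi> (\<lambda>y. ennreal (g x (T - s) y / v x s)))"

definition backward_kernel ::
  "('a::euclidean_space \<Rightarrow> real \<Rightarrow> 'a \<Rightarrow> real) \<Rightarrow> 'a measure \<Rightarrow>
   real \<Rightarrow> real \<Rightarrow> 'a \<Rightarrow> 'a measure" where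
  "backward_kernel g \<phi> t s x =
     (let u = forward_solution g \<phi> in
      if 0 < s then density lborel (\<lambda>y. ennreal (backward_density g u x t y s))
      else density \<phi> (\<lambda>y. ennreal (g x t y / u x t)))"

end

theory Submission
  imports Defs
begin

text \<open>
With Dirac data at \<open>a\<close> and \<open>b\<close> the joint law of the endpoints is the unit mass at
\<open>(a, b)\<close>, because the two factors \<open>1 / sqrt (g a T b)\<close> cancel the Green function at the endpoints.
The Bernstein process is therefore the bridge of the kernel \<open>g\<close> from \<open>a\<close> to \<open>b\<close>:
at times \<open>0 < t\<^sub>1 < \<dots> < t\<^sub>n < T\<close> it has the joint density
\<open>g a t\<^sub>1 x\<^sub>1 \<cdot> g x\<^sub>1 (t\<^sub>2 - t\<^sub>1) x\<^sub>2 \<cdots> g x\<^sub>n (T - t\<^sub>n) b / g a T b\<close>.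
Besides positivity, symmetry and measurability, one property of \<open>g\<close> carries everything: the
Chapman-Kolmogorov identity, at every pair of points. It is needed pointwise because the bridge
starts and ends at prescribed points, which are null sets.

The functional calculus yields that identity only almost everywhere. Fatou's lemma and the continuity
of \<open>g\<close> turn it into an inequality at every pair of points, hence into the bound \<open>g x (2 * s) x\<close>
on the integral of \<open>(g x s z)\<^sup>2\<close> over \<open>z\<close>. This bound is locally uniform in \<open>x\<close>, so
\<open>g x\<^sub>n s\<close> converges weakly in \<open>L\<^sup>2\<close> to \<open>g x s\<close> as \<open>x\<^sub>n\<close> tends to \<open>x\<close>
(\<open>nn_integral_product_tendsto\<close>). The equality thus extends to all points, first in one variable and
then in the other, for times up to \<open>T / 2\<close>; associativity of the composition of kernels gives the
remaining times (\<open>green_semigroup\<close>).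

Inserting a time \<open>r\<close> between neighbours \<open>s < r < t\<close> multiplies the weight of a path by the density
\<open>g x (r - s) z \<cdot> g z (t - r) y / g x (t - s) y\<close> of the intermediate position \<open>z\<close>
(\<open>path_weight_insert\<close>). By Chapman-Kolmogorov this density has mass one, so the finite-dimensional laws
are consistent and Kolmogorov's extension theorem provides the process on the canonical path space. The
same identity, integrated against cylinder sets, says that this density is the law of \<open>Z\<^sub>r\<close> given the
path up to \<open>s\<close> and from \<open>t\<close> on (\<open>nn_cond_exp_bridge\<close>), which is the Bernstein property.

Since \<open>Z\<^sub>0\<close> and \<open>Z\<^sub>T\<close> are constant, the choice \<open>t = T\<close> gives the forward Markov property,
with the Doob transform of \<open>g\<close> by \<open>x \<mapsto> g x (T - s) b\<close> as transition function, and the choice \<open>s = 0\<close>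
gives the backward one. The backward transition function is the forward one for the time-reversed
bridge. The product formulas for the finite-dimensional laws follow because the quotients of \<open>v\<close>, or of
\<open>u\<close>, telescope. The bridge is not stationary: it starts at the point \<open>a\<close> and has a density at time
\<open>T / 2\<close>.
\<close>

section \<open>The semigroup law in the eigenbasis\<close>

lemma L2_borel: "f \<in> L2 \<Longrightarrow> f \<in> borel_measurable borel"
  and L2_square_integrable: "f \<in> L2 \<Longrightarrow> integrable lborel (\<lambda>x. (cmod (f x))\<^sup>2)"
  by (auto simp: L2_def)

lemma L2_scale: "f \<in> L2 \<Longrightarrow> (\<lambda>x. c * f x) \<in> L2"
  by (auto simp: L2_def norm_mult power_mult_distrib)

lemma norm_add_power2_le: "(norm (p + q))\<^sup>2 \<le> 2 * (norm p)\<^sup>2 + 2 * (norm q)\<^sup>2"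
  for p q :: "'a::real_normed_vector"
proof -
  have "(norm (p + q))\<^sup>2 \<le> (norm p + norm q)\<^sup>2"
    by (intro power_mono norm_triangle_ineq) auto
  also have "\<dots> \<le> 2 * (norm p)\<^sup>2 + 2 * (norm q)\<^sup>2"
    using sum_squares_bound[of "norm p" "norm q"] by (simp add: power2_sum)
  finally show ?thesis .
qed

lemma L2_add:
  assumes "f \<in> L2" "h \<in> L2"
  shows "(\<lambda>x. f x + h x) \<in> L2"
proof -
  note [measurable] = assms[THEN L2_borel]
  have "integrable lborel (\<lambda>x. (cmod (f x + h x))\<^sup>2)"
  proof (rule Bochner_Integration.integrable_bound)
    show "integrable lborel (\<lambda>x. 2 * (cmod (f x))\<^sup>2 + 2 * (cmod (h x))\<^sup>2)"
      using assms by (auto simp: L2_def)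
    show "AE x in lborel. norm ((cmod (f x + h x))\<^sup>2)
        \<le> norm (2 * (cmod (f x))\<^sup>2 + 2 * (cmod (h x))\<^sup>2)"
      using norm_add_power2_le[of "f _" "h _"] by auto
  qed measurable
  then show ?thesis
    by (simp add: L2_def)
qed

lemma L2_diff: "f \<in> L2 \<Longrightarrow> h \<in> L2 \<Longrightarrow> (\<lambda>x. f x - h x) \<in> L2"
  using L2_add[of f "\<lambda>x. - 1 * h x"] L2_scale[of h "-1"] by simp

lemma L2_sum: "(\<And>m. m \<in> M \<Longrightarrow> f m \<in> L2) \<Longrightarrow> (\<lambda>x. \<Sum>m\<in>M. f m x) \<in> L2"
proof (induction M rule: infinite_finite_induct)
  case (insert m M)
  then show ?case
    using L2_add[of "f m" "\<lambda>x. \<Sum>m\<in>M. f m x"] by simp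
qed (auto simp: L2_def)

lemma L2_nn_norm: "f \<in> L2 \<Longrightarrow> (\<integral>\<^sup>+ x. (ennreal (cmod (f x)))\<^sup>2 \<partial>lborel) = ennreal ((L2_norm f)\<^sup>2)"
  by (simp add: L2_norm_def L2_def nn_integral_eq_integral ennreal_power)

lemma L2_inner_integrable:
  assumes "f \<in> L2" "h \<in> L2"
  shows "integrable lborel (\<lambda>x. cnj (f x) * h x)"
proof (rule Bochner_Integration.integrable_bound)
  note [measurable] = assms[THEN L2_borel]
  have [measurable]: "cnj \<in> borel_measurable borel"
    by (intro borel_measurable_continuous_onI continuous_intros)
  show "(\<lambda>x. cnj (f x) * h x) \<in> borel_measurable lborel"
    by measurable
  show "integrable lborel (\<lambda>x. (cmod (f x))\<^sup>2 + (cmod (h x))\<^sup>2)"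
    using assms by (auto simp: L2_def)
  have "cmod p * cmod q \<le> (cmod p)\<^sup>2 + (cmod q)\<^sup>2" for p q
    using sum_squares_bound[of "cmod p" "cmod q"]
      mult_nonneg_nonneg[OF norm_ge_zero[of p] norm_ge_zero[of q]] by linarith
  then show "AE x in lborel. norm (cnj (f x) * h x) \<le> norm ((cmod (f x))\<^sup>2 + (cmod (h x))\<^sup>2)"
    by (auto simp: norm_mult)
qed

lemma L2_Cauchy_Schwarz:
  assumes "f \<in> L2" "h \<in> L2"
  shows "cmod (L2_inner f h) \<le> L2_norm f * L2_norm h"
proof -
  note [measurable] = assms[THEN L2_borel]
  let ?I = "LINT x|lborel. cmod (cnj (f x) * h x)"
  have int: "integrable lborel (\<lambda>x. cmod (cnj (f x) * h x))"
    using L2_inner_integrable[OF assms] by auto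
  have I: "ennreal ?I = (\<integral>\<^sup>+ x. ennreal (cmod (f x)) * ennreal (cmod (h x)) \<partial>lborel)"
    using nn_integral_eq_integral[OF int] by (simp add: norm_mult ennreal_mult')
  have nn: "0 \<le> L2_norm f" "0 \<le> L2_norm h"
    by (auto simp: L2_norm_def)
  have "ennreal (?I\<^sup>2) = (ennreal ?I)\<^sup>2"
    by (simp add: ennreal_power)
  also have "\<dots> \<le> (\<integral>\<^sup>+ x. (ennreal (cmod (f x)))\<^sup>2 \<partial>lborel) * (\<integral>\<^sup>+ x. (ennreal (cmod (h x)))\<^sup>2 \<partial>lborel)"
    unfolding I by (rule Cauchy_Schwarz_nn_integral) measurable
  also have "\<dots> = ennreal ((L2_norm f * L2_norm h)\<^sup>2)"
    unfolding L2_nn_norm[OF assms(1)] L2_nn_norm[OF assms(2)] power_mult_distrib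
    by (rule ennreal_mult[symmetric]) auto
  finally have "?I\<^sup>2 \<le> (L2_norm f * L2_norm h)\<^sup>2"
    by (subst (asm) ennreal_le_iff) (rule zero_le_power2)
  then have "?I \<le> L2_norm f * L2_norm h"
    by (rule power2_le_imp_le) (use nn in auto)
  moreover have "cmod (L2_inner f h) \<le> ?I"
    unfolding L2_inner_def by (rule integral_norm_bound)
  ultimately show ?thesis
    by simp
qed

lemma L2_norm_eq_0_iff:
  assumes "f \<in> L2"
  shows "L2_norm f = 0 \<longleftrightarrow> (AE x in lborel. f x = 0)"
  using integral_nonneg_eq_0_iff_AE[OF L2_square_integrable[OF assms]]
  by (simp add: L2_norm_def)

lemma L2_norm_add_power2_le:
  assumes "f \<in> L2" "h \<in> L2"
  shows "(L2_norm (\<lambda>x. f x + h x))\<^sup>2 \<le> 2 * (L2_norm f)\<^sup>2 + 2 * (L2_norm h)\<^sup>2"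
proof -
  have "(LINT x|lborel. (cmod (f x + h x))\<^sup>2)
      \<le> (LINT x|lborel. 2 * (cmod (f x))\<^sup>2 + 2 * (cmod (h x))\<^sup>2)"
    using assms L2_add[OF assms] by (intro integral_mono norm_add_power2_le) (auto simp: L2_def)
  then show ?thesis
    using assms by (simp add: L2_norm_def L2_def)
qed

text \<open>
Used to identify two images under the semigroup that are limits of the same eigenfunction expansion.
\<close>
lemma L2_limit_unique:
  assumes F: "F \<noteq> bot" and s: "\<And>M. s M \<in> L2" and h: "h \<in> L2" "k \<in> L2"
    and lim: "((\<lambda>M. L2_norm (\<lambda>x. s M x - h x)) \<longlongrightarrow> 0) F" "((\<lambda>M. L2_norm (\<lambda>x. s M x - k x)) \<longlongrightarrow> 0) F"
  shows "AE x in lborel. h x = k x"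
proof -
  have sym: "L2_norm (\<lambda>x. h x - s M x) = L2_norm (\<lambda>x. s M x - h x)" for M
    by (simp add: L2_norm_def norm_minus_commute)
  have bound: "(L2_norm (\<lambda>x. h x - k x))\<^sup>2
      \<le> 2 * (L2_norm (\<lambda>x. s M x - h x))\<^sup>2 + 2 * (L2_norm (\<lambda>x. s M x - k x))\<^sup>2" for M
    using L2_norm_add_power2_le[OF L2_diff[OF h(1) s] L2_diff[OF s h(2)], of M M] by (simp add: sym)
  have "((\<lambda>M. 2 * (L2_norm (\<lambda>x. s M x - h x))\<^sup>2 + 2 * (L2_norm (\<lambda>x. s M x - k x))\<^sup>2)
      \<longlongrightarrow> 2 * 0\<^sup>2 + 2 * 0\<^sup>2) F"
    by (intro tendsto_intros lim)
  then have "(L2_norm (\<lambda>x. h x - k x))\<^sup>2 \<le> 2 * 0\<^sup>2 + 2 * 0\<^sup>2"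
    by (rule tendsto_lowerbound[OF _ always_eventually F]) (use bound in auto)
  then have "L2_norm (\<lambda>x. h x - k x) = 0"
    by simp
  then show ?thesis
    by (simp add: L2_norm_eq_0_iff[OF L2_diff[OF h]])
qed

lemma eigenbasis_L2: "eigenbasis V E e \<Longrightarrow> e m \<in> L2"
  by (simp add: eigenbasis_def schroedinger_def form_domain_def)

lemma L2_inner_sum:
  assumes "\<And>m. m \<in> M \<Longrightarrow> f m \<in> L2" "h \<in> L2"
  shows "L2_inner h (\<lambda>x. \<Sum>m\<in>M. c m * f m x) = (\<Sum>m\<in>M. c m * L2_inner h (f m))"
proof -
  have "L2_inner h (\<lambda>x. \<Sum>m\<in>M. c m * f m x) = (LINT x|lborel. (\<Sum>m\<in>M. c m * (cnj (h x) * f m x)))"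
    by (simp add: L2_inner_def sum_distrib_left mult_ac)
  also have "\<dots> = (\<Sum>m\<in>M. LINT x|lborel. c m * (cnj (h x) * f m x))"
    using assms by (intro Bochner_Integration.integral_sum integrable_mult_right L2_inner_integrable)
  finally show ?thesis
    by (simp add: L2_inner_def)
qed

lemma L2_inner_diff:
  assumes "h \<in> L2" "f \<in> L2" "k \<in> L2"
  shows "L2_inner h (\<lambda>x. f x - k x) = L2_inner h f - L2_inner h k"
  unfolding L2_inner_def right_diff_distrib
  by (intro Bochner_Integration.integral_diff L2_inner_integrable assms)

text \<open>
Once the finite set \<open>M\<close> contains \<open>m\<close>, the \<open>m\<close>-th coefficient of the partial sum over \<open>M\<close> no
longer changes, by orthonormality; the inner product is continuous in \<open>L\<^sup>2\<close>.
\<close>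
lemma exp_minus_tH_coefficient:
  fixes m :: "nat ^ 'd"
  assumes basis: "eigenbasis V E e" and S: "exp_minus_tH E e t f h"
  shows "L2_inner (e m) h = of_real (exp (- t * E m)) * L2_inner (e m) f"
proof -
  let ?F = "finite_subsets_at_top (UNIV :: (nat ^ 'd) set)"
  let ?c = "\<lambda>m. of_real (exp (- t * E m)) * L2_inner (e m) f"
  let ?s = "\<lambda>M x. \<Sum>n\<in>M. ?c n * e n x"
  note e = eigenbasis_L2[OF basis]
  have s: "?s M \<in> L2" for M
    by (rule L2_sum, rule L2_scale, rule e)
  have h: "h \<in> L2" and lim: "((\<lambda>M. L2_norm (\<lambda>x. ?s M x - h x)) \<longlongrightarrow> 0) ?F"
    using S by (auto simp: exp_minus_tH_def)
  have inner_s: "L2_inner (e m) (?s M) = ?c m" if "finite M" "m \<in> M" for M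
  proof -
    have "L2_inner (e m) (?s M) = (\<Sum>n\<in>M. ?c n * (if m = n then 1 else 0))"
      using basis by (subst L2_inner_sum) (auto simp: e eigenbasis_def)
    then show ?thesis
      using that by (simp add: if_distrib cong: if_cong)
  qed
  have diff: "L2_inner (e m) (\<lambda>x. ?s M x - h x) = L2_inner (e m) (?s M) - L2_inner (e m) h" for M
    by (rule L2_inner_diff[OF e s h])
  have "((\<lambda>M. L2_inner (e m) (\<lambda>x. ?s M x - h x)) \<longlongrightarrow> 0) ?F"
  proof (rule Lim_null_comparison)
    show "\<forall>\<^sub>F M in ?F. norm (L2_inner (e m) (\<lambda>x. ?s M x - h x))
        \<le> L2_norm (e m) * L2_norm (\<lambda>x. ?s M x - h x)"
      by (intro always_eventually allI L2_Cauchy_Schwarz e L2_diff s h)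
    show "((\<lambda>M. L2_norm (e m) * L2_norm (\<lambda>x. ?s M x - h x)) \<longlongrightarrow> 0) ?F"
      using tendsto_mult_right_zero[OF lim] by simp
  qed
  moreover have "\<forall>\<^sub>F M in ?F. L2_inner (e m) (\<lambda>x. ?s M x - h x) = ?c m - L2_inner (e m) h"
    unfolding eventually_finite_subsets_at_top
    by (intro exI[of _ "{m}"] conjI allI impI, simp, simp) (subst diff, subst inner_s, auto)
  ultimately have "((\<lambda>M. ?c m - L2_inner (e m) h) \<longlongrightarrow> 0) ?F"
    by (rule tendsto_cong[THEN iffD1, rotated])
  then have "?c m - L2_inner (e m) h = 0"
    using tendsto_unique[OF finite_subsets_at_top_neq_bot tendsto_const] by blast
  then show ?thesis
    by simp
qed

text \<open>
By the formula for the coefficients of \<open>k\<close>, the expansions that define \<open>h\<close> and \<open>h'\<close> have the same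
partial sums.
\<close>
lemma exp_minus_tH_semigroup:
  assumes basis: "eigenbasis V E e"
    and h: "exp_minus_tH E e (s + t) f h" and k: "exp_minus_tH E e t f k"
    and h': "exp_minus_tH E e s k h'"
  shows "AE x in lborel. h x = h' x"
proof (rule L2_limit_unique[of "finite_subsets_at_top UNIV"])
  let ?s = "\<lambda>M x. \<Sum>n\<in>M. of_real (exp (- (s + t) * E n)) * L2_inner (e n) f * e n x"
  show "?s M \<in> L2" for M
    by (rule L2_sum, rule L2_scale, rule eigenbasis_L2[OF basis])
  show "((\<lambda>M. L2_norm (\<lambda>x. ?s M x - h x)) \<longlongrightarrow> 0) (finite_subsets_at_top UNIV)" "h \<in> L2"
    using h by (auto simp: exp_minus_tH_def)
  have "exp (- (s + t) * E n) = exp (- s * E n) * exp (- t * E n)" for n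
    by (simp add: algebra_simps flip: exp_add)
  then have coeff: "?s M x = (\<Sum>n\<in>M. of_real (exp (- s * E n)) * L2_inner (e n) k * e n x)" for M x
    unfolding exp_minus_tH_coefficient[OF basis k] by (simp only: of_real_mult mult.assoc)
  then show "((\<lambda>M. L2_norm (\<lambda>x. ?s M x - h' x)) \<longlongrightarrow> 0) (finite_subsets_at_top UNIV)" "h' \<in> L2"
    unfolding coeff using h' by (simp_all only: exp_minus_tH_def)
qed (rule finite_subsets_at_top_neq_bot)

section \<open>Weak convergence of the sections of the kernel\<close>

text \<open>
Pointwise convergence and a bound in \<open>L\<^sup>2\<close> imply weak convergence in \<open>L\<^sup>2\<close>. Fatou's lemma for the
products bounds the limit from above. For the opposite inequality, Fatou's lemma is applied to the
squares \<open>(d * f n - h)\<^sup>2\<close>: expanding them bounds the defect of the mixed term by a multiple of \<open>d\<close>,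
and \<open>d\<close> is arbitrarily small.
\<close>
lemma nn_integral_product_tendsto:
  fixes f :: "nat \<Rightarrow> 'a \<Rightarrow> real" and F h :: "'a \<Rightarrow> real"
  assumes [measurable]: "\<And>n. f n \<in> borel_measurable M" "F \<in> borel_measurable M" "h \<in> borel_measurable M"
    and nonneg: "\<And>n x. 0 \<le> f n x" "\<And>x. 0 \<le> F x" "\<And>x. 0 \<le> h x"
    and lim: "\<And>x. (\<lambda>n. f n x) \<longlonglongrightarrow> F x"
    and C: "\<And>n. (\<integral>\<^sup>+ x. ennreal ((f n x)\<^sup>2) \<partial>M) \<le> ennreal C"
    and h2: "(\<integral>\<^sup>+ x. ennreal ((h x)\<^sup>2) \<partial>M) < \<infinity>"
    and c: "\<And>n. (\<integral>\<^sup>+ x. ennreal (f n x) * ennreal (h x) \<partial>M) = ennreal (c n)"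
       "\<And>n. 0 \<le> c n" "c \<longlonglongrightarrow> c'"
  shows "(\<integral>\<^sup>+ x. ennreal (F x) * ennreal (h x) \<partial>M) = ennreal c'"
proof -
  have "(\<integral>\<^sup>+ x. ennreal (F x * h x) \<partial>M) = (\<integral>\<^sup>+ x. liminf (\<lambda>n. ennreal (f n x * h x)) \<partial>M)"
    by (intro nn_integral_cong lim_imp_Liminf[symmetric] tendsto_ennrealI tendsto_mult_right lim) simp
  also have "\<dots> \<le> liminf (\<lambda>n. \<integral>\<^sup>+ x. ennreal (f n x * h x) \<partial>M)"
    by (rule nn_integral_liminf) simp
  also have "\<dots> = ennreal c'"
    using c nonneg by (intro lim_imp_Liminf) (auto simp: ennreal_mult' intro: tendsto_ennrealI)
  finally have up: "(\<integral>\<^sup>+ x. ennreal (F x * h x) \<partial>M) \<le> ennreal c'" .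
  have "(\<integral>\<^sup>+ x. ennreal ((F x)\<^sup>2) \<partial>M) = (\<integral>\<^sup>+ x. liminf (\<lambda>n. ennreal ((f n x)\<^sup>2)) \<partial>M)"
    by (intro nn_integral_cong lim_imp_Liminf[symmetric] tendsto_ennrealI tendsto_power lim) simp
  also have "\<dots> \<le> liminf (\<lambda>n. \<integral>\<^sup>+ x. ennreal ((f n x)\<^sup>2) \<partial>M)"
    by (rule nn_integral_liminf) simp
  also have "\<dots> \<le> liminf (\<lambda>n::nat. ennreal C)"
    by (intro Liminf_mono always_eventually allI C)
  also have "\<dots> = ennreal C"
    by (simp add: Liminf_const)
  finally have F2: "(\<integral>\<^sup>+ x. ennreal ((F x)\<^sup>2) \<partial>M) \<le> ennreal C" .
  have iF: "integrable M (\<lambda>x. (F x)\<^sup>2)" and ih: "integrable M (\<lambda>x. (h x)\<^sup>2)"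
    and iFh: "integrable M (\<lambda>x. F x * h x)"
    and "integrable M (\<lambda>x. (f n x)\<^sup>2)" and "integrable M (\<lambda>x. f n x * h x)" for n
    using F2 h2 up C[of n] c(1)[of n] nonneg
    by (auto intro!: integrableI_nonneg simp: ennreal_mult' intro: le_less_trans[OF _ ennreal_less_top])
  note int = this
  define a where "a = (LINT x|M. (F x)\<^sup>2)"
  define b where "b = (LINT x|M. (h x)\<^sup>2)"
  define I where "I = (LINT x|M. F x * h x)"
  have a: "0 \<le> a"
    by (simp add: a_def)
  have In: "(LINT x|M. f n x * h x) = c n" for n
    using c(1)[of n] c(2)[of n] nonneg nn_integral_eq_integral[OF int(5)[of n]]
    by (simp add: ennreal_mult')
  have an: "(LINT x|M. (f n x)\<^sup>2) \<le> max 0 C" for n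
    using C[of n] nn_integral_eq_integral[OF int(4)[of n]] by (auto simp: max_def ennreal_le_iff2 not_le split: if_splits)
  have main: "2 * d * (c' - I) \<le> d\<^sup>2 * max 0 C" if d: "0 < d" for d
  proof -
    have sq: "(\<integral>\<^sup>+ x. ennreal ((d * u x - h x)\<^sup>2) \<partial>M)
        = ennreal (d\<^sup>2 * (LINT x|M. (u x)\<^sup>2) - 2 * d * (LINT x|M. u x * h x) + b)"
      if "integrable M (\<lambda>x. (u x)\<^sup>2)" "integrable M (\<lambda>x. u x * h x)" for u
    proof -
      have eq: "(d * u x - h x)\<^sup>2 = d\<^sup>2 * (u x)\<^sup>2 - 2 * d * (u x * h x) + (h x)\<^sup>2" for x
        by (simp add: power2_eq_square algebra_simps)
      have "integrable M (\<lambda>x. (d * u x - h x)\<^sup>2)"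
        unfolding eq using that ih by auto
      then have "(\<integral>\<^sup>+ x. ennreal ((d * u x - h x)\<^sup>2) \<partial>M) = ennreal (LINT x|M. (d * u x - h x)\<^sup>2)"
        by (rule nn_integral_eq_integral) simp
      also have "(LINT x|M. (d * u x - h x)\<^sup>2)
          = d\<^sup>2 * (LINT x|M. (u x)\<^sup>2) - 2 * d * (LINT x|M. u x * h x) + b"
        unfolding eq b_def using that ih by simp
      finally show ?thesis .
    qed
    have "ennreal (d\<^sup>2 * a - 2 * d * I + b) = (\<integral>\<^sup>+ x. ennreal ((d * F x - h x)\<^sup>2) \<partial>M)"
      unfolding a_def I_def by (intro sq[symmetric] iF iFh)
    also have "\<dots> = (\<integral>\<^sup>+ x. liminf (\<lambda>n. ennreal ((d * f n x - h x)\<^sup>2)) \<partial>M)"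
      by (intro nn_integral_cong lim_imp_Liminf[symmetric] tendsto_ennrealI tendsto_intros lim) simp
    also have "\<dots> \<le> liminf (\<lambda>n. \<integral>\<^sup>+ x. ennreal ((d * f n x - h x)\<^sup>2) \<partial>M)"
      by (rule nn_integral_liminf) simp
    also have "\<dots> \<le> liminf (\<lambda>n. ennreal (d\<^sup>2 * max 0 C - 2 * d * c n + b))"
      unfolding sq[OF int(4) int(5)] In
      by (intro Liminf_mono always_eventually allI ennreal_leI add_right_mono diff_right_mono mult_left_mono an) simp
    also have "\<dots> = ennreal (d\<^sup>2 * max 0 C - 2 * d * c' + b)"
      by (intro lim_imp_Liminf tendsto_ennrealI tendsto_intros c) simp
    finally have *: "ennreal (d\<^sup>2 * a - 2 * d * I + b) \<le> ennreal (d\<^sup>2 * max 0 C - 2 * d * c' + b)" .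
    have "0 \<le> d\<^sup>2 * max 0 C - 2 * d * c' + b"
    proof (rule LIMSEQ_le_const)
      show "(\<lambda>n. d\<^sup>2 * max 0 C - 2 * d * c n + b) \<longlonglongrightarrow> d\<^sup>2 * max 0 C - 2 * d * c' + b"
        by (intro tendsto_intros c)
      have "0 \<le> d\<^sup>2 * max 0 C - 2 * d * c n + b" for n
      proof -
        have "0 \<le> (LINT x|M. (d * f n x - h x)\<^sup>2)"
          by simp
        also have "\<dots> = d\<^sup>2 * (LINT x|M. (f n x)\<^sup>2) - 2 * d * c n + b"
        proof -
          have eq: "(d * f n x - h x)\<^sup>2 = d\<^sup>2 * (f n x)\<^sup>2 - 2 * d * (f n x * h x) + (h x)\<^sup>2" for x
            by (simp add: power2_eq_square algebra_simps)
          show ?thesis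
            unfolding eq b_def In[symmetric] using int by simp
        qed
        also have "\<dots> \<le> d\<^sup>2 * max 0 C - 2 * d * c n + b"
          by (intro add_right_mono diff_right_mono mult_left_mono an) simp
        finally show ?thesis .
      qed
      then show "\<exists>N. \<forall>n\<ge>N. 0 \<le> d\<^sup>2 * max 0 C - 2 * d * c n + b"
        by auto
    qed
    with * have "d\<^sup>2 * a - 2 * d * I + b \<le> d\<^sup>2 * max 0 C - 2 * d * c' + b"
      by (simp add: ennreal_le_iff)
    moreover have "0 \<le> d\<^sup>2 * a"
      using a by simp
    ultimately show ?thesis
      by (simp add: algebra_simps)
  qed
  have "c' \<le> I + d" if "0 < d" for d :: real
  proof -
    \<comment> \<open>The summand 1 keeps the quotient defined when the bound vanishes.\<close>
    define \<delta> where "\<delta> = d / (max 0 C + 1)"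
    have \<delta>: "0 < \<delta>" "\<delta> * max 0 C \<le> d"
      using that by (auto simp: \<delta>_def field_simps max_def)
    have "2 * (c' - I) \<le> \<delta> * max 0 C"
      using main[OF \<delta>(1)] \<delta>(1) by (simp add: power2_eq_square mult.assoc mult_le_cancel_left_pos)
    also have "\<dots> \<le> d"
      by (rule \<delta>(2))
    finally show ?thesis
      using that by auto
  qed
  then have "c' \<le> I"
    by (rule field_le_epsilon)
  moreover have I: "(\<integral>\<^sup>+ x. ennreal (F x * h x) \<partial>M) = ennreal I"
    unfolding I_def using nonneg by (intro nn_integral_eq_integral iFh) auto
  ultimately have "(\<integral>\<^sup>+ x. ennreal (F x * h x) \<partial>M) = ennreal c'"
    using up by (metis antisym ennreal_leI)
  then show ?thesis
    using nonneg by (simp add: ennreal_mult')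
qed

section \<open>The Chapman-Kolmogorov identity almost everywhere\<close>
lemma green_continuous:
  assumes "green_function E e T g" "0 < t" "t \<le> T"
  shows "continuous_on UNIV (\<lambda>(x, y). g x t y)"
proof -
  let ?e = "\<lambda>p. (fst p, t, snd p)"
  have c: "continuous_on (UNIV \<times> {0<..T} \<times> UNIV) (\<lambda>(x, t, y). g x t y)"
    using assms(1) by (simp add: green_function_def)
  have "continuous_on UNIV ((\<lambda>(x, t, y). g x t y) \<circ> ?e)"
  proof (rule continuous_on_compose)
    show "continuous_on UNIV ?e"
      by (intro continuous_intros)
    show "continuous_on (range ?e) (\<lambda>(x, t, y). g x t y)"
      using assms(2,3) by (intro continuous_on_subset[OF c]) auto
  qed
  then show ?thesis
    by (simp add: comp_def case_prod_beta)
qed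

lemma green_measurable:
  assumes "green_function E e T g" "0 < t" "t \<le> T"
  shows "(\<lambda>(x, y). g x t y) \<in> borel_measurable (borel \<Otimes>\<^sub>M borel)"
  using borel_measurable_continuous_onI[OF green_continuous[OF assms]] by (simp add: borel_prod)

text \<open>
The semigroup law on the indicator function of \<open>A\<close>. Complex Bochner integrals become nonnegative
integrals because the kernel is positive.
\<close>
lemma green_semigroup_set:
  fixes g :: "real ^ 'd \<Rightarrow> real \<Rightarrow> real ^ 'd \<Rightarrow> real"
  assumes basis: "eigenbasis V E e" and g: "green_function E e T g"
    and st: "0 < s" "0 < t" "s + t \<le> T"
    and A: "A \<in> sets borel" "emeasure lborel A < \<infinity>"
  shows "AE x in lborel. (\<integral>\<^sup>+ y. ennreal (g x (s + t) y) * indicator A y \<partial>lborel)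
    = (\<integral>\<^sup>+ z. ennreal (g x s z) * (\<integral>\<^sup>+ y. ennreal (g z t y) * indicator A y \<partial>lborel) \<partial>lborel)"
proof -
  note [measurable] = A(1)
  define f :: "real ^ 'd \<Rightarrow> complex" where "f = (\<lambda>y. of_real (indicator A y))"
  have f: "f \<in> L2"
    using A by (auto simp: L2_def f_def power2_eq_square simp flip: indicator_inter_arith)
  define k where "k = (\<lambda>z. LINT y|lborel. of_real (g z t y) * f y)"
  define r where "r = (\<lambda>z. LINT y|lborel. g z t y * indicator A y)"
  have k_eq: "k z = of_real (r z)" for z
    unfolding k_def r_def f_def of_real_mult[symmetric] integral_complex_of_real ..
  have pos: "0 < g x u y" if "0 < u" "u \<le> T" for x u y
    using g that by (auto simp: green_function_def)
  have r_nonneg: "0 \<le> r z" for z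
    using pos[of t] st unfolding r_def by (intro Bochner_Integration.integral_nonneg) (simp add: less_imp_le)
  have kern: "AE x in lborel. integrable lborel (\<lambda>y. complex_of_real (g x u y) * h y)"
      "exp_minus_tH E e u h (\<lambda>x. LINT y|lborel. of_real (g x u y) * h y)"
    if "0 < u" "u \<le> T" "h \<in> L2" for u h
    using g that by (auto simp: green_function_def)
  have tT: "t \<le> T" "s \<le> T"
    using st by auto
  have k: "k \<in> L2" "exp_minus_tH E e t f k"
    using kern(2)[OF _ tT(1) f] st by (auto simp: k_def exp_minus_tH_def)
  have r_eq: "AE z in lborel. ennreal (r z) = (\<integral>\<^sup>+ y. ennreal (g z t y) * indicator A y \<partial>lborel)"
    using kern(1)[OF st(2) tT(1) f]
  proof eventually_elim
    case (elim z)
    then have "integrable lborel (\<lambda>y. g z t y * indicator A y)"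
      unfolding f_def of_real_mult[symmetric] complex_of_real_integrable_eq .
    then have "(\<integral>\<^sup>+ y. ennreal (g z t y * indicator A y) \<partial>lborel) = ennreal (r z)"
      unfolding r_def using pos[of t] st by (intro nn_integral_eq_integral) (auto simp: less_imp_le)
    then show ?case
      by (simp add: ennreal_mult'' ennreal_indicator)
  qed
  have "AE x in lborel. (LINT y|lborel. of_real (g x (s + t) y) * f y)
      = (LINT z|lborel. of_real (g x s z) * k z)"
    using st by (intro exp_minus_tH_semigroup[OF basis kern(2) k(2) kern(2)] f k tT) auto
  moreover have "AE x in lborel. integrable lborel (\<lambda>y. complex_of_real (g x (s + t) y) * f y)"
    using st by (intro kern f) auto
  moreover have "AE x in lborel. integrable lborel (\<lambda>z. complex_of_real (g x s z) * k z)"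
    using st by (intro kern k) auto
  ultimately show ?thesis
  proof eventually_elim
    case (elim x)
    have i1: "integrable lborel (\<lambda>y. g x (s + t) y * indicator A y)"
      using elim(2) unfolding f_def of_real_mult[symmetric] complex_of_real_integrable_eq .
    have i2: "integrable lborel (\<lambda>z. g x s z * r z)"
      using elim(3) unfolding k_eq of_real_mult[symmetric] complex_of_real_integrable_eq .
    have eq: "(LINT y|lborel. g x (s + t) y * indicator A y) = (LINT z|lborel. g x s z * r z)"
      using elim(1) unfolding f_def k_eq of_real_mult[symmetric] integral_complex_of_real of_real_eq_iff .
    have "(\<integral>\<^sup>+ y. ennreal (g x (s + t) y * indicator A y) \<partial>lborel)
        = ennreal (LINT y|lborel. g x (s + t) y * indicator A y)"
      using pos[of "s + t"] st by (intro nn_integral_eq_integral i1) (auto simp: less_imp_le)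
    also have "\<dots> = (\<integral>\<^sup>+ z. ennreal (g x s z * r z) \<partial>lborel)"
      unfolding eq using pos[of s x] st r_nonneg
      by (intro nn_integral_eq_integral[symmetric] i2) (auto simp: less_imp_le)
    also have "\<dots> = (\<integral>\<^sup>+ z. ennreal (g x s z) * (\<integral>\<^sup>+ y. ennreal (g z t y) * indicator A y \<partial>lborel) \<partial>lborel)"
      using r_eq by (intro nn_integral_cong_AE) (auto simp: ennreal_mult'' r_nonneg elim!: eventually_mono)
    finally show ?case
      by (simp add: ennreal_mult'' ennreal_indicator)
  qed
qed

text \<open>
By \<open>green_semigroup_set\<close> both sides have the same integral over every rectangle with a factor of finite
measure. They are compared as densities of measures on a bounded box, where the right-hand side is
integrable by continuity.
\<close>
lemma green_semigroup_AE:
  fixes g :: "real ^ 'd \<Rightarrow> real \<Rightarrow> real ^ 'd \<Rightarrow> real"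
  assumes basis: "eigenbasis V E e" and g: "green_function E e T g"
    and st: "0 < s" "0 < t" "s + t \<le> T"
  shows "AE p in lborel. (\<integral>\<^sup>+ z. ennreal (g (fst p) s z) * ennreal (g z t (snd p)) \<partial>lborel)
    = ennreal (g (fst p) (s + t) (snd p))"
proof -
  define G where "G = (\<lambda>p. ennreal (g (fst p) (s + t) (snd p)))"
  define K where "K = (\<lambda>p. \<integral>\<^sup>+ z. ennreal (g (fst p) s z) * ennreal (g z t (snd p)) \<partial>lborel)"
  have [measurable]: "(\<lambda>(x, y). g x u y) \<in> borel_measurable (borel \<Otimes>\<^sub>M borel)" if "u \<in> {s, t, s + t}" for u
    using st that by (intro green_measurable[OF g]) auto
  have [measurable]: "(\<lambda>(x, y). g x s y) \<in> borel_measurable (borel \<Otimes>\<^sub>M borel)"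
      "(\<lambda>(x, y). g x t y) \<in> borel_measurable (borel \<Otimes>\<^sub>M borel)"
      "(\<lambda>(x, y). g x (s + t) y) \<in> borel_measurable (borel \<Otimes>\<^sub>M borel)"
    by auto
  have G[measurable]: "G \<in> borel_measurable (borel \<Otimes>\<^sub>M borel)"
    unfolding G_def by measurable
  have K[measurable]: "K \<in> borel_measurable (borel \<Otimes>\<^sub>M borel)"
    unfolding K_def by measurable
  have Gb [measurable]: "G \<in> borel_measurable lborel" and Kb [measurable]: "K \<in> borel_measurable lborel"
    using G K by (simp_all add: borel_prod)
  have rect: "(\<integral>\<^sup>+ p. G p * indicator (A \<times> B) p \<partial>lborel) = (\<integral>\<^sup>+ p. K p * indicator (A \<times> B) p \<partial>lborel)"
    if [measurable]: "A \<in> sets borel" "B \<in> sets borel" and B: "emeasure lborel B < \<infinity>" for A B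
  proof -
    have "(\<integral>\<^sup>+ p. G p * indicator (A \<times> B) p \<partial>(lborel \<Otimes>\<^sub>M lborel))
        = (\<integral>\<^sup>+ x. \<integral>\<^sup>+ y. G (x, y) * indicator (A \<times> B) (x, y) \<partial>lborel \<partial>lborel)"
      by (rule lborel.nn_integral_fst[symmetric]) measurable
    also have "\<dots> = (\<integral>\<^sup>+ x. indicator A x * (\<integral>\<^sup>+ y. ennreal (g x (s + t) y) * indicator B y \<partial>lborel) \<partial>lborel)"
      by (simp add: G_def indicator_times mult_ac flip: nn_integral_cmult)
    also have "\<dots> = (\<integral>\<^sup>+ x. indicator A x * (\<integral>\<^sup>+ z. ennreal (g x s z) *
        (\<integral>\<^sup>+ y. ennreal (g z t y) * indicator B y \<partial>lborel) \<partial>lborel) \<partial>lborel)"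
      using green_semigroup_set[OF basis g st that(2) B]
      by (intro nn_integral_cong_AE) (auto elim!: eventually_mono)
    also have "\<dots> = (\<integral>\<^sup>+ x. \<integral>\<^sup>+ y. K (x, y) * indicator (A \<times> B) (x, y) \<partial>lborel \<partial>lborel)"
    proof (intro nn_integral_cong)
      fix x
      have "(\<integral>\<^sup>+ z. ennreal (g x s z) * (\<integral>\<^sup>+ y. ennreal (g z t y) * indicator B y \<partial>lborel) \<partial>lborel)
          = (\<integral>\<^sup>+ z. \<integral>\<^sup>+ y. ennreal (g x s z) * (ennreal (g z t y) * indicator B y) \<partial>lborel \<partial>lborel)"
        by (intro nn_integral_cong nn_integral_cmult[symmetric]) measurable
      also have "\<dots> = (\<integral>\<^sup>+ y. \<integral>\<^sup>+ z. ennreal (g x s z) * (ennreal (g z t y) * indicator B y) \<partial>lborel \<partial>lborel)"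
        by (rule lborel_pair.Fubini'[symmetric]) measurable
      also have "\<dots> = (\<integral>\<^sup>+ y. K (x, y) * indicator B y \<partial>lborel)"
        unfolding K_def fst_conv snd_conv
        by (intro nn_integral_cong) (simp add: nn_integral_multc flip: mult.assoc)
      finally show "indicator A x * (\<integral>\<^sup>+ z. ennreal (g x s z) *
          (\<integral>\<^sup>+ y. ennreal (g z t y) * indicator B y \<partial>lborel) \<partial>lborel)
          = (\<integral>\<^sup>+ y. K (x, y) * indicator (A \<times> B) (x, y) \<partial>lborel)"
        by (simp add: indicator_times mult_ac flip: nn_integral_cmult)
    qed
    also have "\<dots> = (\<integral>\<^sup>+ p. K p * indicator (A \<times> B) p \<partial>(lborel \<Otimes>\<^sub>M lborel))"
      by (rule lborel.nn_integral_fst) measurable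
    finally show ?thesis
      by (simp add: lborel_prod)
  qed
  have ball: "AE p in lborel. G p * indicator (cball 0 r \<times> cball 0 r) p = K p * indicator (cball 0 r \<times> cball 0 r) p" for r :: real
  proof -
    let ?B = "cball 0 r :: (real ^ 'd) set"
    let ?E = "{A \<times> B | A B. A \<in> sets (borel :: (real ^ 'd) measure) \<and> B \<in> sets (borel :: (real ^ 'd) measure)}"
    let ?G = "density lborel (\<lambda>p. G p * indicator (?B \<times> ?B) p)"
    let ?K = "density lborel (\<lambda>p. K p * indicator (?B \<times> ?B) p)"
    have BB [measurable]: "?B \<times> ?B \<in> sets lborel"
      by (auto simp: borel_prod[symmetric])
    have eq: "emeasure ?G (A \<times> B) = emeasure ?K (A \<times> B)"
      if [measurable]: "A \<in> sets borel" "B \<in> sets borel" for A B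
    proof -
      have fin: "emeasure lborel (?B \<inter> B) < \<infinity>"
        using emeasure_mono[of "?B \<inter> B" ?B lborel] emeasure_lborel_cball_finite[of 0 r]
        by (auto elim: le_less_trans)
      have AB: "A \<times> B \<in> sets borel"
        by (auto simp: borel_prod[symmetric])
      have ind: "F * indicator (?B \<times> ?B) p * indicator (A \<times> B) p = F * indicator ((?B \<inter> A) \<times> (?B \<inter> B)) p"
        for F :: ennreal and p
        by (auto simp: indicator_def)
      show ?thesis
        using rect[OF _ _ fin, of "?B \<inter> A"] by (subst (1 2) emeasure_density) (simp_all add: ind AB)
    qed
    have "?G = ?K"
    proof (rule measure_eqI_generator_eq[where E = ?E and \<Omega> = UNIV and A = "\<lambda>_. UNIV \<times> UNIV"])
      show "Int_stable ?E"
        by (rule Int_stable_pair_measure_generator)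
      have "sets (borel :: ((real ^ 'd) \<times> (real ^ 'd)) measure) = sigma_sets UNIV ?E"
        unfolding borel_prod[symmetric] sets_pair_measure by simp
      then show "sets ?G = sigma_sets UNIV ?E" "sets ?K = sigma_sets UNIV ?E"
        by auto
      show "emeasure ?G X = emeasure ?K X" if "X \<in> ?E" for X
        using that eq by auto
      have "compact ((\<lambda>(x, y). g x (s + t) y) ` (?B \<times> ?B))"
        using st by (intro compact_continuous_image continuous_on_subset[OF green_continuous[OF g]] compact_Times compact_cball) auto
      then obtain C where C: "\<forall>q \<in> (\<lambda>(x, y). g x (s + t) y) ` (?B \<times> ?B). norm q \<le> C"
        using compact_imp_bounded bounded_iff by blast
      have le: "g x (s + t) y \<le> C" if "x \<in> ?B" "y \<in> ?B" for x y
      proof -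
        have "norm ((\<lambda>(x, y). g x (s + t) y) (x, y)) \<le> C"
          by (rule C[rule_format], rule imageI) (use that in simp)
        then show ?thesis
          by simp
      qed
      have "emeasure ?G UNIV = (\<integral>\<^sup>+ p. G p * indicator (?B \<times> ?B) p \<partial>lborel)"
        using BB by (subst emeasure_density) simp_all
      also have "\<dots> \<le> (\<integral>\<^sup>+ p. ennreal C * indicator (?B \<times> ?B) p \<partial>lborel)"
        by (intro nn_integral_mono) (auto simp: indicator_def G_def intro!: ennreal_leI le)
      also have "\<dots> = ennreal C * emeasure lborel (?B \<times> ?B)"
        using BB by (simp add: nn_integral_cmult_indicator)
      also have "\<dots> < \<infinity>"
        using emeasure_bounded_finite[of "?B \<times> ?B"] by (simp add: ennreal_mult_less_top bounded_Times)
      finally show "emeasure ?G (UNIV \<times> UNIV) \<noteq> \<infinity>"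
        by simp
      have "UNIV \<times> UNIV \<in> ?E"
        by (intro CollectI exI[of _ UNIV] conjI refl) simp_all
      then show "range (\<lambda>_. UNIV \<times> UNIV) \<subseteq> ?E"
        by (rule image_subsetI)
    qed simp_all
    then show ?thesis
      using BB by (subst (asm) sigma_finite_measure.density_unique_iff[OF lborel.sigma_finite_measure_axioms]) simp_all
  qed
  have "AE p in lborel. \<forall>n::nat. G p * indicator (cball 0 n \<times> cball 0 n) p = K p * indicator (cball 0 n \<times> cball 0 n) p"
    using ball by (simp add: AE_all_countable)
  then show ?thesis
  proof eventually_elim
    case (elim p)
    obtain n :: nat where "max (norm (fst p)) (norm (snd p)) \<le> n"
      using real_arch_simple by blast
    then have "p \<in> cball 0 n \<times> cball 0 n"
      by (cases p) auto
    then show ?case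
      using elim[rule_format, of n] by (simp add: G_def K_def)
  qed
qed

section \<open>The Chapman-Kolmogorov identity at every pair of points\<close>

text \<open>
The complement of a null set is dense, as nonempty open sets have positive measure.
\<close>
lemma AE_lborel_sequence:
  fixes x :: "'a::euclidean_space"
  assumes "AE x in lborel. P x"
  shows "\<exists>X. (\<forall>n. P (X n)) \<and> X \<longlonglongrightarrow> x"
proof -
  have "\<exists>y. P y \<and> dist y x < 1 / Suc n" for n
  proof (rule ccontr)
    assume *: "\<not> ?thesis"
    have "AE y in lborel. y \<notin> ball x (1 / Suc n)"
      using assms by eventually_elim (use * in \<open>auto simp: dist_commute\<close>)
    then have "ball x (1 / Suc n) \<in> null_sets lborel"
      by (subst (asm) AE_iff_null_sets[symmetric]) auto
    then have "negligible (ball x (1 / Suc n))"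
      by (simp add: negligible_iff_null_sets null_sets_completionI)
    then show False
      using open_not_negligible[of "ball x (1 / Suc n)"] by simp
  qed
  then obtain X where X: "\<And>n. P (X n)" "\<And>n. dist (X n) x < 1 / Suc n"
    by metis
  have "X \<longlonglongrightarrow> x"
  proof (rule metric_LIMSEQ_I)
    fix r :: real assume "0 < r"
    then obtain N where N: "1 / Suc N < r"
      using nat_approx_posE by blast
    have "dist (X n) x < r" if "n \<ge> N" for n
    proof -
      have "1 / Suc n \<le> 1 / Suc N"
        using that by (simp add: field_simps)
      then show ?thesis
        using X(2)[of n] N by linarith
    qed
    then show "\<exists>no. \<forall>n\<ge>no. dist (X n) x < r"
      by blast
  qed
  then show ?thesis
    using X(1) by blast
qed

context
  fixes g :: "real ^ 'd \<Rightarrow> real \<Rightarrow> real ^ 'd \<Rightarrow> real" and T :: real and V E e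
  assumes basis: "eigenbasis V E e" and g: "green_function E e T g"
begin

lemma green_positive: "0 < t \<Longrightarrow> t \<le> T \<Longrightarrow> 0 < g x t y"
  and green_symmetric: "0 < t \<Longrightarrow> t \<le> T \<Longrightarrow> g x t y = g y t x"
  using g by (auto simp: green_function_def)

lemma green_tendsto:
  assumes "0 < t" "t \<le> T" "X \<longlonglongrightarrow> x" "Y \<longlonglongrightarrow> y"
  shows "(\<lambda>n. g (X n) t (Y n)) \<longlonglongrightarrow> g x t y"
proof -
  have "(\<lambda>n. (X n, Y n)) \<longlonglongrightarrow> (x, y)"
    using assms by (intro tendsto_Pair)
  from continuous_on_tendsto_compose[OF green_continuous[OF g assms(1,2)] this]
  have "(\<lambda>n. (\<lambda>(x, y). g x t y) (X n, Y n)) \<longlonglongrightarrow> (\<lambda>(x, y). g x t y) (x, y)"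
    by simp
  then show ?thesis
    by simp
qed

lemma green_section_measurable:
  assumes "0 < t" "t \<le> T"
  shows "(\<lambda>z. g x t z) \<in> borel_measurable borel" "(\<lambda>z. g z t x) \<in> borel_measurable borel"
proof -
  have [measurable]: "(\<lambda>(x, y). g x t y) \<in> borel_measurable (borel \<Otimes>\<^sub>M borel)"
    by (intro green_measurable[OF g] assms)
  show "(\<lambda>z. g x t z) \<in> borel_measurable borel" "(\<lambda>z. g z t x) \<in> borel_measurable borel"
    by measurable
qed

text \<open>
The exceptional points are approximated by regular ones; the integral is lower semicontinuous by Fatou's
lemma, and the right-hand side is continuous.
\<close>
lemma green_semigroup_le:
  assumes st: "0 < s" "0 < t" "s + t \<le> T"
  shows "(\<integral>\<^sup>+ z. ennreal (g x s z) * ennreal (g z t y) \<partial>lborel) \<le> ennreal (g x (s + t) y)"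
proof -
  obtain p where p: "\<And>n. (\<integral>\<^sup>+ z. ennreal (g (fst (p n)) s z) * ennreal (g z t (snd (p n))) \<partial>lborel)
      = ennreal (g (fst (p n)) (s + t) (snd (p n)))" "p \<longlonglongrightarrow> (x, y)"
    using AE_lborel_sequence[OF green_semigroup_AE[OF basis g st]] by blast
  have lim: "(\<lambda>n. fst (p n)) \<longlonglongrightarrow> x" "(\<lambda>n. snd (p n)) \<longlonglongrightarrow> y"
    using tendsto_fst[OF p(2)] tendsto_snd[OF p(2)] by auto
  have [measurable]: "(\<lambda>z. g w s z) \<in> borel_measurable borel" "(\<lambda>z. g z t w) \<in> borel_measurable borel" for w
    using st by (auto intro: green_section_measurable)
  have "(\<integral>\<^sup>+ z. ennreal (g x s z) * ennreal (g z t y) \<partial>lborel)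
      = (\<integral>\<^sup>+ z. liminf (\<lambda>n. ennreal (g (fst (p n)) s z * g z t (snd (p n)))) \<partial>lborel)"
  proof (intro nn_integral_cong)
    fix z
    have "(\<lambda>n. g (fst (p n)) s z * g z t (snd (p n))) \<longlonglongrightarrow> g x s z * g z t y"
      using st by (intro tendsto_mult green_tendsto lim tendsto_const) auto
    then have "liminf (\<lambda>n. ennreal (g (fst (p n)) s z * g z t (snd (p n)))) = ennreal (g x s z * g z t y)"
      by (intro lim_imp_Liminf tendsto_ennrealI) auto
    then show "ennreal (g x s z) * ennreal (g z t y) = liminf (\<lambda>n. ennreal (g (fst (p n)) s z * g z t (snd (p n))))"
      using green_positive[of s x z] green_positive[of t z y] st by (simp add: ennreal_mult)
  qed
  also have "\<dots> \<le> liminf (\<lambda>n. \<integral>\<^sup>+ z. ennreal (g (fst (p n)) s z * g z t (snd (p n))) \<partial>lborel)"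
    by (rule nn_integral_liminf) measurable
  also have "(\<lambda>n. \<integral>\<^sup>+ z. ennreal (g (fst (p n)) s z * g z t (snd (p n))) \<partial>lborel)
      = (\<lambda>n. ennreal (g (fst (p n)) (s + t) (snd (p n))))"
    using st green_positive by (simp add: ennreal_mult less_imp_le flip: p(1))
  also have "liminf \<dots> = ennreal (g x (s + t) y)"
    using st by (intro lim_imp_Liminf tendsto_ennrealI green_tendsto lim) auto
  finally show ?thesis .
qed

text \<open>
The diagonal case \<open>y = x\<close>, \<open>t = s\<close> of \<open>green_semigroup_le\<close>, which the almost everywhere identity
does not see: it makes the sections of the kernel square integrable, locally uniformly.
\<close>
lemma green_square_le:
  assumes "0 < s" "2 * s \<le> T"
  shows "(\<integral>\<^sup>+ z. ennreal ((g x s z)\<^sup>2) \<partial>lborel) \<le> ennreal (g x (2 * s) x)"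
proof -
  have "ennreal ((g x s z)\<^sup>2) = ennreal (g x s z) * ennreal (g z s x)" for z
    using green_positive[of s] green_symmetric[of s z x] assms
    by (simp add: power2_eq_square ennreal_mult less_imp_le)
  then show ?thesis
    using green_semigroup_le[of s s x x] assms by simp
qed

text \<open>
The first factor converges weakly and the second one is a fixed square-integrable function. Only one of
the two points may move at a time, since products of weakly convergent sequences need not converge.
\<close>
lemma green_section_limit:
  assumes st: "0 < s" "0 < t" "2 * s \<le> T" "2 * t \<le> T"
    and lim: "X \<longlonglongrightarrow> x"
    and eq: "\<And>n. (\<integral>\<^sup>+ z. ennreal (g (X n) s z) * ennreal (g z t y) \<partial>lborel) = ennreal (g (X n) (s + t) y)"
  shows "(\<integral>\<^sup>+ z. ennreal (g x s z) * ennreal (g z t y) \<partial>lborel) = ennreal (g x (s + t) y)"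
proof -
  have "(\<lambda>n. g (X n) (2 * s) (X n)) \<longlonglongrightarrow> g x (2 * s) x"
    using st by (intro green_tendsto lim) auto
  then have "Bseq (\<lambda>n. g (X n) (2 * s) (X n))"
    by (intro convergent_imp_Bseq convergentI)
  then obtain C where C: "\<And>n. norm (g (X n) (2 * s) (X n)) \<le> C"
    unfolding Bseq_def by blast
  show ?thesis
  proof (rule nn_integral_product_tendsto[where C = C])
    show "(\<lambda>n. g (X n) s z) \<longlonglongrightarrow> g x s z" for z
      using st by (intro green_tendsto lim tendsto_const) auto
    show "(\<integral>\<^sup>+ z. ennreal ((g (X n) s z)\<^sup>2) \<partial>lborel) \<le> ennreal C" for n
      using green_square_le[of s "X n"] st C[of n] by (auto intro: order_trans[OF _ ennreal_leI])
    have "(\<integral>\<^sup>+ z. ennreal ((g z t y)\<^sup>2) \<partial>lborel) = (\<integral>\<^sup>+ z. ennreal ((g y t z)\<^sup>2) \<partial>lborel)"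
      using st green_symmetric[of t _ y] by (intro nn_integral_cong) simp
    then show "(\<integral>\<^sup>+ z. ennreal ((g z t y)\<^sup>2) \<partial>lborel) < \<infinity>"
      using green_square_le[of t y] st by (auto intro: le_less_trans)
    show "(\<integral>\<^sup>+ z. ennreal (g (X n) s z) * ennreal (g z t y) \<partial>lborel) = ennreal (g (X n) (s + t) y)" for n
      by (rule eq)
    show "(\<lambda>n. g (X n) (s + t) y) \<longlonglongrightarrow> g x (s + t) y"
      using st by (intro green_tendsto lim tendsto_const) auto
  qed (use st green_positive green_section_measurable in \<open>auto intro: less_imp_le\<close>)
qed

lemma green_semigroup_commute:
  assumes "0 < s" "0 < t" "s \<le> T" "t \<le> T"
  shows "(\<integral>\<^sup>+ z. ennreal (g x s z) * ennreal (g z t y) \<partial>lborel) = (\<integral>\<^sup>+ z. ennreal (g y t z) * ennreal (g z s x) \<partial>lborel)"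
proof (rule nn_integral_cong)
  fix z show "ennreal (g x s z) * ennreal (g z t y) = ennreal (g y t z) * ennreal (g z s x)"
    unfolding green_symmetric[OF assms(1,3), of x z] green_symmetric[OF assms(2,4), of z y] by (rule mult.commute)
qed

text \<open>
For almost every \<open>x\<close> the identity holds for almost every \<open>y\<close>. It extends to every \<open>y\<close> for such
\<open>x\<close>, with the roles of the two points exchanged by symmetry, and then to every \<open>x\<close> for each \<open>y\<close>.
The diagonal bound requires \<open>2 * s\<close> and \<open>2 * t\<close> not to exceed \<open>T\<close>.
\<close>
lemma green_semigroup_half:
  assumes st: "0 < s" "0 < t" "2 * s \<le> T" "2 * t \<le> T"
  shows "(\<integral>\<^sup>+ z. ennreal (g x s z) * ennreal (g z t y) \<partial>lborel) = ennreal (g x (s + t) y)"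
proof -
  have st': "0 < s" "0 < t" "s + t \<le> T" "s \<le> T" "t \<le> T" "0 < s + t"
    using st by auto
  have "AE p in lborel \<Otimes>\<^sub>M lborel. (\<integral>\<^sup>+ z. ennreal (g (fst p) s z) * ennreal (g z t (snd p)) \<partial>lborel)
      = ennreal (g (fst p) (s + t) (snd p))"
    unfolding lborel_prod by (rule green_semigroup_AE[OF basis g st'(1-3)])
  then have AE: "AE x in lborel. AE y in lborel. (\<integral>\<^sup>+ z. ennreal (g x s z) * ennreal (g z t y) \<partial>lborel) = ennreal (g x (s + t) y)"
    using lborel_pair.AE_pair by fastforce
  then have "AE x in lborel. \<forall>y. (\<integral>\<^sup>+ z. ennreal (g x s z) * ennreal (g z t y) \<partial>lborel) = ennreal (g x (s + t) y)"
  proof eventually_elim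
    case (elim x)
    show ?case
    proof
      fix y
      obtain Y where Y: "\<And>n. (\<integral>\<^sup>+ z. ennreal (g x s z) * ennreal (g z t (Y n)) \<partial>lborel) = ennreal (g x (s + t) (Y n))"
          "Y \<longlonglongrightarrow> y"
        using AE_lborel_sequence[OF elim] by blast
      have "(\<integral>\<^sup>+ z. ennreal (g (Y n) t z) * ennreal (g z s x) \<partial>lborel) = ennreal (g (Y n) (t + s) x)" for n
        using Y(1)[of n] green_symmetric[OF st'(6,3), of x "Y n"]
        by (simp add: green_semigroup_commute[OF st'(1,2,4,5)] add.commute)
      then have "(\<integral>\<^sup>+ z. ennreal (g y t z) * ennreal (g z s x) \<partial>lborel) = ennreal (g y (t + s) x)"
        by (intro green_section_limit[OF st(2,1,4,3) Y(2)])
      then show "(\<integral>\<^sup>+ z. ennreal (g x s z) * ennreal (g z t y) \<partial>lborel) = ennreal (g x (s + t) y)"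
        using green_symmetric[OF st'(6,3), of x y]
        by (simp add: green_semigroup_commute[OF st'(1,2,4,5)] add.commute)
    qed
  qed
  from AE_lborel_sequence[OF this, of x]
  obtain X where X: "\<forall>n. \<forall>y. (\<integral>\<^sup>+ z. ennreal (g (X n) s z) * ennreal (g z t y) \<partial>lborel) = ennreal (g (X n) (s + t) y)"
      and lim: "X \<longlonglongrightarrow> x"
    by (elim exE conjE)
  show ?thesis
    by (rule green_section_limit[OF st lim]) (use X in simp)
qed

text \<open>
If \<open>s\<close> exceeds \<open>T / 2\<close>, the kernel at time \<open>s\<close> splits at time \<open>T / 2\<close>. After Fubini the remainder
\<open>s - T / 2\<close> is joined to \<open>t\<close>, and all times involved are at most \<open>T / 2\<close>.
\<close>
lemma green_semigroup_right:
  assumes st: "0 < s" "0 < t" "s + t \<le> T" "2 * t \<le> T"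
  shows "(\<integral>\<^sup>+ z. ennreal (g x s z) * ennreal (g z t y) \<partial>lborel) = ennreal (g x (s + t) y)"
proof (cases "2 * s \<le> T")
  case True
  then show ?thesis
    using st by (intro green_semigroup_half)
next
  case False
  \<comment> \<open>Here s > T / 2, so r is positive, and r + t is at most T / 2.\<close>
  define h r where "h = T / 2" and "r = s - T / 2"
  have hr: "0 < h" "0 < r" "2 * h \<le> T" "2 * r \<le> T" "2 * (r + t) \<le> T" "h + r = s" "h \<le> T" "r \<le> T" "t \<le> T"
    using False st by (auto simp: h_def r_def)
  have [measurable]: "(\<lambda>(x, y). g x u y) \<in> borel_measurable (borel \<Otimes>\<^sub>M borel)" if "u \<in> {h, r, t}" for u
    using st hr that by (intro green_measurable[OF g]) auto
  have [measurable]: "(\<lambda>(x, y). g x h y) \<in> borel_measurable (borel \<Otimes>\<^sub>M borel)"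
      "(\<lambda>(x, y). g x r y) \<in> borel_measurable (borel \<Otimes>\<^sub>M borel)"
      "(\<lambda>(x, y). g x t y) \<in> borel_measurable (borel \<Otimes>\<^sub>M borel)"
    by auto
  have "(\<integral>\<^sup>+ z. ennreal (g x s z) * ennreal (g z t y) \<partial>lborel)
      = (\<integral>\<^sup>+ z. (\<integral>\<^sup>+ w. ennreal (g x h w) * ennreal (g w r z) \<partial>lborel) * ennreal (g z t y) \<partial>lborel)"
    by (simp only: green_semigroup_half[OF hr(1-4)] hr(6))
  also have "\<dots> = (\<integral>\<^sup>+ z. \<integral>\<^sup>+ w. ennreal (g x h w) * (ennreal (g w r z) * ennreal (g z t y)) \<partial>lborel \<partial>lborel)"
    by (intro nn_integral_cong) (simp add: nn_integral_multc flip: mult.assoc)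
  also have "\<dots> = (\<integral>\<^sup>+ w. \<integral>\<^sup>+ z. ennreal (g x h w) * (ennreal (g w r z) * ennreal (g z t y)) \<partial>lborel \<partial>lborel)"
    by (rule lborel_pair.Fubini') measurable
  also have "\<dots> = (\<integral>\<^sup>+ w. ennreal (g x h w) * (\<integral>\<^sup>+ z. ennreal (g w r z) * ennreal (g z t y) \<partial>lborel) \<partial>lborel)"
    by (intro nn_integral_cong nn_integral_cmult) measurable
  also have "\<dots> = (\<integral>\<^sup>+ w. ennreal (g x h w) * ennreal (g w (r + t) y) \<partial>lborel)"
    using hr st by (subst green_semigroup_half) auto
  also have "\<dots> = ennreal (g x (h + (r + t)) y)"
    using hr st by (intro green_semigroup_half) auto
  finally show ?thesis
    using hr(6) by (simp add: add.assoc[symmetric])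
qed

theorem green_semigroup:
  assumes st: "0 < s" "0 < t" "s + t \<le> T"
  shows "(\<integral>\<^sup>+ z. ennreal (g x s z) * ennreal (g z t y) \<partial>lborel) = ennreal (g x (s + t) y)"
proof (cases "2 * t \<le> T")
  case True
  then show ?thesis
    using st by (intro green_semigroup_right)
next
  case False
  have "(\<integral>\<^sup>+ z. ennreal (g x s z) * ennreal (g z t y) \<partial>lborel) = ennreal (g y (t + s) x)"
    using st False by (subst green_semigroup_commute) (auto intro!: green_semigroup_right)
  also have "g y (t + s) x = g x (s + t) y"
    using st green_symmetric[of "s + t" y x] by (simp add: add.commute)
  finally show ?thesis .
qed

end

section \<open>Path weights\<close>

text \<open>
The construction of the bridge uses the Green function only through the following properties.
\<close>
locale green_kernel =
  fixes g :: "'a::euclidean_space \<Rightarrow> real \<Rightarrow> 'a \<Rightarrow> real" and T :: real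
  assumes T_pos: "0 < T"
    and kernel_measurable: "0 < t \<Longrightarrow> t \<le> T \<Longrightarrow> (\<lambda>(x, y). g x t y) \<in> borel_measurable (borel \<Otimes>\<^sub>M borel)"
    and kernel_pos: "0 < t \<Longrightarrow> t \<le> T \<Longrightarrow> 0 < g x t y"
    and kernel_sym: "0 < t \<Longrightarrow> t \<le> T \<Longrightarrow> g x t y = g y t x"
    and Chapman_Kolmogorov: "0 < s \<Longrightarrow> 0 < t \<Longrightarrow> s + t \<le> T \<Longrightarrow>
      (\<integral>\<^sup>+ z. ennreal (g x s z) * ennreal (g z t y) \<partial>lborel) = ennreal (g x (s + t) y)"
begin

lemma kernel_measurable_compose:
  assumes "0 < t" "t \<le> T" "X \<in> borel_measurable M" "Y \<in> borel_measurable M"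
  shows "(\<lambda>w. g (X w) t (Y w)) \<in> borel_measurable M"
  using measurable_compose[OF measurable_Pair[OF assms(3,4)] kernel_measurable[OF assms(1,2)]] by simp

text \<open>
The conditional density of the position at time \<open>r\<close> given the positions \<open>x\<close> at \<open>s\<close> and \<open>y\<close> at \<open>t\<close>.
\<close>
definition bridge_density :: "real \<Rightarrow> real \<Rightarrow> real \<Rightarrow> 'a \<Rightarrow> 'a \<Rightarrow> 'a \<Rightarrow> real" where
  "bridge_density s r t x y z = g x (r - s) z * g z (t - r) y / g x (t - s) y"

lemma bridge_density_pos: "0 \<le> s \<Longrightarrow> s < r \<Longrightarrow> r < t \<Longrightarrow> t \<le> T \<Longrightarrow> 0 < bridge_density s r t x y z"
  by (auto simp: bridge_density_def intro!: divide_pos_pos mult_pos_pos kernel_pos)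

lemma bridge_density_measurable [measurable (raw)]:
  assumes "0 \<le> s" "s < r" "r < t" "t \<le> T"
    and "X \<in> borel_measurable M" "Y \<in> borel_measurable M" "W \<in> borel_measurable M"
  shows "(\<lambda>w. bridge_density s r t (X w) (Y w) (W w)) \<in> borel_measurable M"
  unfolding bridge_density_def using assms
  by (intro borel_measurable_divide borel_measurable_times kernel_measurable_compose) auto

lemma bridge_density_mass:
  assumes "0 \<le> s" "s < r" "r < t" "t \<le> T"
  shows "(\<integral>\<^sup>+ z. ennreal (bridge_density s r t x y z) \<partial>lborel) = 1"
proof -
  have pos: "0 < g x (t - s) y"
    using assms by (intro kernel_pos) auto
  have "(\<integral>\<^sup>+ z. ennreal (bridge_density s r t x y z) \<partial>lborel)
      = (\<integral>\<^sup>+ z. ennreal (1 / g x (t - s) y) * (ennreal (g x (r - s) z) * ennreal (g z (t - r) y)) \<partial>lborel)"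
  proof (intro nn_integral_cong)
    fix z
    have "0 < g x (r - s) z" "0 < g z (t - r) y"
      using assms by (auto intro: kernel_pos)
    then show "ennreal (bridge_density s r t x y z)
        = ennreal (1 / g x (t - s) y) * (ennreal (g x (r - s) z) * ennreal (g z (t - r) y))"
      using pos by (simp add: bridge_density_def flip: ennreal_mult)
  qed
  also have "\<dots> = ennreal (1 / g x (t - s) y) * ennreal (g x ((r - s) + (t - r)) y)"
    using assms
    by (subst nn_integral_cmult) (auto intro!: kernel_measurable_compose borel_measurable_times_ennreal measurable_compose[OF _ measurable_ennreal] simp: Chapman_Kolmogorov)
  also have "\<dots> = 1"
    using pos by (simp flip: ennreal_mult)
  finally show ?thesis .
qed

definition interior_times :: "real set \<Rightarrow> bool" where
  "interior_times J \<longleftrightarrow> finite J \<and> J \<subseteq> {0<..<T}"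

definition successor :: "real set \<Rightarrow> real \<Rightarrow> real" where
  "successor J s = Min {t \<in> insert T J. s < t}"

lemma interior_times_empty: "interior_times {}"
  and interior_times_insert: "interior_times (insert r J) \<longleftrightarrow> r \<in> {0<..<T} \<and> interior_times J"
  by (auto simp: interior_times_def)

lemma interior_times_subset: "interior_times J \<Longrightarrow> I \<subseteq> J \<Longrightarrow> interior_times I"
  by (auto simp: interior_times_def intro: finite_subset)

lemma successor:
  assumes "interior_times J" "s < T"
  shows "successor J s \<in> insert T J" "s < successor J s" "successor J s \<le> T"
    "u \<in> insert T J \<Longrightarrow> s < u \<Longrightarrow> successor J s \<le> u"
proof -
  let ?S = "{t \<in> insert T J. s < t}"
  have fin: "finite ?S"
    using assms(1) by (simp add: interior_times_def)
  moreover have "?S \<noteq> {}"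
    using assms(2) by auto
  ultimately have "successor J s \<in> ?S"
    unfolding successor_def by (rule Min_in)
  then show "successor J s \<in> insert T J" "s < successor J s"
    by auto
  show "successor J s \<le> u" if "u \<in> insert T J" "s < u" for u
    unfolding successor_def using fin that by (intro Min_le) auto
  then show "successor J s \<le> T"
    using assms(2) by simp
qed

lemma successor_eqI:
  assumes "interior_times J" "t \<in> insert T J" "s < t" "\<And>u. u \<in> J \<Longrightarrow> s < u \<Longrightarrow> t \<le> u"
  shows "successor J s = t"
proof -
  have "t \<le> T"
    using assms(1,2) by (auto simp: interior_times_def)
  then have sT: "s < T"
    using assms(3) by simp
  have "t \<le> successor J s"
    using successor(1,2)[OF assms(1) sT] assms(4) \<open>t \<le> T\<close> by auto
  then show ?thesis
    using successor(4)[OF assms(1) sT assms(2,3)] by simp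
qed

text \<open>
The sampling times are kept as a finite set, so that inserting or forgetting a time needs no renumbering;
\<open>successor\<close> supplies the order. The endpoints \<open>0\<close> and \<open>T\<close> take part without belonging to the set.
\<close>
definition path_weight :: "real set \<Rightarrow> (real \<Rightarrow> 'a) \<Rightarrow> real" where
  "path_weight J z = (\<Prod>s\<in>insert 0 J. g (z s) (successor J s - s) (z (successor J s)))"

lemma path_weight_pos:
  assumes "interior_times J"
  shows "0 < path_weight J z"
  unfolding path_weight_def
proof (rule prod_pos)
  fix s assume "s \<in> insert 0 J"
  then have "0 \<le> s" "s < T"
    using assms T_pos by (auto simp: interior_times_def)
  then show "0 < g (z s) (successor J s - s) (z (successor J s))"
    using successor(2,3)[OF assms, of s] by (intro kernel_pos) auto
qed

lemma path_weight_cong: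
  assumes "interior_times J" "\<And>s. s \<in> insert 0 (insert T J) \<Longrightarrow> z s = z' s"
  shows "path_weight J z = path_weight J z'"
  unfolding path_weight_def
proof (rule prod.cong[OF refl])
  fix s assume s: "s \<in> insert 0 J"
  then have "s < T"
    using assms T_pos by (auto simp: interior_times_def)
  then have "successor J s \<in> insert 0 (insert T J)"
    using successor(1)[OF assms(1)] by auto
  then show "g (z s) (successor J s - s) (z (successor J s)) = g (z' s) (successor J s - s) (z' (successor J s))"
    using assms(2)[of s] assms(2)[of "successor J s"] s by auto
qed

text \<open>
Only the factor of the step from \<open>s\<close> to \<open>t\<close> is affected: it is replaced by the product of the steps
from \<open>s\<close> to \<open>r\<close> and from \<open>r\<close> to \<open>t\<close>.
\<close>
lemma path_weight_insert:
  assumes J: "interior_times J" and r: "r \<in> {0<..<T}" "r \<notin> J"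
    and s: "s \<in> insert 0 J" "s < r" and t: "successor J s = t" "r < t"
  shows "path_weight (insert r J) z = path_weight J z * bridge_density s r t (z s) (z t) (z r)"
proof -
  let ?J = "insert r J" and ?R = "insert 0 J - {s}"
  let ?q = "\<lambda>J s. g (z s) (successor J s - s) (z (successor J s))"
  have J': "interior_times ?J"
    using J r by (simp add: interior_times_insert)
  have sT: "s < T"
    using s r by auto
  note succ = successor[OF J sT, unfolded t(1)]
  have fin: "finite J"
    using J by (simp add: interior_times_def)
  have "successor ?J r = t"
  proof (rule successor_eqI[OF J'])
    show "t \<in> insert T ?J" "r < t"
      using succ t by auto
    show "t \<le> u" if "u \<in> ?J" "r < u" for u
      using that s succ(4)[of u] by auto
  qed
  moreover have "successor ?J s = r"
  proof (rule successor_eqI[OF J'])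
    show "r \<le> u" if "u \<in> ?J" "s < u" for u
      using that succ(4)[of u] t(2) by auto
  qed (use s in auto)
  moreover have "successor ?J u = successor J u" if u: "u \<in> ?R" for u
  proof (rule successor_eqI[OF J'])
    have uT: "u < T"
      using u J T_pos by (auto simp: interior_times_def)
    note su = successor[OF J uT]
    show "successor J u \<in> insert T ?J" "u < successor J u"
      using su by auto
    show "successor J u \<le> w" if w: "w \<in> ?J" "u < w" for w
    proof (cases "w = r")
      case True
      have "u < s"
      proof (rule ccontr)
        assume "\<not> u < s"
        then have "s < u"
          using u by auto
        moreover have "u \<in> J"
          using \<open>s < u\<close> u s J by (auto simp: interior_times_def)
        ultimately show False
          using succ(4)[of u] w True t by auto
      qed
      moreover have "s \<in> J"
        using \<open>u < s\<close> u s J by (auto simp: interior_times_def)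
      ultimately show ?thesis
        using su(4)[of s] s True by auto
    next
      case False
      then show ?thesis
        using w su(4)[of w] by auto
    qed
  qed
  ultimately have new: "path_weight ?J z = g (z r) (t - r) (z t) * (g (z s) (r - s) (z r) * (\<Prod>u\<in>?R. ?q J u))"
  proof -
    assume h: "successor ?J r = t" "successor ?J s = r" "\<And>u. u \<in> ?R \<Longrightarrow> successor ?J u = successor J u"
    have eq: "insert 0 ?J = insert r (insert s ?R)"
      using s by auto
    have "path_weight ?J z = ?q ?J r * (?q ?J s * (\<Prod>u\<in>?R. ?q ?J u))"
      unfolding path_weight_def eq using fin r s by (subst prod.insert, simp, force, subst prod.insert) auto
    also have "(\<Prod>u\<in>?R. ?q ?J u) = (\<Prod>u\<in>?R. ?q J u)"
      by (rule prod.cong) (simp_all add: h(3))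
    finally show ?thesis
      by (simp only: h(1,2))
  qed
  have old: "path_weight J z = g (z s) (t - s) (z t) * (\<Prod>u\<in>?R. ?q J u)"
    unfolding path_weight_def using fin s(1) by (subst prod.remove[of _ s]) (simp_all add: t(1))
  have "0 \<le> s"
    using s(1) J by (auto simp: interior_times_def)
  then have "g (z s) (t - s) (z t) \<noteq> 0"
    using kernel_pos[of "t - s" "z s" "z t"] s t succ(3) by auto
  then show ?thesis
    unfolding new old bridge_density_def by (simp add: field_simps)
qed

end

section \<open>The finite-dimensional laws of the bridge\<close>
locale pinned_bridge = green_kernel g T for g :: "'a::euclidean_space \<Rightarrow> real \<Rightarrow> 'a \<Rightarrow> real" and T +
  fixes a b :: 'a
begin

text \<open>
The coordinate process with the deterministic values \<open>a\<close> and \<open>b\<close> at the two ends, where no density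
exists. Only the coordinates in the open interval are random.
\<close>
definition pinned :: "real \<Rightarrow> (real \<Rightarrow> 'a) \<Rightarrow> 'a" where
  "pinned \<tau> \<xi> = (if \<tau> \<le> 0 then a else if T \<le> \<tau> then b else \<xi> \<tau>)"

lemma pinned_simps [simp]: "pinned 0 \<xi> = a" "pinned T \<xi> = b" "\<tau> \<in> {0<..<T} \<Longrightarrow> pinned \<tau> \<xi> = \<xi> \<tau>"
  using T_pos by (auto simp: pinned_def)

lemma pinned_measurable:
  assumes "\<tau> \<in> {0<..<T} \<Longrightarrow> \<tau> \<in> J"
  shows "pinned \<tau> \<in> borel_measurable (PiM J (\<lambda>_. borel))"
proof (cases "\<tau> \<in> {0<..<T}")
  case True
  then show ?thesis
    using assms by (simp add: pinned_def[abs_def] not_le measurable_component_singleton)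
next
  case False
  then have "pinned \<tau> = (\<lambda>_. if \<tau> \<le> 0 then a else b)"
    by (auto simp: pinned_def)
  then show ?thesis
    by simp
qed

lemma pinned_restrict: "(\<tau> \<in> {0<..<T} \<Longrightarrow> \<tau> \<in> J) \<Longrightarrow> pinned \<tau> (restrict \<xi> J) = pinned \<tau> \<xi>"
  by (auto simp: pinned_def)

lemma pinned_upd: "pinned \<tau> (\<xi>(r := y)) = (if \<tau> = r \<and> r \<in> {0<..<T} then y else pinned \<tau> \<xi>)"
  by (auto simp: pinned_def)

definition bridge_law :: "real set \<Rightarrow> (real \<Rightarrow> 'a) measure" where
  "bridge_law J = density (PiM J (\<lambda>_. lborel)) (\<lambda>\<xi>. ennreal (path_weight J (\<lambda>\<tau>. pinned \<tau> \<xi>) / g a T b))"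

lemma sets_bridge_law [simp, measurable_cong]: "sets (bridge_law J) = sets (PiM J (\<lambda>_. borel))"
  by (simp add: bridge_law_def cong: sets_PiM_cong)

lemma space_bridge_law [simp]: "space (bridge_law J) = space (PiM J (\<lambda>_. borel))"
  by (rule sets_eq_imp_space_eq) simp

lemma measurable_PiM_lborel: "measurable (PiM J (\<lambda>_. lborel)) N = measurable (PiM J (\<lambda>_. borel)) N"
  by (intro measurable_cong_sets sets_PiM_cong) auto

lemma path_weight_measurable:
  assumes J: "interior_times J"
  shows "(\<lambda>\<xi>. path_weight J (\<lambda>\<tau>. pinned \<tau> \<xi>)) \<in> borel_measurable (PiM J (\<lambda>_. borel))"
  unfolding path_weight_def
proof (rule borel_measurable_prod)
  fix s assume s: "s \<in> insert 0 J"
  then have "0 \<le> s" "s < T"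
    using J T_pos by (auto simp: interior_times_def)
  note succ = successor[OF J \<open>s < T\<close>]
  show "(\<lambda>\<xi>. g (pinned s \<xi>) (successor J s - s) (pinned (successor J s) \<xi>)) \<in> borel_measurable (PiM J (\<lambda>_. borel))"
    using succ s \<open>0 \<le> s\<close> by (intro kernel_measurable_compose pinned_measurable) auto
qed

lemma bridge_density_pinned_measurable:
  assumes "0 \<le> s" "s < r" "r < t" "t \<le> T" "s \<in> {0<..<T} \<Longrightarrow> s \<in> J" "t \<in> {0<..<T} \<Longrightarrow> t \<in> J"
  shows "(\<lambda>(\<xi>, y). bridge_density s r t (pinned s \<xi>) (pinned t \<xi>) y) \<in> borel_measurable (PiM J (\<lambda>_. borel) \<Otimes>\<^sub>M borel)"
proof -
  have [measurable]: "pinned s \<in> borel_measurable (PiM J (\<lambda>_. borel))" "pinned t \<in> borel_measurable (PiM J (\<lambda>_. borel))"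
    using assms by (auto intro: pinned_measurable)
  show ?thesis
    unfolding case_prod_beta using assms(1-4) by (intro bridge_density_measurable) measurable
qed

text \<open>
Disintegration of the law over \<open>insert r J\<close>: the new coordinate is drawn from the bridge density between
the neighbours of \<open>r\<close>. This yields both the consistency of the laws, when \<open>f\<close> ignores the new
coordinate, and the conditional law of that coordinate.
\<close>
lemma nn_integral_bridge_law_insert:
  assumes J: "interior_times J" and r: "r \<in> {0<..<T}" "r \<notin> J"
    and s: "s \<in> insert 0 J" "s < r" and t: "successor J s = t" "r < t"
    and f: "f \<in> borel_measurable (PiM (insert r J) (\<lambda>_. borel))"
  shows "(\<integral>\<^sup>+ \<xi>. f \<xi> \<partial>bridge_law (insert r J))
    = (\<integral>\<^sup>+ \<xi>. (\<integral>\<^sup>+ y. ennreal (bridge_density s r t (pinned s \<xi>) (pinned t \<xi>) y) * f (\<xi>(r := y)) \<partial>lborel) \<partial>bridge_law J)"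
proof -
  interpret product_sigma_finite "\<lambda>_::real. lborel :: 'a measure" ..
  have J': "interior_times (insert r J)"
    using J r by (simp add: interior_times_insert)
  have fin: "finite J"
    using J by (simp add: interior_times_def)
  have st: "0 \<le> s" "s < T"
    using s(1) J T_pos by (auto simp: interior_times_def)
  note succ = successor[OF J st(2), unfolded t(1)]
  let ?w = "\<lambda>J \<xi>. ennreal (path_weight J (\<lambda>\<tau>. pinned \<tau> \<xi>) / g a T b)"
  let ?B = "\<lambda>\<xi> y. ennreal (bridge_density s r t (pinned s \<xi>) (pinned t \<xi>) y)"
  have g0: "0 < g a T b"
    using T_pos by (intro kernel_pos) auto
  have [measurable]: "(\<lambda>\<xi>. path_weight J (\<lambda>\<tau>. pinned \<tau> \<xi>)) \<in> borel_measurable (PiM J (\<lambda>_. borel))"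
      "(\<lambda>\<xi>. path_weight (insert r J) (\<lambda>\<tau>. pinned \<tau> \<xi>)) \<in> borel_measurable (PiM (insert r J) (\<lambda>_. borel))"
    by (intro path_weight_measurable J J')+
  note f [measurable]
  have B [measurable]: "(\<lambda>(\<xi>, y). bridge_density s r t (pinned s \<xi>) (pinned t \<xi>) y) \<in> borel_measurable (PiM J (\<lambda>_. borel) \<Otimes>\<^sub>M borel)"
    using st s t succ by (intro bridge_density_pinned_measurable) auto
  have upd [measurable]: "(\<lambda>(\<xi>, y). \<xi>(r := y)) \<in> PiM J (\<lambda>_. borel) \<Otimes>\<^sub>M borel \<rightarrow>\<^sub>M PiM (insert r J) (\<lambda>_. borel :: 'a measure)"
    by (rule measurable_add_dim)
  have split: "?w (insert r J) (\<xi>(r := y)) = ?w J \<xi> * ?B \<xi> y" for \<xi> y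
  proof -
    have "path_weight (insert r J) (\<lambda>\<tau>. pinned \<tau> (\<xi>(r := y)))
        = path_weight J (\<lambda>\<tau>. pinned \<tau> (\<xi>(r := y))) * bridge_density s r t (pinned s \<xi>) (pinned t \<xi>) y"
      using s t r by (subst path_weight_insert[OF J r s t]) (auto simp: pinned_upd)
    also have "path_weight J (\<lambda>\<tau>. pinned \<tau> (\<xi>(r := y))) = path_weight J (\<lambda>\<tau>. pinned \<tau> \<xi>)"
      using r by (intro path_weight_cong[OF J]) (auto simp: pinned_upd)
    finally have eq: "path_weight (insert r J) (\<lambda>\<tau>. pinned \<tau> (\<xi>(r := y)))
        = path_weight J (\<lambda>\<tau>. pinned \<tau> \<xi>) * bridge_density s r t (pinned s \<xi>) (pinned t \<xi>) y" .
    show ?thesis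
      unfolding eq using g0 path_weight_pos[OF J] bridge_density_pos[of s r t] st s t succ
      by (simp add: less_imp_le flip: ennreal_mult)
  qed
  have "(\<integral>\<^sup>+ \<xi>. f \<xi> \<partial>bridge_law (insert r J)) = (\<integral>\<^sup>+ \<xi>. ?w (insert r J) \<xi> * f \<xi> \<partial>PiM (insert r J) (\<lambda>_. lborel))"
    unfolding bridge_law_def by (rule nn_integral_density) (simp_all add: measurable_PiM_lborel)
  also have "\<dots> = (\<integral>\<^sup>+ \<xi>. \<integral>\<^sup>+ y. ?w (insert r J) (\<xi>(r := y)) * f (\<xi>(r := y)) \<partial>lborel \<partial>PiM J (\<lambda>_. lborel))"
    by (rule product_nn_integral_insert[OF fin r(2)]) (simp add: measurable_PiM_lborel)
  also have "\<dots> = (\<integral>\<^sup>+ \<xi>. ?w J \<xi> * (\<integral>\<^sup>+ y. ?B \<xi> y * f (\<xi>(r := y)) \<partial>lborel) \<partial>PiM J (\<lambda>_. lborel))"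
  proof (rule nn_integral_cong)
    fix \<xi> assume "\<xi> \<in> space (PiM J (\<lambda>_. lborel :: 'a measure))"
    then have [measurable]: "\<xi> \<in> space (PiM J (\<lambda>_. borel :: 'a measure))"
      by (simp add: space_PiM)
    have "(\<lambda>y. ?B \<xi> y * f (\<xi>(r := y))) \<in> borel_measurable borel"
      by measurable
    then show "(\<integral>\<^sup>+ y. ?w (insert r J) (\<xi>(r := y)) * f (\<xi>(r := y)) \<partial>lborel) = ?w J \<xi> * (\<integral>\<^sup>+ y. ?B \<xi> y * f (\<xi>(r := y)) \<partial>lborel)"
      unfolding split mult.assoc by (intro nn_integral_cmult) simp
  qed
  also have "\<dots> = (\<integral>\<^sup>+ \<xi>. (\<integral>\<^sup>+ y. ?B \<xi> y * f (\<xi>(r := y)) \<partial>lborel) \<partial>bridge_law J)"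
    unfolding bridge_law_def by (rule nn_integral_density[symmetric]) (simp_all add: measurable_PiM_lborel)
  finally show ?thesis .
qed

lemma predecessor_exists:
  assumes J: "interior_times J" and r: "r \<in> {0<..<T}" "r \<notin> J"
  obtains s where "s \<in> insert 0 J" "s < r" "r < successor J s"
proof -
  let ?S = "{s \<in> insert 0 J. s < r}"
  define s where "s = Max ?S"
  have fin: "finite ?S" "?S \<noteq> {}"
    using J r by (auto simp: interior_times_def)
  then have s: "s \<in> ?S"
    unfolding s_def by (rule Max_in)
  have sT: "s < T"
    using s r by auto
  have "r < successor J s"
  proof (rule ccontr)
    assume "\<not> ?thesis"
    then have *: "successor J s \<le> r"
      by simp
    then have "successor J s \<in> ?S"
      using successor(1)[OF J sT] r by (cases "successor J s = r") auto
    then have "successor J s \<le> s"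
      unfolding s_def using fin by (intro Max_ge) auto
    then show False
      using successor(2)[OF J sT] by simp
  qed
  then show ?thesis
    using s that by auto
qed

text \<open>
A test function that ignores the coordinate \<open>r\<close> only sees the mass one of the bridge density.
\<close>
lemma distr_bridge_law_insert:
  assumes J: "interior_times J" and r: "r \<in> {0<..<T}" "r \<notin> J"
  shows "distr (bridge_law (insert r J)) (PiM J (\<lambda>_. borel)) (\<lambda>\<xi>. restrict \<xi> J) = bridge_law J"
proof (rule measure_eqI)
  obtain s where s: "s \<in> insert 0 J" "s < r" "r < successor J s"
    using predecessor_exists[OF J r] .
  have st: "0 \<le> s" "s < T"
    using s(1) J T_pos by (auto simp: interior_times_def)
  have t: "successor J s \<le> T"
    using successor(3)[OF J st(2)] .
  have [measurable]: "(\<lambda>\<xi>. restrict \<xi> J) \<in> PiM (insert r J) (\<lambda>_. borel) \<rightarrow>\<^sub>M PiM J (\<lambda>_. borel :: 'a measure)"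
    by (rule measurable_restrict_subset) auto
  fix A assume "A \<in> sets (distr (bridge_law (insert r J)) (PiM J (\<lambda>_. borel)) (\<lambda>\<xi>. restrict \<xi> J))"
  then have A [measurable]: "A \<in> sets (PiM J (\<lambda>_. borel))"
    by simp
  have "emeasure (distr (bridge_law (insert r J)) (PiM J (\<lambda>_. borel)) (\<lambda>\<xi>. restrict \<xi> J)) A
      = (\<integral>\<^sup>+ \<xi>. indicator A (restrict \<xi> J) \<partial>bridge_law (insert r J))"
    by (subst nn_integral_indicator[symmetric], simp, subst nn_integral_distr) simp_all
  also have "\<dots> = (\<integral>\<^sup>+ \<xi>. (\<integral>\<^sup>+ y. ennreal (bridge_density s r (successor J s) (pinned s \<xi>) (pinned (successor J s) \<xi>) y)
      * indicator A (restrict (\<xi>(r := y)) J) \<partial>lborel) \<partial>bridge_law J)"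
    by (rule nn_integral_bridge_law_insert[OF J r s(1,2) refl s(3)]) measurable
  also have "\<dots> = (\<integral>\<^sup>+ \<xi>. indicator A \<xi> \<partial>bridge_law J)"
  proof (rule nn_integral_cong)
    fix \<xi> assume "\<xi> \<in> space (bridge_law J)"
    then have "restrict (\<xi>(r := y)) J = \<xi>" for y
      using r(2) by (auto simp: space_PiM PiE_def extensional_def restrict_def fun_eq_iff)
    then show "(\<integral>\<^sup>+ y. ennreal (bridge_density s r (successor J s) (pinned s \<xi>) (pinned (successor J s) \<xi>) y)
        * indicator A (restrict (\<xi>(r := y)) J) \<partial>lborel) = indicator A \<xi>"
      using st t s by (simp add: nn_integral_multc bridge_density_mass)
  qed
  also have "\<dots> = emeasure (bridge_law J) A"
    by simp
  finally show "emeasure (distr (bridge_law (insert r J)) (PiM J (\<lambda>_. borel)) (\<lambda>\<xi>. restrict \<xi> J)) A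
      = emeasure (bridge_law J) A" .
qed simp

lemma distr_bridge_law:
  assumes "interior_times H" "J \<subseteq> H"
  shows "distr (bridge_law H) (PiM J (\<lambda>_. borel)) (\<lambda>\<xi>. restrict \<xi> J) = bridge_law J"
proof -
  have "finite (H - J)"
    using assms by (simp add: interior_times_def)
  moreover have "distr (bridge_law (D \<union> J)) (PiM J (\<lambda>_. borel)) (\<lambda>\<xi>. restrict \<xi> J) = bridge_law J"
    if "finite D" "D \<subseteq> H - J" for D
    using that
  proof (induction D)
    case empty
    have "distr (bridge_law J) (PiM J (\<lambda>_. borel)) (\<lambda>\<xi>. restrict \<xi> J) = distr (bridge_law J) (bridge_law J) (\<lambda>\<xi>. \<xi>)"
      by (intro distr_cong) (auto simp: space_PiM)
    also have "\<dots> = bridge_law J"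
      by (rule distr_id)
    finally show ?case
      by (simp only: Un_empty_left)
  next
    case (insert r D)
    let ?H = "D \<union> J"
    have H: "interior_times ?H"
      using insert.prems assms by (intro interior_times_subset[OF assms(1)]) auto
    have r: "r \<in> {0<..<T}" "r \<notin> ?H"
      using insert assms by (auto simp: interior_times_def)
    have m: "(\<lambda>\<xi>. restrict \<xi> J) \<in> PiM ?H (\<lambda>_. borel) \<rightarrow>\<^sub>M PiM J (\<lambda>_. borel :: 'a measure)"
        "(\<lambda>\<xi>. restrict \<xi> ?H) \<in> PiM (insert r ?H) (\<lambda>_. borel) \<rightarrow>\<^sub>M PiM ?H (\<lambda>_. borel :: 'a measure)"
      by (rule measurable_restrict_subset, auto)+
    have "bridge_law J = distr (distr (bridge_law (insert r ?H)) (PiM ?H (\<lambda>_. borel)) (\<lambda>\<xi>. restrict \<xi> ?H)) (PiM J (\<lambda>_. borel)) (\<lambda>\<xi>. restrict \<xi> J)"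
      unfolding distr_bridge_law_insert[OF H r] by (rule insert.IH[symmetric]) (use insert.prems in auto)
    also have "\<dots> = distr (bridge_law (insert r ?H)) (PiM J (\<lambda>_. borel)) ((\<lambda>\<xi>. restrict \<xi> J) \<circ> (\<lambda>\<xi>. restrict \<xi> ?H))"
      using m by (intro distr_distr) simp_all
    also have "(\<lambda>\<xi>. restrict \<xi> J) \<circ> (\<lambda>\<xi>. restrict \<xi> ?H) = (\<lambda>\<xi> :: real \<Rightarrow> 'a. restrict \<xi> J)"
      by (auto simp: fun_eq_iff restrict_def)
    finally show ?case
      by (simp only: Un_insert_left)
  qed
  moreover have "H - J \<union> J = H"
    using assms(2) by auto
  ultimately show ?thesis
    by (metis order_refl)
qed

lemma prob_space_bridge_law:
  assumes "interior_times J"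
  shows "prob_space (bridge_law J)"
proof -
  have g0: "0 < g a T b"
    using T_pos by (intro kernel_pos) auto
  have succ: "successor {} 0 = T"
    using T_pos by (intro successor_eqI interior_times_empty) auto
  have "prob_space (bridge_law {})"
  proof (rule prob_spaceI)
    show "emeasure (bridge_law {}) (space (bridge_law {})) = 1"
      using g0 by (simp add: bridge_law_def emeasure_density path_weight_def succ PiM_empty
         one_ennreal_def[symmetric] nn_integral_count_space_finite)
  qed
  then have "prob_space (distr (bridge_law J) (PiM {} (\<lambda>_. borel)) (\<lambda>\<xi>. restrict \<xi> {}))"
    using assms by (simp only: distr_bridge_law empty_subsetI)
  then show ?thesis
    by (rule prob_space_distrD[rotated])
      (unfold measurable_cong_sets[OF sets_bridge_law refl], rule measurable_restrict_subset, simp)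
qed

sublocale projective: polish_projective "{0<..<T}" bridge_law
proof (intro polish_projective.intro projective_family.intro)
  show "bridge_law J = distr (bridge_law H) (PiM J (\<lambda>_. borel)) (\<lambda>f. restrict f J)"
    if "J \<subseteq> H" "finite H" "H \<subseteq> {0<..<T}" for J H
    using that by (intro distr_bridge_law[symmetric]) (auto simp: interior_times_def)
  show "prob_space (bridge_law J)" if "finite J" "J \<subseteq> {0<..<T}" for J
    using that by (intro prob_space_bridge_law) (auto simp: interior_times_def)
qed

end

section \<open>The process and its conditional laws\<close>
lemma generated_space [simp]: "space (generated P Z K) = space P"
  by (simp add: generated_def space_measure_of_conv)

lemma generated_sets:
  "sets (generated P Z K) = sigma_sets (space P) {Z \<tau> -` F \<inter> space P | \<tau> F. \<tau> \<in> K \<and> F \<in> sets borel}"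
  unfolding generated_def by (rule sets_measure_of) auto

lemma generated_measurable:
  assumes "\<tau> \<in> K"
  shows "Z \<tau> \<in> borel_measurable (generated P Z K)"
proof (rule measurableI)
  show "Z \<tau> -` F \<inter> space (generated P Z K) \<in> sets (generated P Z K)" if "F \<in> sets borel" for F
    using that assms unfolding generated_sets generated_space by (intro sigma_sets.Basic) auto
qed simp

lemma generated_subalgebra:
  assumes "\<And>\<tau>. \<tau> \<in> K \<Longrightarrow> Z \<tau> \<in> borel_measurable P"
  shows "subalgebra P (generated P Z K)"
  unfolding subalgebra_def generated_sets
  using assms by (auto intro!: sets.sigma_sets_subset measurable_sets)

text \<open>
An event generated by the process over \<open>K\<close> is an event of the path restricted to \<open>K\<close>, which allows
uniqueness of measures on product spaces to be used for conditional expectations.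
\<close>
lemma generated_sets_vimage:
  fixes Z :: "real \<Rightarrow> 'w \<Rightarrow> 'a::euclidean_space"
  assumes "A \<in> sets (generated P Z K)"
  obtains B where "B \<in> sets (PiM K (\<lambda>_. borel))" "A = (\<lambda>\<xi>. \<lambda>\<tau>\<in>K. Z \<tau> \<xi>) -` B \<inter> space P"
proof -
  let ?X = "\<lambda>\<xi>. \<lambda>\<tau>\<in>K. Z \<tau> \<xi>" and ?N = "PiM K (\<lambda>_. borel)"
  have X: "?X \<in> space P \<rightarrow> space ?N"
    by (auto simp: space_PiM)
  have "sigma_sets (space P) {Z \<tau> -` F \<inter> space P | \<tau> F. \<tau> \<in> K \<and> F \<in> sets borel}
      \<subseteq> sets (vimage_algebra (space P) ?X ?N)"
  proof (rule sets.sigma_sets_subset[of _ "vimage_algebra (space P) ?X ?N", unfolded space_vimage_algebra], safe)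
    fix \<tau> F assume \<tau>: "\<tau> \<in> K" and F: "F \<in> sets (borel :: 'a measure)"
    have "Z \<tau> -` F \<inter> space P = ?X -` ((\<lambda>\<eta>. \<eta> \<tau>) -` F \<inter> space ?N) \<inter> space P"
      using \<tau> X by (auto simp: space_PiM)
    also have "\<dots> \<in> sets (vimage_algebra (space P) ?X ?N)"
      using \<tau> F by (intro in_vimage_algebra measurable_sets[OF measurable_component_singleton])
    finally show "Z \<tau> -` F \<inter> space P \<in> sets (vimage_algebra (space P) ?X ?N)" .
  qed
  then show ?thesis
    using assms that X by (auto simp: generated_sets sets_vimage_algebra2)
qed

context pinned_bridge
begin

definition bridge_measure :: "(real \<Rightarrow> 'a) measure" where
  "bridge_measure = completion projective.lim"

lemma space_bridge_measure [simp]: "space bridge_measure = space (PiM {0<..<T} (\<lambda>_. borel))"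
  by (simp add: bridge_measure_def)

lemma measurable_bridge_measure:
  "f \<in> PiM {0<..<T} (\<lambda>_. borel) \<rightarrow>\<^sub>M N \<Longrightarrow> f \<in> bridge_measure \<rightarrow>\<^sub>M N"
  unfolding bridge_measure_def
  by (rule measurable_completion) (unfold measurable_cong_sets[OF projective.sets_lim refl])

lemma pinned_process_measurable: "pinned \<tau> \<in> borel_measurable bridge_measure"
  by (intro measurable_bridge_measure pinned_measurable)

lemma prob_space_bridge_measure: "prob_space bridge_measure"
  unfolding bridge_measure_def
  by (intro prob_spaceI) (simp add: projective.P.emeasure_space_1[unfolded projective.space_lim])

lemma pinned_process: "process T bridge_measure pinned"
  unfolding process_def
proof (intro conjI ballI prob_space_bridge_measure pinned_process_measurable)
  show "complete_measure bridge_measure"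
    unfolding bridge_measure_def by (rule completion.complete_measure_axioms)
qed

lemma restrict_measurable_bridge:
  "J \<subseteq> {0<..<T} \<Longrightarrow> (\<lambda>\<xi>. restrict \<xi> J) \<in> PiM {0<..<T} (\<lambda>_. borel) \<rightarrow>\<^sub>M PiM J (\<lambda>_. borel :: 'a measure)"
  by (rule measurable_restrict_subset)

lemma nn_integral_bridge_measure:
  assumes J: "interior_times J" and f: "f \<in> borel_measurable (PiM J (\<lambda>_. borel))"
  shows "(\<integral>\<^sup>+ \<xi>. f (restrict \<xi> J) \<partial>bridge_measure) = (\<integral>\<^sup>+ \<xi>. f \<xi> \<partial>bridge_law J)"
proof -
  have J': "J \<subseteq> {0<..<T}" "finite J"
    using J by (auto simp: interior_times_def)
  have m: "(\<lambda>\<xi>. restrict \<xi> J) \<in> projective.lim \<rightarrow>\<^sub>M PiM J (\<lambda>_. borel :: 'a measure)"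
    using restrict_measurable_bridge[OF J'(1)]
    unfolding measurable_cong_sets[OF projective.sets_lim refl] .
  have eq: "distr projective.lim (PiM J (\<lambda>_. borel)) (\<lambda>\<xi>. restrict \<xi> J) = bridge_law J"
  proof (rule measure_eqI)
    fix A assume "A \<in> sets (distr projective.lim (PiM J (\<lambda>_. borel)) (\<lambda>\<xi>. restrict \<xi> J))"
    then have A: "A \<in> sets (PiM J (\<lambda>_. borel))"
      by simp
    show "emeasure (distr projective.lim (PiM J (\<lambda>_. borel)) (\<lambda>\<xi>. restrict \<xi> J)) A = emeasure (bridge_law J) A"
      unfolding emeasure_distr[OF m A] projective.emeasure_lim_emb[OF J' A, symmetric]
      by (simp add: prod_emb_def space_PiM)
  qed simp
  show ?thesis
    unfolding bridge_measure_def nn_integral_completion eq[symmetric]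
    by (rule nn_integral_distr[OF m, symmetric]) (use f in simp)
qed

definition bridge_expectation :: "real \<Rightarrow> real \<Rightarrow> real \<Rightarrow> ('a \<Rightarrow> ennreal) \<Rightarrow> 'a \<Rightarrow> 'a \<Rightarrow> ennreal" where
  "bridge_expectation s r t f x y = (\<integral>\<^sup>+ z. ennreal (bridge_density s r t x y z) * f z \<partial>lborel)"

lemma bridge_expectation_measurable:
  assumes "0 \<le> s" "s < r" "r < t" "t \<le> T" "f \<in> borel_measurable borel"
    "X \<in> borel_measurable M" "Y \<in> borel_measurable M"
  shows "(\<lambda>\<xi>. bridge_expectation s r t f (X \<xi>) (Y \<xi>)) \<in> borel_measurable M"
proof -
  note [measurable] = assms(5-7)
  have [measurable]: "(\<lambda>(\<xi>, z). bridge_density s r t (X \<xi>) (Y \<xi>) z) \<in> borel_measurable (M \<Otimes>\<^sub>M borel)"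
    unfolding case_prod_beta using assms(1-4) by (intro bridge_density_measurable) measurable
  show ?thesis
    unfolding bridge_expectation_def by measurable
qed

text \<open>
The sampling times of the cylinder together with \<open>s\<close> and \<open>t\<close> form a finite set in which \<open>s\<close> and
\<open>t\<close> are the neighbours of \<open>r\<close>. The cylinder does not involve the coordinate \<open>r\<close>, so the
disintegration at \<open>r\<close> leaves its indicator untouched.
\<close>
lemma bridge_cylinder:
  assumes srt: "0 \<le> s" "s < r" "r < t" "t \<le> T" and f: "f \<in> borel_measurable borel"
    and K: "finite K" "K \<subseteq> {0..s} \<union> {t..T}" and F: "\<And>\<tau>. \<tau> \<in> K \<Longrightarrow> F \<tau> \<in> sets borel"
  shows "(\<integral>\<^sup>+ \<xi>. (\<Prod>\<tau>\<in>K. indicator (F \<tau>) (pinned \<tau> \<xi>)) * f (pinned r \<xi>) \<partial>bridge_measure)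
    = (\<integral>\<^sup>+ \<xi>. (\<Prod>\<tau>\<in>K. indicator (F \<tau>) (pinned \<tau> \<xi>)) * bridge_expectation s r t f (pinned s \<xi>) (pinned t \<xi>) \<partial>bridge_measure)"
proof -
  \<comment> \<open>The endpoints are deterministic and must not be integrated over.\<close>
  define J where "J = (K \<union> {s, t}) \<inter> {0<..<T}"
  have J: "interior_times J"
    using K by (auto simp: J_def interior_times_def)
  have r: "r \<in> {0<..<T}" "r \<notin> J"
    using srt K by (auto simp: J_def)
  have J': "interior_times (insert r J)"
    using J r by (simp add: interior_times_insert)
  have s: "s \<in> insert 0 J" "s < r"
    using srt by (auto simp: J_def)
  have t: "successor J s = t"
    by (rule successor_eqI[OF J]) (use srt K in \<open>auto simp: J_def\<close>)
  let ?C = "\<lambda>\<xi>. (\<Prod>\<tau>\<in>K. indicator (F \<tau>) (pinned \<tau> \<xi>)) :: ennreal"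
  let ?E = "\<lambda>\<xi>. bridge_expectation s r t f (pinned s \<xi>) (pinned t \<xi>)"
  have pin: "pinned \<tau> \<in> borel_measurable (PiM H (\<lambda>_. borel))" if "\<tau> \<in> K \<union> {s, t} \<or> \<tau> = r \<and> r \<in> H" "J \<subseteq> H" for \<tau> H
    using that by (intro pinned_measurable) (auto simp: J_def)
  have C: "?C \<in> borel_measurable (PiM H (\<lambda>_. borel))" if "J \<subseteq> H" for H
  proof (rule borel_measurable_prod_ennreal)
    show "(\<lambda>\<xi>. indicator (F \<tau>) (pinned \<tau> \<xi>) :: ennreal) \<in> borel_measurable (PiM H (\<lambda>_. borel))"
      if "\<tau> \<in> K" for \<tau>
      by (rule measurable_compose[OF pin borel_measurable_indicator[OF F]]) (use that \<open>J \<subseteq> H\<close> in auto)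
  qed
  have E: "?E \<in> borel_measurable (PiM J (\<lambda>_. borel))"
    using srt f by (intro bridge_expectation_measurable pin) auto
  have pin_restrict: "pinned \<tau> (restrict \<xi> H) = pinned \<tau> \<xi>" if "\<tau> \<in> K \<union> {s, t} \<or> \<tau> = r \<and> r \<in> H" "J \<subseteq> H" for \<tau> H \<xi>
    using that by (intro pinned_restrict) (auto simp: J_def)
  have C_restrict: "?C (restrict \<xi> H) = ?C \<xi>" if "J \<subseteq> H" for H \<xi>
    using that by (intro prod.cong refl) (simp add: pin_restrict)
  have fC: "(\<lambda>\<xi>. ?C \<xi> * f (pinned r \<xi>)) \<in> borel_measurable (PiM (insert r J) (\<lambda>_. borel))"
    by (intro borel_measurable_times_ennreal C measurable_compose[OF pin f]) auto
  have "(\<integral>\<^sup>+ \<xi>. ?C \<xi> * f (pinned r \<xi>) \<partial>bridge_measure)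
      = (\<integral>\<^sup>+ \<xi>. ?C (restrict \<xi> (insert r J)) * f (pinned r (restrict \<xi> (insert r J))) \<partial>bridge_measure)"
    by (simp only: C_restrict[OF subset_insertI] pin_restrict[OF _ subset_insertI] insertI1 simp_thms)
  also have "\<dots> = (\<integral>\<^sup>+ \<xi>. ?C \<xi> * f (pinned r \<xi>) \<partial>bridge_law (insert r J))"
    by (rule nn_integral_bridge_measure[OF J' fC])
  also have "\<dots> = (\<integral>\<^sup>+ \<xi>. (\<integral>\<^sup>+ y. ennreal (bridge_density s r t (pinned s \<xi>) (pinned t \<xi>) y)
      * (?C (\<xi>(r := y)) * f (pinned r (\<xi>(r := y)))) \<partial>lborel) \<partial>bridge_law J)"
    by (rule nn_integral_bridge_law_insert[OF J r s t srt(3) fC])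
  also have "\<dots> = (\<integral>\<^sup>+ \<xi>. ?C \<xi> * ?E \<xi> \<partial>bridge_law J)"
  proof (rule nn_integral_cong)
    fix \<xi>
    have "r \<notin> K"
      using K srt by auto
    then have "?C (\<xi>(r := y)) = ?C \<xi>" for y
      by (intro prod.cong refl) (auto simp: pinned_upd)
    moreover have "pinned r (\<xi>(r := y)) = y" for y
      using r by (simp add: pinned_upd)
    moreover have "(\<lambda>y. ennreal (bridge_density s r t (pinned s \<xi>) (pinned t \<xi>) y) * f y) \<in> borel_measurable lborel"
      using srt f by (intro borel_measurable_times_ennreal measurable_compose[OF bridge_density_measurable measurable_ennreal]) auto
    ultimately show "(\<integral>\<^sup>+ y. ennreal (bridge_density s r t (pinned s \<xi>) (pinned t \<xi>) y)
        * (?C (\<xi>(r := y)) * f (pinned r (\<xi>(r := y)))) \<partial>lborel) = ?C \<xi> * ?E \<xi>"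
      unfolding bridge_expectation_def by (simp only: mult.left_commute nn_integral_cmult)
  qed
  also have "\<dots> = (\<integral>\<^sup>+ \<xi>. ?C (restrict \<xi> J) * ?E (restrict \<xi> J) \<partial>bridge_measure)"
    by (rule nn_integral_bridge_measure[OF J, symmetric]) (intro borel_measurable_times_ennreal C E order_refl)
  also have "\<dots> = (\<integral>\<^sup>+ \<xi>. ?C \<xi> * ?E \<xi> \<partial>bridge_measure)"
    by (simp only: C_restrict[OF order_refl] pin_restrict[OF _ order_refl] insertI1 insertI2 UnI2 simp_thms)
  finally show ?thesis .
qed

text \<open>
Both sides, as functions of the event, are finite measures on paths over \<open>K\<close>; they agree on cylinders by
\<open>bridge_cylinder\<close>. The bound on \<open>f\<close> ensures finiteness.
\<close>
lemma bridge_generated: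
  assumes srt: "0 \<le> s" "s < r" "r < t" "t \<le> T" and f: "f \<in> borel_measurable borel" "\<And>x. f x \<le> ennreal C"
    and K: "K \<subseteq> {0..s} \<union> {t..T}" and A: "A \<in> sets (generated bridge_measure pinned K)"
  shows "(\<integral>\<^sup>+ \<xi>\<in>A. f (pinned r \<xi>) \<partial>bridge_measure)
    = (\<integral>\<^sup>+ \<xi>\<in>A. bridge_expectation s r t f (pinned s \<xi>) (pinned t \<xi>) \<partial>bridge_measure)"
proof -
  let ?P = "bridge_measure" and ?N = "PiM K (\<lambda>_. borel :: 'a measure)"
  let ?X = "\<lambda>\<xi>. \<lambda>\<tau>\<in>K. pinned \<tau> \<xi>"
  let ?f = "\<lambda>\<xi>. f (pinned r \<xi>)" and ?E = "\<lambda>\<xi>. bridge_expectation s r t f (pinned s \<xi>) (pinned t \<xi>)"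
  note [measurable] = pinned_process_measurable f(1)
  have X [measurable]: "?X \<in> ?P \<rightarrow>\<^sub>M ?N"
    by (intro measurable_restrict pinned_process_measurable)
  have E [measurable]: "?E \<in> borel_measurable ?P"
    using srt f by (intro bridge_expectation_measurable pinned_process_measurable)
  have int: "emeasure (distr (density ?P h) ?N ?X) B = (\<integral>\<^sup>+ \<xi>. h \<xi> * indicator B (?X \<xi>) \<partial>?P)"
    if [measurable]: "h \<in> borel_measurable ?P" "B \<in> sets ?N" for h B
  proof -
    have "emeasure (distr (density ?P h) ?N ?X) B = (\<integral>\<^sup>+ \<eta>. indicator B \<eta> \<partial>distr (density ?P h) ?N ?X)"
      by simp
    also have "\<dots> = (\<integral>\<^sup>+ \<xi>. indicator B (?X \<xi>) \<partial>density ?P h)"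
      by (rule nn_integral_distr) simp_all
    also have "\<dots> = (\<integral>\<^sup>+ \<xi>. h \<xi> * indicator B (?X \<xi>) \<partial>?P)"
      by (rule nn_integral_density) measurable
    finally show ?thesis .
  qed
  have law: "distr (density ?P ?f) ?N ?X = distr (density ?P ?E) ?N ?X"
  proof (rule measure_eqI_PiM_infinite)
    fix F J assume J: "finite J" "J \<subseteq> K" and F: "\<And>\<tau>. \<tau> \<in> J \<Longrightarrow> F \<tau> \<in> sets (borel :: 'a measure)"
    let ?B = "prod_emb K (\<lambda>_. borel) J (Pi\<^sub>E J F)"
    have B: "?B \<in> sets ?N"
      using J F by (intro sets_PiM_I) auto
    have ind: "indicator ?B (?X \<xi>) = (\<Prod>\<tau>\<in>J. indicator (F \<tau>) (pinned \<tau> \<xi>) :: ennreal)" for \<xi>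
    proof -
      have "?X \<xi> \<in> ?B \<longleftrightarrow> (\<forall>\<tau>\<in>J. pinned \<tau> \<xi> \<in> F \<tau>)"
        using J(2) by (auto simp: prod_emb_def PiE_iff subset_iff)
      then show ?thesis
        using J(1) by (auto simp: indicator_def prod_zero_iff)
    qed
    have "J \<subseteq> {0..s} \<union> {t..T}"
      using J(2) K by auto
    from bridge_cylinder[OF srt f(1) J(1) this F]
    show "emeasure (distr (density ?P ?f) ?N ?X) ?B = emeasure (distr (density ?P ?E) ?N ?X) ?B"
      unfolding int[OF measurable_compose[OF pinned_process_measurable f(1)] B] int[OF E B] ind
      by (simp add: mult.commute)
  next
    show "finite_measure (distr (density ?P ?f) ?N ?X)"
    proof (intro finite_measureI)
      interpret prob_space ?P
        by (rule prob_space_bridge_measure)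
      have "emeasure (distr (density ?P ?f) ?N ?X) (space ?N) = (\<integral>\<^sup>+ \<xi>. f (pinned r \<xi>) * indicator (space ?N) (?X \<xi>) \<partial>?P)"
        by (rule int) measurable
      also have "\<dots> \<le> (\<integral>\<^sup>+ \<xi>. ennreal C \<partial>?P)"
        using f(2) by (intro nn_integral_mono) (auto simp: indicator_def)
      also have "\<dots> < \<infinity>"
        by (simp add: emeasure_space_1[unfolded space_bridge_measure])
      finally show "emeasure (distr (density ?P ?f) ?N ?X) (space (distr (density ?P ?f) ?N ?X)) \<noteq> \<infinity>"
        by simp
    qed
  qed simp_all
  obtain B where B: "B \<in> sets ?N" "A = ?X -` B \<inter> space ?P"
    using generated_sets_vimage[OF A] .
  have "(\<integral>\<^sup>+ \<xi>. ?f \<xi> * indicator B (?X \<xi>) \<partial>?P) = (\<integral>\<^sup>+ \<xi>. ?E \<xi> * indicator B (?X \<xi>) \<partial>?P)"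
    unfolding int[OF measurable_compose[OF pinned_process_measurable f(1)] B(1), symmetric]
      int[OF E B(1), symmetric] law ..
  moreover have "indicator B (?X \<xi>) = (indicator A \<xi> :: ennreal)" if "\<xi> \<in> space ?P" for \<xi>
    using that by (simp add: B(2) indicator_def)
  then have "(\<integral>\<^sup>+ \<xi>. h \<xi> * indicator B (?X \<xi>) \<partial>?P) = (\<integral>\<^sup>+ \<xi>\<in>A. h \<xi> \<partial>?P)" for h
    by (intro nn_integral_cong) simp
  ultimately show ?thesis
    by (simp only:)
qed

lemma generated_pinned_subalgebra: "subalgebra bridge_measure (generated bridge_measure pinned K)"
  by (intro generated_subalgebra pinned_process_measurable)

lemma sigma_finite_generated: "sigma_finite_subalgebra bridge_measure (generated bridge_measure pinned K)"
proof -
  interpret prob_space bridge_measure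
    by (rule prob_space_bridge_measure)
  have "finite_measure_subalgebra bridge_measure (generated bridge_measure pinned K)"
    by unfold_locales (rule generated_pinned_subalgebra)
  then show ?thesis
    by (rule finite_measure_subalgebra_is_sigma_finite)
qed

text \<open>
The endpoint values are constant, so a neighbour at \<open>0\<close> or \<open>T\<close> need not be observed. Different \<open>K\<close> give
the same conditional expectation, which contains the Bernstein and both Markov properties.
\<close>
lemma nn_cond_exp_bridge:
  assumes srt: "0 \<le> s" "s < r" "r < t" "t \<le> T" and f: "f \<in> borel_measurable borel" "\<And>x. f x \<le> ennreal C"
    and K: "K \<subseteq> {0..s} \<union> {t..T}" "s \<in> insert 0 K" "t \<in> insert T K"
  shows "AE \<xi> in bridge_measure. nn_cond_exp bridge_measure (generated bridge_measure pinned K) (\<lambda>\<xi>. f (pinned r \<xi>)) \<xi>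
    = bridge_expectation s r t f (pinned s \<xi>) (pinned t \<xi>)"
proof -
  let ?G = "generated bridge_measure pinned K"
  interpret sigma_finite_subalgebra bridge_measure ?G
    by (rule sigma_finite_generated)
  have "pinned s \<in> borel_measurable ?G"
  proof (cases "s = 0")
    case True
    then have "pinned s = (\<lambda>_. a)" by auto
    then show ?thesis by simp
  qed (use K in \<open>auto intro: generated_measurable\<close>)
  moreover have "pinned t \<in> borel_measurable ?G"
  proof (cases "t = T")
    case True
    then have "pinned t = (\<lambda>_. b)" by auto
    then show ?thesis by simp
  qed (use K in \<open>auto intro: generated_measurable\<close>)
  ultimately have E: "(\<lambda>\<xi>. bridge_expectation s r t f (pinned s \<xi>) (pinned t \<xi>)) \<in> borel_measurable ?G"
    using srt f by (intro bridge_expectation_measurable)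
  have "AE \<xi> in bridge_measure. bridge_expectation s r t f (pinned s \<xi>) (pinned t \<xi>)
      = nn_cond_exp bridge_measure ?G (\<lambda>\<xi>. f (pinned r \<xi>)) \<xi>"
    using bridge_generated[OF srt f K(1)] E measurable_compose[OF pinned_process_measurable f(1)]
    by (intro nn_cond_exp_charact)
  then show ?thesis
    by eventually_elim simp
qed

end

lemma (in sigma_finite_subalgebra) nn_cond_exp_const: "AE x in M. nn_cond_exp M F (\<lambda>_. c) x = c"
  using nn_cond_exp_F_meas[of "\<lambda>_. c"] by (auto elim!: eventually_mono)

lemma AE_eq_trans: "AE x in M. f x = h x \<Longrightarrow> AE x in M. k x = h x \<Longrightarrow> AE x in M. f x = k x"
  by (auto elim!: eventually_elim2)

section \<open>Bernstein and Markov properties\<close>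

text \<open>
The complex conditional expectation is composed of the nonnegative ones of the positive and negative
parts of the real and imaginary parts.
\<close>
lemma complex_cond_exp_cong:
  fixes X :: "'w \<Rightarrow> 'a::euclidean_space"
  assumes eq: "\<And>f C. f \<in> borel_measurable borel \<Longrightarrow> (\<And>x. f x \<le> ennreal C) \<Longrightarrow>
      AE \<xi> in P. nn_cond_exp P G (\<lambda>\<xi>. f (X \<xi>)) \<xi> = nn_cond_exp P H (\<lambda>\<xi>. f (X \<xi>)) \<xi>"
    and h: "h \<in> bounded_borel"
  shows "AE \<xi> in P. complex_cond_exp P G (\<lambda>\<xi>. h (X \<xi>)) \<xi> = complex_cond_exp P H (\<lambda>\<xi>. h (X \<xi>)) \<xi>"
proof -
  obtain C where C: "\<And>x. cmod (h x) \<le> C"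
    using h by (auto simp: bounded_borel_def bounded_iff)
  have [measurable]: "h \<in> borel_measurable borel"
    using h by (simp add: bounded_borel_def)
  have "\<bar>Re (h x)\<bar> \<le> C" "\<bar>Im (h x)\<bar> \<le> C" for x
    using abs_Re_le_cmod[of "h x"] abs_Im_le_cmod[of "h x"] C[of x] by linarith+
  then have "Re (h x) \<le> C" "- Re (h x) \<le> C" "Im (h x) \<le> C" "- Im (h x) \<le> C" for x
    by (simp_all add: abs_le_iff)
  then have "AE \<xi> in P. nn_cond_exp P G (\<lambda>\<xi>. ennreal (Re (h (X \<xi>)))) \<xi> = nn_cond_exp P H (\<lambda>\<xi>. ennreal (Re (h (X \<xi>)))) \<xi>"
    "AE \<xi> in P. nn_cond_exp P G (\<lambda>\<xi>. ennreal (- Re (h (X \<xi>)))) \<xi> = nn_cond_exp P H (\<lambda>\<xi>. ennreal (- Re (h (X \<xi>)))) \<xi>"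
    "AE \<xi> in P. nn_cond_exp P G (\<lambda>\<xi>. ennreal (Im (h (X \<xi>)))) \<xi> = nn_cond_exp P H (\<lambda>\<xi>. ennreal (Im (h (X \<xi>)))) \<xi>"
    "AE \<xi> in P. nn_cond_exp P G (\<lambda>\<xi>. ennreal (- Im (h (X \<xi>)))) \<xi> = nn_cond_exp P H (\<lambda>\<xi>. ennreal (- Im (h (X \<xi>)))) \<xi>"
    by (intro eq[of "\<lambda>x. ennreal (Re (h x))" C] eq[of "\<lambda>x. ennreal (- Re (h x))" C]
        eq[of "\<lambda>x. ennreal (Im (h x))" C] eq[of "\<lambda>x. ennreal (- Im (h x))" C] ennreal_leI; simp)+
  then show ?thesis
    by eventually_elim (simp add: complex_cond_exp_def real_cond_exp_def)
qed

lemma real_cond_exp_indicator: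
  fixes X :: "'w \<Rightarrow> 'a::euclidean_space"
  assumes "sigma_finite_subalgebra P G" and X: "X \<in> borel_measurable P" and F: "F \<in> sets borel"
    and eq: "AE \<xi> in P. nn_cond_exp P G (\<lambda>\<xi>. indicator F (X \<xi>)) \<xi> = h \<xi>"
  shows "AE \<xi> in P. real_cond_exp P G (indicator (X -` F \<inter> space P)) \<xi> = enn2real (h \<xi>)"
proof -
  interpret sigma_finite_subalgebra P G by fact
  let ?A = "X -` F \<inter> space P"
  have [measurable]: "?A \<in> sets P" "X \<in> borel_measurable P" "F \<in> sets borel"
    using X F by (auto intro: measurable_sets)
  have "AE \<xi> in P. nn_cond_exp P G (\<lambda>\<xi>. ennreal (indicator ?A \<xi>)) \<xi> = nn_cond_exp P G (\<lambda>\<xi>. indicator F (X \<xi>)) \<xi>"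
    by (intro nn_cond_exp_cong AE_I2) (auto simp: indicator_def)
  then show ?thesis
    using eq nn_cond_exp_const[of 0]
  proof eventually_elim
    case (elim \<xi>)
    have "(\<lambda>\<xi>. ennreal (- indicator ?A \<xi>)) = (\<lambda>_. 0)"
      by (rule ext) (simp add: ennreal_neg)
    then show ?case
      using elim by (simp add: real_cond_exp_def)
  qed
qed

context green_kernel
begin

text \<open>
The Doob transform of the kernel that conditions on arrival at \<open>p\<close> at time \<open>T\<close>.
\<close>
definition doob_kernel :: "'a \<Rightarrow> real \<Rightarrow> real \<Rightarrow> 'a \<Rightarrow> 'a measure" where
  "doob_kernel p s t x =
    (if t < T then density lborel (\<lambda>y. ennreal (bridge_density s t T x p y)) else return borel p)"

lemma sets_doob_kernel [simp]: "sets (doob_kernel p s t x) = sets borel"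
  by (simp add: doob_kernel_def)

lemma doob_density_measurable:
  assumes "0 \<le> s" "s < t" "t < T"
  shows "(\<lambda>(x, y). ennreal (bridge_density s t T x p y)) \<in> borel_measurable (borel \<Otimes>\<^sub>M borel)"
  unfolding case_prod_beta using assms
  by (intro measurable_compose[OF bridge_density_measurable measurable_ennreal]) auto

lemma emeasure_doob_kernel:
  assumes "0 \<le> s" "s < t" "t \<le> T" "F \<in> sets borel"
  shows "emeasure (doob_kernel p s t x) F
    = (if t < T then \<integral>\<^sup>+ y. ennreal (bridge_density s t T x p y) * indicator F y \<partial>lborel else indicator F p)"
proof (cases "t < T")
  case True
  then show ?thesis
    using measurable_compose[OF measurable_Pair1' doob_density_measurable[of s t p], of x] assms
    by (simp add: doob_kernel_def emeasure_density)
qed (use assms in \<open>simp add: doob_kernel_def\<close>)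

lemma nn_integral_doob_kernel:
  assumes "0 \<le> s" "s < t" "t \<le> T" "f \<in> borel_measurable borel"
  shows "(\<integral>\<^sup>+ y. f y \<partial>doob_kernel p s t x)
    = (if t < T then \<integral>\<^sup>+ y. ennreal (bridge_density s t T x p y) * f y \<partial>lborel else f p)"
proof (cases "t < T")
  case True
  then show ?thesis
    using measurable_compose[OF measurable_Pair1' doob_density_measurable[of s t p], of x] assms
    by (simp add: doob_kernel_def nn_integral_density)
qed (use assms in \<open>simp add: doob_kernel_def nn_integral_return\<close>)

lemma doob_kernel_measurable:
  assumes "0 \<le> s" "s < t" "t \<le> T"
  shows "doob_kernel p s t \<in> borel \<rightarrow>\<^sub>M prob_algebra borel"
proof (rule measurable_prob_algebraI)
  show prob: "prob_space (doob_kernel p s t x)" for x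
    using assms emeasure_doob_kernel[OF assms, of UNIV p x] bridge_density_mass[of s t T x p]
    by (intro prob_spaceI) (auto simp: sets_eq_imp_space_eq[OF sets_doob_kernel] split: if_splits)
  show "doob_kernel p s t \<in> borel \<rightarrow>\<^sub>M subprob_algebra borel"
  proof (rule measurable_subprob_algebra)
    show "subprob_space (doob_kernel p s t x)" for x
      using prob by (rule prob_space_imp_subprob_space)
    show "(\<lambda>x. emeasure (doob_kernel p s t x) F) \<in> borel_measurable borel" if [measurable]: "F \<in> sets borel" for F
    proof (cases "t < T")
      case True
      note [measurable] = doob_density_measurable[OF assms(1,2) True, of p]
      show ?thesis
        using True unfolding emeasure_doob_kernel[OF assms that] by simp
    qed (simp add: emeasure_doob_kernel[OF assms that])
  qed simp
qed

text \<open>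
The factor \<open>g z (T - s) p\<close> cancels in the product of two bridge densities with common final point
\<open>p\<close>, so the composition reduces to the Chapman-Kolmogorov identity for \<open>g\<close>.
\<close>
lemma doob_kernel_bind:
  assumes "0 \<le> r" "r < s" "s < t" "t \<le> T"
  shows "doob_kernel p r t x = doob_kernel p r s x \<bind> doob_kernel p s t"
proof (rule measure_eqI)
  have K: "doob_kernel p r s \<in> borel \<rightarrow>\<^sub>M prob_algebra borel" "doob_kernel p s t \<in> borel \<rightarrow>\<^sub>M prob_algebra borel"
    using assms by (auto intro: doob_kernel_measurable)
  have x: "doob_kernel p r s x \<in> space (prob_algebra borel)"
    using measurable_space[OF K(1)] by simp
  show "sets (doob_kernel p r t x) = sets (doob_kernel p r s x \<bind> doob_kernel p s t)"
    using sets_bind'[OF x K(2)] by simp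
  fix F assume "F \<in> sets (doob_kernel p r t x)"
  then have F [measurable]: "F \<in> sets borel"
    by simp
  have m: "(\<lambda>z. emeasure (doob_kernel p s t z) F) \<in> borel_measurable borel"
    by (rule measurable_emeasure_kernel[OF measurable_prob_algebraD[OF K(2)] F])
  have "emeasure (doob_kernel p r s x \<bind> doob_kernel p s t) F
      = (\<integral>\<^sup>+ z. emeasure (doob_kernel p s t z) F \<partial>doob_kernel p r s x)"
    using x K(2) F by (rule emeasure_bind_prob_algebra)
  also have "\<dots> = (\<integral>\<^sup>+ z. ennreal (bridge_density r s T x p z) * emeasure (doob_kernel p s t z) F \<partial>lborel)"
    using assms by (subst nn_integral_doob_kernel[OF _ _ _ m]) auto
  also have "\<dots> = emeasure (doob_kernel p r t x) F"
  proof (cases "t < T")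
    case False
    then show ?thesis
      using assms doob_density_measurable[of r s p] measurable_compose[OF measurable_Pair1' doob_density_measurable[of r s p], of x]
      by (simp add: emeasure_doob_kernel nn_integral_multc bridge_density_mass)
  next
    case True
    have rT: "s < T" "0 \<le> s" "r < t"
      using assms True by auto
    note [measurable] = doob_density_measurable[OF assms(1,2) rT(1), of p] doob_density_measurable[OF rT(2) assms(3) True, of p]
    have step: "(\<integral>\<^sup>+ z. ennreal (bridge_density r s T x p z) * ennreal (bridge_density s t T z p y) \<partial>lborel)
        = ennreal (bridge_density r t T x p y)" for y
    proof -
      let ?c = "g y (T - t) p / g x (T - r) p"
      have pos: "0 < g x (s - r) z" "0 < g z (t - s) y" "0 < g z (T - s) p" "0 < g y (T - t) p" "0 < g x (T - r) p" for z
        using assms True by (auto intro!: kernel_pos)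
      have "(\<integral>\<^sup>+ z. ennreal (bridge_density r s T x p z) * ennreal (bridge_density s t T z p y) \<partial>lborel)
          = (\<integral>\<^sup>+ z. ennreal ?c * (ennreal (g x (s - r) z) * ennreal (g z (t - s) y)) \<partial>lborel)"
      proof (intro nn_integral_cong)
        fix z
        have "bridge_density r s T x p z * bridge_density s t T z p y = ?c * (g x (s - r) z * g z (t - s) y)"
          using pos(3)[of z] by (simp add: bridge_density_def field_simps)
        then show "ennreal (bridge_density r s T x p z) * ennreal (bridge_density s t T z p y)
            = ennreal ?c * (ennreal (g x (s - r) z) * ennreal (g z (t - s) y))"
          using pos(1-3)[of z] pos(4,5) bridge_density_pos[of r s T x p z] bridge_density_pos[of s t T z p y] assms True
          by (simp add: less_imp_le flip: ennreal_mult)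
      qed
      also have "\<dots> = ennreal ?c * ennreal (g x ((s - r) + (t - s)) y)"
        using assms by (subst nn_integral_cmult)
          (auto intro!: kernel_measurable_compose borel_measurable_times_ennreal measurable_compose[OF _ measurable_ennreal] simp: Chapman_Kolmogorov)
      also have "\<dots> = ennreal (bridge_density r t T x p y)"
        using pos kernel_pos[of "t - r" x y] assms by (simp add: bridge_density_def mult_ac less_imp_le flip: ennreal_mult)
      finally show ?thesis .
    qed
    have "(\<integral>\<^sup>+ z. ennreal (bridge_density r s T x p z) * emeasure (doob_kernel p s t z) F \<partial>lborel)
        = (\<integral>\<^sup>+ z. \<integral>\<^sup>+ y. ennreal (bridge_density r s T x p z) * (ennreal (bridge_density s t T z p y) * indicator F y) \<partial>lborel \<partial>lborel)"
      using assms True rT by (simp add: emeasure_doob_kernel nn_integral_cmult)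
    also have "\<dots> = (\<integral>\<^sup>+ y. \<integral>\<^sup>+ z. ennreal (bridge_density r s T x p z) * (ennreal (bridge_density s t T z p y) * indicator F y) \<partial>lborel \<partial>lborel)"
      by (rule lborel_pair.Fubini'[symmetric]) measurable
    also have "\<dots> = (\<integral>\<^sup>+ y. ennreal (bridge_density r t T x p y) * indicator F y \<partial>lborel)"
      by (intro nn_integral_cong) (simp add: nn_integral_multc step flip: mult.assoc)
    also have "\<dots> = emeasure (doob_kernel p r t x) F"
      using assms True by (simp add: emeasure_doob_kernel)
    finally show ?thesis .
  qed
  finally show "emeasure (doob_kernel p r t x) F = emeasure (doob_kernel p r s x \<bind> doob_kernel p s t) F"
    by simp
qed

end

context pinned_bridge
begin

lemma pinned_bernstein_process: "bernstein_process T bridge_measure pinned"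
  unfolding bernstein_process_def
proof (intro conjI ballI allI impI pinned_process)
  fix h :: "'a \<Rightarrow> complex" and s r t
  assume h: "h \<in> bounded_borel" and srt: "0 \<le> s \<and> s < r \<and> r < t \<and> t \<le> T"
  show "AE \<xi> in bridge_measure.
      complex_cond_exp bridge_measure (generated bridge_measure pinned ({0..s} \<union> {t..T})) (\<lambda>\<xi>. h (pinned r \<xi>)) \<xi>
      = complex_cond_exp bridge_measure (generated bridge_measure pinned {s, t}) (\<lambda>\<xi>. h (pinned r \<xi>)) \<xi>"
  proof (rule complex_cond_exp_cong[OF _ h])
    fix f :: "'a \<Rightarrow> ennreal" and C
    assume f: "f \<in> borel_measurable borel" "\<And>x. f x \<le> ennreal C"
    have "AE \<xi> in bridge_measure. nn_cond_exp bridge_measure (generated bridge_measure pinned K) (\<lambda>\<xi>. f (pinned r \<xi>)) \<xi>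
        = bridge_expectation s r t f (pinned s \<xi>) (pinned t \<xi>)" if "K \<in> {{0..s} \<union> {t..T}, {s, t}}" for K
      using srt f that by (intro nn_cond_exp_bridge[where C = C]) auto
    note law = this
    show "AE \<xi> in bridge_measure.
        nn_cond_exp bridge_measure (generated bridge_measure pinned ({0..s} \<union> {t..T})) (\<lambda>\<xi>. f (pinned r \<xi>)) \<xi>
        = nn_cond_exp bridge_measure (generated bridge_measure pinned {s, t}) (\<lambda>\<xi>. f (pinned r \<xi>)) \<xi>"
      by (rule AE_eq_trans[OF law law]) simp_all
  qed
qed

lemma nn_cond_exp_forward:
  assumes st: "0 \<le> s" "s < t" "t \<le> T" and K: "s \<in> K" "K \<subseteq> {0..s}"
    and f: "f \<in> borel_measurable borel" "\<And>x. f x \<le> ennreal C"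
  shows "AE \<xi> in bridge_measure. nn_cond_exp bridge_measure (generated bridge_measure pinned K) (\<lambda>\<xi>. f (pinned t \<xi>)) \<xi>
    = (\<integral>\<^sup>+ y. f y \<partial>doob_kernel b s t (pinned s \<xi>))"
proof (cases "t < T")
  case True
  then show ?thesis
    using nn_cond_exp_bridge[of s t T f C K] st K f
    by (auto simp: nn_integral_doob_kernel bridge_expectation_def)
next
  case False
  then have "t = T"
    using st by simp
  interpret sigma_finite_subalgebra bridge_measure "generated bridge_measure pinned K"
    by (rule sigma_finite_generated)
  show ?thesis
    using nn_cond_exp_const[of "f b"] st f \<open>t = T\<close> by (simp add: nn_integral_doob_kernel)
qed

text \<open>
By symmetry of \<open>g\<close>, the time reversal of the bridge from \<open>a\<close> to \<open>b\<close> is the bridge from \<open>b\<close> to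
\<open>a\<close>, with times counted from \<open>T\<close> downwards.
\<close>
lemma nn_cond_exp_backward:
  assumes st: "0 \<le> s" "s < t" "t \<le> T" and K: "t \<in> K" "K \<subseteq> {t..T}"
    and f: "f \<in> borel_measurable borel" "\<And>x. f x \<le> ennreal C"
  shows "AE \<xi> in bridge_measure. nn_cond_exp bridge_measure (generated bridge_measure pinned K) (\<lambda>\<xi>. f (pinned s \<xi>)) \<xi>
    = (\<integral>\<^sup>+ y. f y \<partial>doob_kernel a (T - t) (T - s) (pinned t \<xi>))"
proof (cases "0 < s")
  case True
  have "bridge_density (T - t) (T - s) T y a z = bridge_density 0 s t a y z" for y z
    using True st kernel_sym[of s z a] kernel_sym[of "t - s" y z] kernel_sym[of t y a]
    by (simp add: bridge_density_def mult.commute)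
  then show ?thesis
    using nn_cond_exp_bridge[of 0 s t f C K] True st K f
    by (auto simp: nn_integral_doob_kernel bridge_expectation_def)
next
  case False
  then have "s = 0"
    using st by simp
  interpret sigma_finite_subalgebra bridge_measure "generated bridge_measure pinned K"
    by (rule sigma_finite_generated)
  show ?thesis
    using nn_cond_exp_const[of "f a"] st f \<open>s = 0\<close> by (simp add: nn_integral_doob_kernel)
qed

lemma pinned_forward_markov: "forward_markov_process T bridge_measure pinned"
  unfolding forward_markov_process_def
proof (intro conjI ballI allI impI pinned_process)
  fix h :: "'a \<Rightarrow> complex" and s t
  assume h: "h \<in> bounded_borel" and st: "0 \<le> s \<and> s < t \<and> t \<le> T"
  show "AE \<xi> in bridge_measure.
      complex_cond_exp bridge_measure (generated bridge_measure pinned {0..s}) (\<lambda>\<xi>. h (pinned t \<xi>)) \<xi>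
      = complex_cond_exp bridge_measure (generated bridge_measure pinned {s}) (\<lambda>\<xi>. h (pinned t \<xi>)) \<xi>"
  proof (rule complex_cond_exp_cong[OF _ h])
    fix f :: "'a \<Rightarrow> ennreal" and C
    assume f: "f \<in> borel_measurable borel" "\<And>x. f x \<le> ennreal C"
    have "AE \<xi> in bridge_measure. nn_cond_exp bridge_measure (generated bridge_measure pinned K) (\<lambda>\<xi>. f (pinned t \<xi>)) \<xi>
        = (\<integral>\<^sup>+ y. f y \<partial>doob_kernel b s t (pinned s \<xi>))" if "K \<in> {{0..s}, {s}}" for K
      using st f that by (intro nn_cond_exp_forward[where C = C]) auto
    note law = this
    show "AE \<xi> in bridge_measure.
        nn_cond_exp bridge_measure (generated bridge_measure pinned {0..s}) (\<lambda>\<xi>. f (pinned t \<xi>)) \<xi>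
        = nn_cond_exp bridge_measure (generated bridge_measure pinned {s}) (\<lambda>\<xi>. f (pinned t \<xi>)) \<xi>"
      by (rule AE_eq_trans[OF law law]) simp_all
  qed
qed

lemma pinned_backward_markov: "backward_markov_process T bridge_measure pinned"
  unfolding backward_markov_process_def
proof (intro conjI ballI allI impI pinned_process)
  fix h :: "'a \<Rightarrow> complex" and s t
  assume h: "h \<in> bounded_borel" and st: "0 \<le> s \<and> s < t \<and> t \<le> T"
  show "AE \<xi> in bridge_measure.
      complex_cond_exp bridge_measure (generated bridge_measure pinned {t..T}) (\<lambda>\<xi>. h (pinned s \<xi>)) \<xi>
      = complex_cond_exp bridge_measure (generated bridge_measure pinned {t}) (\<lambda>\<xi>. h (pinned s \<xi>)) \<xi>"
  proof (rule complex_cond_exp_cong[OF _ h])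
    fix f :: "'a \<Rightarrow> ennreal" and C
    assume f: "f \<in> borel_measurable borel" "\<And>x. f x \<le> ennreal C"
    have "AE \<xi> in bridge_measure. nn_cond_exp bridge_measure (generated bridge_measure pinned K) (\<lambda>\<xi>. f (pinned s \<xi>)) \<xi>
        = (\<integral>\<^sup>+ y. f y \<partial>doob_kernel a (T - t) (T - s) (pinned t \<xi>))" if "K \<in> {{t..T}, {t}}" for K
      using st f that by (intro nn_cond_exp_backward[where C = C]) auto
    note law = this
    show "AE \<xi> in bridge_measure.
        nn_cond_exp bridge_measure (generated bridge_measure pinned {t..T}) (\<lambda>\<xi>. f (pinned s \<xi>)) \<xi>
        = nn_cond_exp bridge_measure (generated bridge_measure pinned {t}) (\<lambda>\<xi>. f (pinned s \<xi>)) \<xi>"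
      by (rule AE_eq_trans[OF law law]) simp_all
  qed
qed

lemma pinned_forward_transition:
  assumes K: "\<And>s t x. 0 \<le> s \<Longrightarrow> s < t \<Longrightarrow> t \<le> T \<Longrightarrow> K s t x = doob_kernel b s t x"
  shows "forward_transition_function T bridge_measure pinned K"
  unfolding forward_transition_function_def
proof (intro conjI allI impI ballI)
  fix s t :: real assume st: "0 \<le> s \<and> s < t \<and> t \<le> T"
  then have Kst: "K s t = doob_kernel b s t"
    using K by auto
  show "K s t \<in> borel \<rightarrow>\<^sub>M prob_algebra borel"
    unfolding Kst using st by (intro doob_kernel_measurable) auto
  fix F :: "'a set" assume F: "F \<in> sets borel"
  have "AE \<xi> in bridge_measure. nn_cond_exp bridge_measure (generated bridge_measure pinned {0..s}) (\<lambda>\<xi>. indicator F (pinned t \<xi>)) \<xi>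
      = (\<integral>\<^sup>+ y. indicator F y \<partial>doob_kernel b s t (pinned s \<xi>))"
    using st F by (intro nn_cond_exp_forward[where C = 1]) (auto simp: indicator_def)
  from real_cond_exp_indicator[OF sigma_finite_generated pinned_process_measurable F this]
  show "AE \<xi> in bridge_measure. real_cond_exp bridge_measure (generated bridge_measure pinned {0..s})
      (indicator (pinned t -` F \<inter> space bridge_measure)) \<xi> = measure (K s t (pinned s \<xi>)) F"
    using F by (simp add: Kst measure_def)
next
  fix r s t x assume rst: "0 \<le> r \<and> r < s \<and> s < t \<and> t \<le> T"
  then have "K s t = doob_kernel b s t"
    using K by auto
  then show "K r t x = K r s x \<bind> K s t"
    using rst K doob_kernel_bind[of r s t b x] by simp
qed

lemma pinned_backward_transition:
  assumes K: "\<And>s t x. 0 \<le> s \<Longrightarrow> s < t \<Longrightarrow> t \<le> T \<Longrightarrow> K t s x = doob_kernel a (T - t) (T - s) x"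
  shows "backward_transition_function T bridge_measure pinned K"
  unfolding backward_transition_function_def
proof (intro conjI allI impI ballI)
  fix s t :: real assume st: "0 \<le> s \<and> s < t \<and> t \<le> T"
  then have Kst: "K t s = doob_kernel a (T - t) (T - s)"
    using K by auto
  show "K t s \<in> borel \<rightarrow>\<^sub>M prob_algebra borel"
    unfolding Kst using st by (intro doob_kernel_measurable) auto
  fix F :: "'a set" assume F: "F \<in> sets borel"
  have "AE \<xi> in bridge_measure. nn_cond_exp bridge_measure (generated bridge_measure pinned {t..T}) (\<lambda>\<xi>. indicator F (pinned s \<xi>)) \<xi>
      = (\<integral>\<^sup>+ y. indicator F y \<partial>doob_kernel a (T - t) (T - s) (pinned t \<xi>))"
    using st F by (intro nn_cond_exp_backward[where C = 1]) (auto simp: indicator_def)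
  from real_cond_exp_indicator[OF sigma_finite_generated pinned_process_measurable F this]
  show "AE \<xi> in bridge_measure. real_cond_exp bridge_measure (generated bridge_measure pinned {t..T})
      (indicator (pinned s -` F \<inter> space bridge_measure)) \<xi> = measure (K t s (pinned t \<xi>)) F"
    using F by (simp add: Kst measure_def)
next
  fix r s t x assume rst: "0 \<le> r \<and> r < s \<and> s < t \<and> t \<le> T"
  then have "K s r = doob_kernel a (T - s) (T - r)"
    using K by auto
  then show "K t r x = K t s x \<bind> K s r"
    using rst K doob_kernel_bind[of "T - t" "T - s" "T - r" a x] by simp
qed

end

section \<open>Dirac data and the formulas for the laws\<close>
abbreviation dirac :: "real \<Rightarrow> 'a::euclidean_space \<Rightarrow> 'a measure" where
  "dirac c p \<equiv> scale_measure (ennreal c) (return borel p)"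

lemma dirac_eq_density: "dirac c p = density (return borel p) (\<lambda>_. ennreal c)"
  by (rule measure_eqI) (auto simp: emeasure_density nn_integral_cmult_indicator)

lemma integral_dirac:
  fixes f :: "'a::euclidean_space \<Rightarrow> real"
  assumes "0 \<le> c" "f \<in> borel_measurable borel"
  shows "(LINT y|dirac c p. f y) = c * f p"
  using assms by (simp add: dirac_eq_density integral_density integral_return)

lemma nn_integral_dirac:
  fixes p :: "'a::euclidean_space"
  assumes "f \<in> borel_measurable borel"
  shows "(\<integral>\<^sup>+ y. f y \<partial>dirac c p) = ennreal c * f p"
  using assms by (simp add: nn_integral_scale_measure nn_integral_return)

text \<open>
Holds for every function, because almost every point is \<open>x\<close>.
\<close>
lemma nn_integral_return_singleton:
  assumes "{x} \<in> sets M"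
  shows "(\<integral>\<^sup>+ y. f y \<partial>return M x) = f x"
proof -
  have x: "x \<in> space M"
    using sets.sets_into_space[OF assms] by simp
  have "AE y in return M x. y = x"
    by (rule AE_I[where N = "space M - {x}"]) (use assms x in \<open>auto simp: emeasure_return\<close>)
  then have "(\<integral>\<^sup>+ y. f y \<partial>return M x) = (\<integral>\<^sup>+ y. f x \<partial>return M x)"
    by (intro nn_integral_cong_AE) (auto elim: eventually_mono)
  then show ?thesis
    using x by (simp add: emeasure_return)
qed

lemma density_dirac_eq_return:
  fixes p :: "'a::euclidean_space"
  assumes f: "f \<in> borel_measurable borel" and c: "0 \<le> c" "c * f p = 1"
  shows "density (dirac c p) (\<lambda>x. ennreal (f x)) = return borel p"
proof (rule measure_eqI)
  fix A assume "A \<in> sets (density (dirac c p) (\<lambda>x. ennreal (f x)))"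
  then have A [measurable]: "A \<in> sets borel"
    by simp
  have [measurable]: "(\<lambda>x. ennreal (f x)) \<in> borel_measurable (dirac c p)"
      "(\<lambda>x. ennreal (f x) * indicator A x) \<in> borel_measurable borel"
  proof -
    have "borel_measurable (dirac c p) = (borel_measurable borel :: ('a \<Rightarrow> ennreal) set)"
      by (intro measurable_cong_sets) simp_all
    then show "(\<lambda>x. ennreal (f x)) \<in> borel_measurable (dirac c p)"
      "(\<lambda>x. ennreal (f x) * indicator A x) \<in> borel_measurable borel"
      using f by simp_all
  qed
  have "ennreal c * ennreal (f p) = 1"
    using c by (metis ennreal_1 ennreal_mult')
  then show "emeasure (density (dirac c p) (\<lambda>x. ennreal (f x))) A = emeasure (return borel p) A"
    by (subst emeasure_density) (simp_all add: nn_integral_dirac flip: mult.assoc)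
qed simp

context green_kernel
begin

lemma kernel_section_measurable:
  assumes "0 < t" "t \<le> T"
  shows "(\<lambda>y. g x t y) \<in> borel_measurable borel" "(\<lambda>y. g y t x) \<in> borel_measurable borel"
  using assms by (auto intro: kernel_measurable_compose)

lemma forward_solution_dirac:
  assumes "0 \<le> c" "0 < t" "t \<le> T"
  shows "forward_solution g (dirac c p) x t = c * g x t p"
  unfolding forward_solution_def using assms by (intro integral_dirac kernel_section_measurable)

lemma backward_solution_dirac:
  assumes "0 \<le> c" "0 \<le> t" "t < T"
  shows "backward_solution g T (dirac c p) x t = c * g x (T - t) p"
  unfolding backward_solution_def using assms by (intro integral_dirac kernel_section_measurable) auto

text \<open>
The constant \<open>c\<close> of the datum cancels in the quotient of the solutions.
\<close>
lemma forward_kernel_dirac: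
  assumes c: "0 < c" and st: "0 \<le> s" "s < t" "t \<le> T"
  shows "forward_kernel g T (dirac c p) s t x = doob_kernel p s t x"
proof (cases "t < T")
  case True
  then show ?thesis
    using c st by (simp add: forward_kernel_def doob_kernel_def forward_density_def bridge_density_def
        backward_solution_dirac mult.commute)
next
  case False
  have "0 < g x (T - s) p"
    using st by (intro kernel_pos) auto
  then have "density (dirac c p) (\<lambda>y. ennreal (g x (T - s) y / (c * g x (T - s) p))) = return borel p"
    using c st by (intro density_dirac_eq_return borel_measurable_divide kernel_section_measurable) auto
  then show ?thesis
    using False c st by (simp add: forward_kernel_def doob_kernel_def backward_solution_dirac)
qed

text \<open>
Under \<open>t \<mapsto> T - t\<close> the forward solution of a datum turns into its backward solution, and the backward
kernel into the forward kernel.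
\<close>
lemma backward_kernel_dirac:
  assumes c: "0 < c" and st: "0 \<le> s" "s < t" "t \<le> T"
  shows "backward_kernel g (dirac c p) t s x = doob_kernel p (T - t) (T - s) x"
proof -
  have "backward_kernel g (dirac c p) t s x = forward_kernel g T (dirac c p) (T - t) (T - s) x"
    by (simp add: backward_kernel_def forward_kernel_def backward_solution_def forward_solution_def
        backward_density_def forward_density_def Let_def)
  then show ?thesis
    using forward_kernel_dirac[OF c, of "T - t" "T - s"] st by simp
qed

definition time_grid :: "nat \<Rightarrow> (nat \<Rightarrow> real) \<Rightarrow> bool" where
  "time_grid n t \<longleftrightarrow> t 0 = 0 \<and> (\<forall>k\<le>n. t k < t (Suc k)) \<and> t (Suc n) = T"

lemma time_gridD:
  assumes "time_grid n t"
  shows "t 0 = 0" "k \<le> n \<Longrightarrow> t k < t (Suc k)" "t (Suc n) = T"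
  using assms by (auto simp: time_grid_def)

lemma successor_image:
  assumes t: "time_grid n t"
  shows "i < j \<Longrightarrow> j \<le> Suc n \<Longrightarrow> t i < t j" and "interior_times (t ` {1..n})" and "inj_on t {..n}"
    and "k \<le> n \<Longrightarrow> successor (t ` {1..n}) (t k) = t (Suc k)"
proof -
  have less: "t i < t j" if "i < j" "j \<le> Suc n" for i j
    using that
  proof (induction j)
    case (Suc j)
    then show ?case
      using time_gridD(2)[OF t, of j] by (cases "i = j") auto
  qed simp
  then show "i < j \<Longrightarrow> j \<le> Suc n \<Longrightarrow> t i < t j" .
  show int: "interior_times (t ` {1..n})"
    using less[of 0] less[of _ "Suc n"] time_gridD(1,3)[OF t] by (auto simp: interior_times_def)
  show "inj_on t {..n}"
  proof (rule inj_onI)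
    fix i j assume "i \<in> {..n}" "j \<in> {..n}" "t i = t j"
    then show "i = j"
      using less[of i j] less[of j i] by (cases i j rule: linorder_cases) auto
  qed
  assume k: "k \<le> n"
  show "successor (t ` {1..n}) (t k) = t (Suc k)"
  proof (rule successor_eqI[OF int])
    show "t (Suc k) \<in> insert T (t ` {1..n})"
      using k time_gridD(3)[OF t] by (cases "k = n") auto
    show "t k < t (Suc k)"
      using time_gridD(2)[OF t k] .
    fix u assume "u \<in> t ` {1..n}" and u: "t k < u"
    then obtain j where j: "u = t j" "j \<in> {1..n}"
      by auto
    have "k < j"
    proof (rule ccontr)
      assume "\<not> k < j"
      then have "t j \<le> t k"
        using less[of j k] k by (cases "j = k") auto
      then show False
        using u j by simp
    qed
    then show "t (Suc k) \<le> u"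
      using less[of "Suc k" j] j by (cases "j = Suc k") auto
  qed
qed

lemma path_weight_image:
  assumes t: "time_grid n t"
  shows "path_weight (t ` {1..n}) z = (\<Prod>k\<le>n. g (z (t k)) (t (Suc k) - t k) (z (t (Suc k))))"
proof -
  have "insert 0 (t ` {1..n}) = t ` {..n}"
    using time_gridD(1)[OF t] by (auto simp: image_iff atMost_def Bex_def) (metis less_eq_Suc_le not_gr_zero One_nat_def)
  then have "path_weight (t ` {1..n}) z
      = (\<Prod>s\<in>t ` {..n}. g (z s) (successor (t ` {1..n}) s - s) (z (successor (t ` {1..n}) s)))"
    by (simp add: path_weight_def)
  also have "\<dots> = (\<Prod>k\<le>n. g (z (t k)) (successor (t ` {1..n}) (t k) - t k) (z (successor (t ` {1..n}) (t k))))"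
    using successor_image(3)[OF t] by (subst prod.reindex) auto
  also have "\<dots> = (\<Prod>k\<le>n. g (z (t k)) (t (Suc k) - t k) (z (t (Suc k))))"
    using successor_image(4)[OF t] by (intro prod.cong) auto
  finally show ?thesis .
qed

lemma kernel_chain:
  assumes t: "time_grid n t" and k: "k \<le> n"
  shows "0 \<le> t k" "t k < T" "0 < t (Suc k)" "t (Suc k) \<le> T" "0 < g x (t (Suc k) - t k) y"
proof -
  note less = successor_image(1)[OF t]
  show k0: "0 \<le> t k" and kT: "t k < T"
    using less[of 0 k] less[of k "Suc n"] k time_gridD(1,3)[OF t] by (cases "k = 0"; simp)+
  show "0 < t (Suc k)"
    using time_gridD(2)[OF t k] k0 by simp
  show kS: "t (Suc k) \<le> T"
    using less[of "Suc k" "Suc n"] k time_gridD(3)[OF t] by (cases "k = n") auto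
  show "0 < g x (t (Suc k) - t k) y"
    using time_gridD(2)[OF t k] k0 kS by (intro kernel_pos) auto
qed

end

text \<open>
Relates the coordinates indexed by times to those indexed by position numbers.
\<close>
lemma distr_PiM_lborel_reindex:
  fixes t :: "'i \<Rightarrow> 'j"
  assumes fin: "finite I" and inj: "inj_on t I"
  shows "distr (PiM (t ` I) (\<lambda>_. lborel)) (PiM I (\<lambda>_. borel)) (\<lambda>\<xi>. \<lambda>k\<in>I. \<xi> (t k))
    = PiM I (\<lambda>_. lborel :: 'a::euclidean_space measure)"
proof (rule product_sigma_finite.PiM_eqI)
  show "product_sigma_finite (\<lambda>_::'i. lborel :: 'a measure)" ..
  interpret J: product_sigma_finite "\<lambda>_::'j. lborel :: 'a measure" ..
  let ?J = "t ` I" and ?r = "\<lambda>\<xi> :: 'j \<Rightarrow> 'a. \<lambda>k\<in>I. \<xi> (t k)"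
  show "sets (distr (PiM ?J (\<lambda>_. lborel)) (PiM I (\<lambda>_. borel)) ?r) = sets (PiM I (\<lambda>_. lborel :: 'a measure))"
    by (simp cong: sets_PiM_cong)
  fix A assume A: "\<And>i. i \<in> I \<Longrightarrow> A i \<in> sets (lborel :: 'a measure)"
  let ?s = "the_inv_into I t"
  have m: "?r \<in> PiM ?J (\<lambda>_. lborel) \<rightarrow>\<^sub>M PiM I (\<lambda>_. borel :: 'a measure)"
    by (intro measurable_restrict) (simp add: measurable_component_singleton[of _ ?J "\<lambda>_. lborel :: 'a measure", unfolded measurable_lborel2])
  have "emeasure (distr (PiM ?J (\<lambda>_. lborel)) (PiM I (\<lambda>_. borel)) ?r) (Pi\<^sub>E I A)
      = emeasure (PiM ?J (\<lambda>_. lborel)) (?r -` Pi\<^sub>E I A \<inter> space (PiM ?J (\<lambda>_. lborel)))"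
    using A fin by (intro emeasure_distr m sets_PiM_I_finite) auto
  also have "?r -` Pi\<^sub>E I A \<inter> space (PiM ?J (\<lambda>_. lborel)) = Pi\<^sub>E ?J (\<lambda>j. A (?s j))"
    using the_inv_into_f_f[OF inj] by (auto simp: space_PiM PiE_iff)
  also have "emeasure (PiM ?J (\<lambda>_. lborel)) \<dots> = (\<Prod>j\<in>?J. emeasure lborel (A (?s j)))"
    using A fin the_inv_into_f_f[OF inj] by (intro J.emeasure_PiM) auto
  also have "\<dots> = (\<Prod>i\<in>I. emeasure lborel (A i))"
    using inj the_inv_into_f_f[OF inj] by (subst prod.reindex) auto
  finally show "emeasure (distr (PiM ?J (\<lambda>_. lborel)) (PiM I (\<lambda>_. borel)) ?r) (Pi\<^sub>E I A) = (\<Prod>i\<in>I. emeasure lborel (A i))" .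
qed (rule fin)

context pinned_bridge
begin

text \<open>
The path weight along a numbered grid, as a function of the intermediate positions only.
\<close>
definition chain :: "nat \<Rightarrow> (nat \<Rightarrow> real) \<Rightarrow> (nat \<Rightarrow> 'a) \<Rightarrow> real" where
  "chain n t \<eta> = (let y = \<eta>(0 := a, Suc n := b) in \<Prod>k\<le>n. g (y k) (t (Suc k) - t k) (y (Suc k)))"

lemma chain_measurable:
  assumes t: "time_grid n t"
  shows "chain n t \<in> borel_measurable (PiM {1..n} (\<lambda>_. borel))"
proof -
  let ?y = "\<lambda>\<eta>. \<eta>(0 := a, Suc n := b)"
  have y: "(\<lambda>\<eta>. ?y \<eta> k) \<in> borel_measurable (PiM {1..n} (\<lambda>_. borel))" if "k \<le> Suc n" for k
    using that by (cases "k = 0"; cases "k = Suc n") (auto intro!: measurable_component_singleton)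
  have "(\<lambda>\<eta>. g (?y \<eta> k) (t (Suc k) - t k) (?y \<eta> (Suc k))) \<in> borel_measurable (PiM {1..n} (\<lambda>_. borel))"
    if "k \<in> {..n}" for k
    using that time_gridD(2)[OF t, of k] kernel_chain(1,4)[OF t, of k] by (intro kernel_measurable_compose y) auto
  then show ?thesis
    unfolding chain_def Let_def by (rule borel_measurable_prod)
qed

lemma cylinder_measurable:
  assumes "\<And>k. k \<in> I \<Longrightarrow> F k \<in> sets borel"
  shows "(\<lambda>\<eta>. (\<Prod>k\<in>I. indicator (F k) (\<eta> k)) :: ennreal) \<in> borel_measurable (PiM I (\<lambda>_. borel :: 'a measure))"
  using assms
  by (intro borel_measurable_prod_ennreal measurable_compose[OF measurable_component_singleton borel_measurable_indicator])

lemma bridge_finite_dimensional: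
  assumes t: "time_grid n t"
    and F: "\<And>k. k \<in> {1..n} \<Longrightarrow> F k \<in> sets borel"
  shows "emeasure bridge_measure {\<xi> \<in> space bridge_measure. \<forall>k\<in>{1..n}. pinned (t k) \<xi> \<in> F k}
    = (\<integral>\<^sup>+ \<eta>. (\<Prod>k\<in>{1..n}. indicator (F k) (\<eta> k)) * ennreal (chain n t \<eta> / g a T b) \<partial>PiM {1..n} (\<lambda>_. lborel))"
proof -
  let ?J = "t ` {1..n}" and ?P = bridge_measure
  let ?r = "\<lambda>\<xi>. \<lambda>k\<in>{1..n}. \<xi> (t k)"
  let ?C = "\<lambda>\<eta>. (\<Prod>k\<in>{1..n}. indicator (F k) (\<eta> k)) :: ennreal"
  let ?y = "\<lambda>\<eta>. \<eta>(0 := a, Suc n := b)"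
  let ?w = "\<lambda>\<eta>. ennreal (chain n t \<eta> / g a T b)"
  note sc = successor_image[OF t]
  have J: "interior_times ?J"
    by (rule sc(2))
  have tk: "t k \<in> {0<..<T}" if "k \<in> {1..n}" for k
    using J that by (auto simp: interior_times_def image_subset_iff)
  have pin: "pinned (t k) \<xi> = ?y (?r \<xi>) k" if "k \<le> Suc n" for k \<xi>
    using that tk[of k] time_gridD(1,3)[OF t] by (cases "k = 0"; cases "k = Suc n") auto
  have Cm: "?C \<in> borel_measurable (PiM {1..n} (\<lambda>_. borel))"
    by (rule cylinder_measurable[OF F])
  have rm: "?r \<in> PiM ?J (\<lambda>_. borel) \<rightarrow>\<^sub>M PiM {1..n} (\<lambda>_. borel :: 'a measure)"
    by (intro measurable_restrict measurable_component_singleton) auto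
  have wm: "?w \<in> borel_measurable (PiM {1..n} (\<lambda>_. borel))"
    using chain_measurable[OF t] by simp
  have "emeasure ?P {\<xi> \<in> space ?P. \<forall>k\<in>{1..n}. pinned (t k) \<xi> \<in> F k}
      = (\<integral>\<^sup>+ \<xi>. indicator {\<xi> \<in> space ?P. \<forall>k\<in>{1..n}. pinned (t k) \<xi> \<in> F k} \<xi> \<partial>?P)"
  proof (rule nn_integral_indicator[symmetric])
    have "{\<xi> \<in> space ?P. pinned (t k) \<xi> \<in> F k} \<in> sets ?P" if "k \<in> {1..n}" for k
      using measurable_sets[OF pinned_process_measurable F[OF that], of "t k"] by (simp add: vimage_def Int_def conj_commute)
    then show "{\<xi> \<in> space ?P. \<forall>k\<in>{1..n}. pinned (t k) \<xi> \<in> F k} \<in> sets ?P"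
      by (intro sets.sets_Collect_finite_All) auto
  qed
  also have "\<dots> = (\<integral>\<^sup>+ \<xi>. ?C (?r (restrict \<xi> ?J)) \<partial>?P)"
  proof (rule nn_integral_cong)
    fix \<xi> assume "\<xi> \<in> space ?P"
    then show "indicator {\<xi> \<in> space ?P. \<forall>k\<in>{1..n}. pinned (t k) \<xi> \<in> F k} \<xi> = ?C (?r (restrict \<xi> ?J))"
      using tk by (auto simp: indicator_def prod_zero_iff)
  qed
  also have "\<dots> = (\<integral>\<^sup>+ \<xi>. ?C (?r \<xi>) \<partial>bridge_law ?J)"
    by (rule nn_integral_bridge_measure[OF J]) (rule measurable_compose[OF rm Cm])
  also have "\<dots> = (\<integral>\<^sup>+ \<xi>. ennreal (path_weight ?J (\<lambda>\<tau>. pinned \<tau> \<xi>) / g a T b) * ?C (?r \<xi>) \<partial>PiM ?J (\<lambda>_. lborel))"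
    unfolding bridge_law_def
    by (rule nn_integral_density)
      (use path_weight_measurable[OF J] measurable_compose[OF rm Cm] in \<open>simp_all add: measurable_PiM_lborel\<close>)
  also have "\<dots> = (\<integral>\<^sup>+ \<xi>. ?C (?r \<xi>) * ?w (?r \<xi>) \<partial>PiM ?J (\<lambda>_. lborel))"
  proof (rule nn_integral_cong)
    fix \<xi>
    have "path_weight ?J (\<lambda>\<tau>. pinned \<tau> \<xi>) = (\<Prod>k\<le>n. g (pinned (t k) \<xi>) (t (Suc k) - t k) (pinned (t (Suc k)) \<xi>))"
      by (rule path_weight_image[OF t])
    also have "\<dots> = chain n t (?r \<xi>)"
      unfolding chain_def Let_def
    proof (intro prod.cong refl)
      fix k assume "k \<in> {..n}"
      then have "k \<le> Suc n" "Suc k \<le> Suc n"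
        by auto
      from this[THEN pin, of \<xi>]
      show "g (pinned (t k) \<xi>) (t (Suc k) - t k) (pinned (t (Suc k)) \<xi>)
          = g (?y (?r \<xi>) k) (t (Suc k) - t k) (?y (?r \<xi>) (Suc k))"
        by (simp only:)
    qed
    finally have "path_weight ?J (\<lambda>\<tau>. pinned \<tau> \<xi>) = chain n t (?r \<xi>)" .
    then show "ennreal (path_weight ?J (\<lambda>\<tau>. pinned \<tau> \<xi>) / g a T b) * ?C (?r \<xi>) = ?C (?r \<xi>) * ?w (?r \<xi>)"
      by (simp only: mult.commute)
  qed
  also have "\<dots> = (\<integral>\<^sup>+ \<eta>. ?C \<eta> * ?w \<eta> \<partial>distr (PiM ?J (\<lambda>_. lborel)) (PiM {1..n} (\<lambda>_. borel)) ?r)"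
  proof (rule nn_integral_distr[symmetric])
    show "?r \<in> PiM ?J (\<lambda>_. lborel) \<rightarrow>\<^sub>M PiM {1..n} (\<lambda>_. borel :: 'a measure)"
      unfolding measurable_PiM_lborel by (rule rm)
    show "(\<lambda>\<eta>. ?C \<eta> * ?w \<eta>) \<in> borel_measurable (distr (PiM ?J (\<lambda>_. lborel)) (PiM {1..n} (\<lambda>_. borel)) ?r)"
      unfolding measurable_distr_eq1 by (rule borel_measurable_times_ennreal[OF Cm wm])
  qed
  also have "\<dots> = (\<integral>\<^sup>+ \<eta>. ?C \<eta> * ?w \<eta> \<partial>PiM {1..n} (\<lambda>_. lborel))"
    by (subst distr_PiM_lborel_reindex) (use sc(3) in \<open>auto intro: inj_on_subset\<close>)
  finally show ?thesis .
qed

lemma distr_pinned: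
  assumes \<tau>: "0 < \<tau>" "\<tau> < T"
  shows "distr bridge_measure borel (pinned \<tau>) = density lborel (\<lambda>z. ennreal (bridge_density 0 \<tau> T a b z))"
proof (rule measure_eqI)
  interpret prob_space bridge_measure
    by (rule prob_space_bridge_measure)
  fix F assume "F \<in> sets (distr bridge_measure borel (pinned \<tau>))"
  then have F [measurable]: "F \<in> sets borel"
    by simp
  note [measurable] = pinned_process_measurable[of \<tau>]
  have [measurable]: "(\<lambda>z. bridge_density 0 \<tau> T a b z) \<in> borel_measurable borel"
    using \<tau> by (intro bridge_density_measurable) auto
  have "emeasure (distr bridge_measure borel (pinned \<tau>)) F = (\<integral>\<^sup>+ z. indicator F z \<partial>distr bridge_measure borel (pinned \<tau>))"
    by simp
  also have "\<dots> = (\<integral>\<^sup>+ \<xi>. indicator F (pinned \<tau> \<xi>) \<partial>bridge_measure)"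
    by (rule nn_integral_distr) simp_all
  also have "\<dots> = bridge_expectation 0 \<tau> T (indicator F) a b"
    using bridge_cylinder[of 0 \<tau> T "indicator F" "{}"] \<tau> F by (simp add: emeasure_space_1[unfolded space_bridge_measure])
  also have "\<dots> = emeasure (density lborel (\<lambda>z. ennreal (bridge_density 0 \<tau> T a b z))) F"
    by (simp add: bridge_expectation_def emeasure_density)
  finally show "emeasure (distr bridge_measure borel (pinned \<tau>)) F
      = emeasure (density lborel (\<lambda>z. ennreal (bridge_density 0 \<tau> T a b z))) F" .
qed simp

lemma emeasure_pinned:
  assumes "0 < \<tau>" "\<tau> < T" and F: "F \<in> sets borel"
  shows "emeasure bridge_measure {\<xi> \<in> space bridge_measure. pinned \<tau> \<xi> \<in> F}
    = (\<integral>\<^sup>+ z\<in>F. ennreal (bridge_density 0 \<tau> T a b z) \<partial>lborel)"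
proof -
  have [measurable]: "(\<lambda>z. bridge_density 0 \<tau> T a b z) \<in> borel_measurable borel"
    using assms by (intro bridge_density_measurable) auto
  have "emeasure bridge_measure {\<xi> \<in> space bridge_measure. pinned \<tau> \<xi> \<in> F} = emeasure (distr bridge_measure borel (pinned \<tau>)) F"
    using F by (subst emeasure_distr) (auto intro!: pinned_process_measurable arg_cong2[where f = emeasure])
  then show ?thesis
    using F by (simp add: distr_pinned[OF assms(1,2)] emeasure_density)
qed

text \<open>
At time \<open>0\<close> the point \<open>a\<close> has probability one, while the law at time \<open>T / 2\<close> has a density.
\<close>
lemma not_stationary: "\<not> stationary T bridge_measure pinned"
proof
  interpret prob_space bridge_measure
    by (rule prob_space_bridge_measure)
  assume st: "stationary T bridge_measure pinned"
  have "measure bridge_measure {\<xi> \<in> space bridge_measure. \<forall>k\<in>{1..1::nat}. pinned (0 + T / 2) \<xi> \<in> {a}}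
      = measure bridge_measure {\<xi> \<in> space bridge_measure. \<forall>k\<in>{1..1::nat}. pinned 0 \<xi> \<in> {a}}"
    using T_pos by (intro st[unfolded stationary_def, rule_format, of 1 "\<lambda>_. 0" "T / 2" "\<lambda>_. {a}"]) auto
  moreover have "emeasure bridge_measure {\<xi> \<in> space bridge_measure. pinned (T / 2) \<xi> \<in> {a}} = 0"
  proof -
    have "AE z in lborel. z \<noteq> a"
      by (rule AE_lborel_singleton)
    then have "AE z in lborel. ennreal (bridge_density 0 (T / 2) T a b z) * indicator {a} z = 0"
      by eventually_elim simp
    then show ?thesis
      using T_pos by (subst emeasure_pinned) (auto simp: nn_integral_0_iff_AE cong: nn_integral_cong_AE)
  qed
  ultimately show False
    using prob_space by (simp add: measure_def)
qed

end

lemma prod_telescope_forward: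
  fixes w q :: "nat \<Rightarrow> real"
  assumes "\<And>k. k \<le> n \<Longrightarrow> w k \<noteq> 0"
  shows "(\<Prod>k\<in>{1..n}. q k * (w k / w (k - 1))) = (\<Prod>k\<in>{1..n}. q k) * (w n / w 0)"
  using assms
proof (induction n)
  case (Suc n)
  then have "(\<Prod>k\<in>{1..n}. q k * (w k / w (k - 1))) = (\<Prod>k\<in>{1..n}. q k) * (w n / w 0)"
    by simp
  moreover have "w n \<noteq> 0"
    using Suc.prems[of n] by simp
  moreover have "(\<Prod>k\<in>{1..Suc n}. h k) = (\<Prod>k\<in>{1..n}. h k) * h (Suc n)" for h :: "nat \<Rightarrow> real"
    by (simp add: prod.nat_ivl_Suc')
  ultimately show ?case
    by simp
qed simp

lemma prod_telescope_backward:
  fixes w q :: "nat \<Rightarrow> real"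
  assumes "\<And>k. 1 \<le> k \<Longrightarrow> k \<le> Suc n \<Longrightarrow> w k \<noteq> 0"
  shows "(\<Prod>k\<in>{1..n}. q k * (w k / w (Suc k))) = (\<Prod>k\<in>{1..n}. q k) * (w 1 / w (Suc n))"
  using assms
proof (induction n)
  case (Suc n)
  then have "(\<Prod>k\<in>{1..n}. q k * (w k / w (Suc k))) = (\<Prod>k\<in>{1..n}. q k) * (w 1 / w (Suc n))"
    by simp
  moreover have "w (Suc n) \<noteq> 0"
    using Suc.prems[of "Suc n"] by simp
  moreover have "(\<Prod>k\<in>{1..Suc n}. h k) = (\<Prod>k\<in>{1..n}. h k) * h (Suc n)" for h :: "nat \<Rightarrow> real"
    by (simp add: prod.nat_ivl_Suc')
  ultimately show ?case
    by simp
qed simp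

lemma prod_atMost_split_last: "(\<Prod>k\<le>n. h k) = (\<Prod>k\<in>{1..n}. h (k - 1)) * h n" for h :: "nat \<Rightarrow> real"
  by (induction n) (simp_all add: prod.nat_ivl_Suc' mult_ac)

lemma prod_atMost_split_first: "(\<Prod>k\<le>n. h k) = h 0 * (\<Prod>k\<in>{1..n}. h k)" for h :: "nat \<Rightarrow> real"
  by (induction n) (simp_all add: prod.nat_ivl_Suc' mult_ac)

lemma prod_indicator_ennreal:
  assumes "\<And>k. k \<in> I \<Longrightarrow> 0 \<le> q k"
  shows "(\<Prod>k\<in>I. indicator (F k) (\<eta> k) * ennreal (q k)) = (\<Prod>k\<in>I. indicator (F k) (\<eta> k)) * ennreal (\<Prod>k\<in>I. q k)"
  using assms by (simp add: prod.distrib prod_ennreal)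

context pinned_bridge
begin

abbreviation "datum_weight \<equiv> 1 / sqrt (g a T b)"

lemma endpoint_kernel_pos: "0 < g a T b"
  using T_pos by (intro kernel_pos) auto

lemma normalizer: "0 < datum_weight" "datum_weight * (datum_weight * g a T b) = 1"
proof -
  show "0 < datum_weight"
    using endpoint_kernel_pos by simp
  have "g a T b = sqrt (g a T b) * sqrt (g a T b)"
    using endpoint_kernel_pos by simp
  then show "datum_weight * (datum_weight * g a T b) = 1"
    using endpoint_kernel_pos by (simp add: field_simps)
qed

text \<open>
The density \<open>g\<close> contributes the factor \<open>g a T b\<close>, which the two weights of the data cancel.
\<close>
lemma joint_law_dirac: "joint_law g T (dirac datum_weight a) (dirac datum_weight b) = return (borel \<Otimes>\<^sub>M borel) (a, b)"
proof (rule measure_eqI)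
  let ?M = "dirac datum_weight a \<Otimes>\<^sub>M dirac datum_weight b"
  have s: "sets ?M = sets (borel \<Otimes>\<^sub>M borel)"
    by (rule sets_pair_measure_cong) simp_all
  then show "sets (joint_law g T (dirac datum_weight a) (dirac datum_weight b)) = sets (return (borel \<Otimes>\<^sub>M borel) (a, b))"
    by (simp add: joint_law_def)
  have gm [measurable]: "(\<lambda>(x, y). ennreal (g x T y)) \<in> borel_measurable (borel \<Otimes>\<^sub>M borel)"
    using kernel_measurable[of T] T_pos by simp
  interpret b: finite_measure "dirac datum_weight b"
    by (rule finite_measureI) (simp add: space_scale_measure ennreal_mult_less_top less_top[symmetric])
  have ms: "borel_measurable ?M = (borel_measurable (borel \<Otimes>\<^sub>M borel) :: ('a \<times> 'a \<Rightarrow> ennreal) set)"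
    by (rule measurable_cong_sets[OF s refl])
  fix A assume "A \<in> sets (joint_law g T (dirac datum_weight a) (dirac datum_weight b))"
  then have A [measurable]: "A \<in> sets (borel \<Otimes>\<^sub>M borel)"
    by (simp add: joint_law_def s)
  let ?h = "\<lambda>p. (\<lambda>(x, y). ennreal (g x T y)) p * indicator A p"
  have hm [measurable]: "?h \<in> borel_measurable (borel \<Otimes>\<^sub>M borel)"
    by measurable
  have "emeasure (joint_law g T (dirac datum_weight a) (dirac datum_weight b)) A = (\<integral>\<^sup>+ p. ?h p \<partial>?M)"
    unfolding joint_law_def using A gm by (intro emeasure_density) (simp_all only: s ms)
  also have "\<dots> = (\<integral>\<^sup>+ x. \<integral>\<^sup>+ y. ?h (x, y) \<partial>dirac datum_weight b \<partial>dirac datum_weight a)"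
    by (rule b.nn_integral_fst[symmetric]) (use hm ms in simp)
  also have "\<dots> = (\<integral>\<^sup>+ x. ennreal datum_weight * ?h (x, b) \<partial>dirac datum_weight a)"
    by (intro nn_integral_cong nn_integral_dirac) measurable
  also have "\<dots> = ennreal datum_weight * (ennreal datum_weight * ?h (a, b))"
    by (rule nn_integral_dirac) measurable
  also have "\<dots> = ennreal (datum_weight * (datum_weight * g a T b)) * indicator A (a, b)"
    unfolding ennreal_mult'[OF less_imp_le[OF normalizer(1)]] by (simp only: case_prod_conv mult.assoc)
  also have "\<dots> = emeasure (return (borel \<Otimes>\<^sub>M borel) (a, b)) A"
    using A by (simp only: normalizer(2)) simp
  finally show "emeasure (joint_law g T (dirac datum_weight a) (dirac datum_weight b)) A = emeasure (return (borel \<Otimes>\<^sub>M borel) (a, b)) A" .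
qed

lemma chain_split_last:
  assumes t: "time_grid n t"
  shows "chain n t \<eta> = (\<Prod>k\<in>{1..n}. g ((\<eta>(0 := a)) (k - 1)) (t k - t (k - 1)) (\<eta> k)) * g ((\<eta>(0 := a)) n) (T - t n) b"
proof -
  have "(\<Prod>k\<in>{1..n}. g ((\<eta>(0 := a, Suc n := b)) (k - 1)) (t (Suc (k - 1)) - t (k - 1)) ((\<eta>(0 := a, Suc n := b)) (Suc (k - 1))))
      = (\<Prod>k\<in>{1..n}. g ((\<eta>(0 := a)) (k - 1)) (t k - t (k - 1)) (\<eta> k))"
    by (intro prod.cong) auto
  then show ?thesis
    unfolding chain_def Let_def prod_atMost_split_last using time_gridD(3)[OF t] by auto
qed

lemma chain_split_first:
  assumes t: "time_grid n t" and n: "1 \<le> n"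
  shows "chain n t \<eta> = g a (t 1) (\<eta> 1) * (\<Prod>k\<in>{1..n}. g (\<eta> k) (t (Suc k) - t k) ((\<eta>(Suc n := b)) (Suc k)))"
proof -
  have "(\<Prod>k\<in>{1..n}. g ((\<eta>(0 := a, Suc n := b)) k) (t (Suc k) - t k) ((\<eta>(0 := a, Suc n := b)) (Suc k)))
      = (\<Prod>k\<in>{1..n}. g (\<eta> k) (t (Suc k) - t k) ((\<eta>(Suc n := b)) (Suc k)))"
    by (intro prod.cong) auto
  then show ?thesis
    unfolding chain_def Let_def prod_atMost_split_first using time_gridD(1)[OF t] n by auto
qed

text \<open>
The outer integral is evaluation at \<open>(a, b)\<close>, which leaves the finite-dimensional formula with the
step factors read backwards in space.
\<close>
lemma pinned_associated:
  "bernstein_process_associated g T (joint_law g T (dirac datum_weight a) (dirac datum_weight b)) bridge_measure pinned"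
  unfolding bernstein_process_associated_def joint_law_dirac
proof (intro conjI allI impI pinned_bernstein_process)
  show "prob_space (return (borel \<Otimes>\<^sub>M borel) (a, b))"
    by (rule prob_space_return) (simp add: space_pair_measure)
  show "sets (return (borel \<Otimes>\<^sub>M borel) (a, b)) = sets (borel \<Otimes>\<^sub>M borel)"
    by simp
  fix n :: nat and t and F :: "nat \<Rightarrow> 'a set" and F0 FT :: "'a set"
  assume asm: "t 0 = 0 \<and> (\<forall>k<n. t k < t (Suc k)) \<and> t n < T \<and> F0 \<in> sets borel \<and>
      (\<forall>k\<in>{1..n}. F k \<in> sets borel) \<and> FT \<in> sets borel"
  \<comment> \<open>The value of the grid beyond its last time is unspecified; it becomes the final time.\<close>
  define t' where "t' = t(Suc n := T)"
  have t': "t' 0 = 0" "\<And>k. k \<le> n \<Longrightarrow> t' k < t' (Suc k)" "t' (Suc n) = T"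
    using asm by (auto simp: t'_def le_less)
  then have p': "time_grid n t'"
    by (simp add: time_grid_def)
  have tt: "t' k = t k" if "k \<le> n" for k
    using that by (simp add: t'_def)
  let ?C = "\<lambda>\<xi>. (\<Prod>k\<in>{1..n}. indicator (F k) (\<xi> k)) :: ennreal"
  let ?S = "{\<xi> \<in> space bridge_measure. \<forall>k\<in>{1..n}. pinned (t k) \<xi> \<in> F k}"
  let ?i = "\<lambda>\<xi>. (\<Prod>k\<in>{1..n}. indicator (F k) (\<xi> k) * ennreal (g (\<xi> k) (t k - t (k - 1)) ((\<xi>(0 := a)) (k - 1))))
      * ennreal (g b (T - t n) ((\<xi>(0 := a)) n))"
  have times: "0 < t k - t (k - 1)" "t k - t (k - 1) \<le> T" if "k \<in> {1..n}" for k
  proof -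
    have "k - 1 \<le> n" "Suc (k - 1) = k"
      using that by auto
    then show "0 < t k - t (k - 1)" "t k - t (k - 1) \<le> T"
      using that kernel_chain(1,4)[OF p', of "k - 1"] t'(2)[of "k - 1"] tt[of k] tt[of "k - 1"] by auto
  qed
  have last: "0 < T - t n" "T - t n \<le> T"
    using kernel_chain(1,2)[OF p', of n] tt[of n] by auto
  have integrand: "?i \<xi> = ?C \<xi> * ennreal (chain n t' \<xi>)" for \<xi>
  proof -
    let ?q = "\<lambda>k. g ((\<xi>(0 := a)) (k - 1)) (t k - t (k - 1)) (\<xi> k)"
    have q: "0 \<le> ?q k" if "k \<in> {1..n}" for k
      by (rule less_imp_le, rule kernel_pos) (rule times[OF that])+
    have "(\<Prod>k\<in>{1..n}. indicator (F k) (\<xi> k) * ennreal (g (\<xi> k) (t k - t (k - 1)) ((\<xi>(0 := a)) (k - 1))))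
        = (\<Prod>k\<in>{1..n}. indicator (F k) (\<xi> k) * ennreal (?q k))"
      using kernel_sym[OF times] by (intro prod.cong refl arg_cong2[where f = "(*)"] arg_cong[where f = ennreal]) auto
    also have "\<dots> = ?C \<xi> * ennreal (\<Prod>k\<in>{1..n}. ?q k)"
      by (rule prod_indicator_ennreal) (rule q)
    finally have 1: "(\<Prod>k\<in>{1..n}. indicator (F k) (\<xi> k) * ennreal (g (\<xi> k) (t k - t (k - 1)) ((\<xi>(0 := a)) (k - 1))))
        = ?C \<xi> * ennreal (\<Prod>k\<in>{1..n}. ?q k)" .
    have 2: "chain n t' \<xi> = (\<Prod>k\<in>{1..n}. ?q k) * g b (T - t n) ((\<xi>(0 := a)) n)"
    proof -
      have "(\<Prod>k\<in>{1..n}. g ((\<xi>(0 := a)) (k - 1)) (t' k - t' (k - 1)) (\<xi> k)) = (\<Prod>k\<in>{1..n}. ?q k)"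
        using tt by (intro prod.cong) auto
      then show ?thesis
        unfolding chain_split_last[OF p'] kernel_sym[OF last, of b] using tt[of n] by (simp only: order_refl)
    qed
    have "0 \<le> (\<Prod>k\<in>{1..n}. ?q k)"
      using q by (intro prod_nonneg)
    then show ?thesis
      unfolding 1 2 by (simp only: ennreal_mult' mult.assoc)
  qed
  have m: "(\<lambda>\<xi>. ?C \<xi> * ennreal (chain n t' \<xi>)) \<in> borel_measurable (PiM {1..n} (\<lambda>_. lborel :: 'a measure))"
    unfolding measurable_PiM_lborel using asm chain_measurable[OF p']
    by (intro borel_measurable_times_ennreal cylinder_measurable) auto
  have "emeasure bridge_measure ?S = emeasure bridge_measure {\<xi> \<in> space bridge_measure. \<forall>k\<in>{1..n}. pinned (t' k) \<xi> \<in> F k}"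
    using tt by (intro arg_cong2[where f = emeasure]) auto
  also have "\<dots> = (\<integral>\<^sup>+ \<xi>. ?C \<xi> * ennreal (chain n t' \<xi> / g a T b) \<partial>PiM {1..n} (\<lambda>_. lborel))"
    using asm by (intro bridge_finite_dimensional[OF p']) auto
  also have "\<dots> = (\<integral>\<^sup>+ \<xi>. ennreal (1 / g a T b) * (?C \<xi> * ennreal (chain n t' \<xi>)) \<partial>PiM {1..n} (\<lambda>_. lborel))"
  proof (rule nn_integral_cong)
    fix \<xi>
    have "ennreal (chain n t' \<xi> / g a T b) = ennreal (1 / g a T b) * ennreal (chain n t' \<xi>)"
      using endpoint_kernel_pos by (simp flip: ennreal_mult')
    then show "?C \<xi> * ennreal (chain n t' \<xi> / g a T b) = ennreal (1 / g a T b) * (?C \<xi> * ennreal (chain n t' \<xi>))"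
      by (simp only: mult.left_commute)
  qed
  also have "\<dots> = ennreal (1 / g a T b) * (\<integral>\<^sup>+ \<xi>. ?C \<xi> * ennreal (chain n t' \<xi>) \<partial>PiM {1..n} (\<lambda>_. lborel))"
    by (rule nn_integral_cmult[OF m])
  also have "\<dots> = ennreal (1 / g a T b) * (\<integral>\<^sup>+ \<xi>. ?i \<xi> \<partial>PiM {1..n} (\<lambda>_. lborel))"
    by (simp only: integrand)
  finally have S: "emeasure bridge_measure ?S = ennreal (1 / g a T b) * (\<integral>\<^sup>+ \<xi>. ?i \<xi> \<partial>PiM {1..n} (\<lambda>_. lborel))" .
  have "{\<xi> \<in> space bridge_measure. pinned 0 \<xi> \<in> F0 \<and> (\<forall>k\<in>{1..n}. pinned (t k) \<xi> \<in> F k) \<and> pinned T \<xi> \<in> FT}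
      = (if a \<in> F0 \<and> b \<in> FT then ?S else {})"
    by auto
  then have "emeasure bridge_measure {\<xi> \<in> space bridge_measure. pinned 0 \<xi> \<in> F0 \<and> (\<forall>k\<in>{1..n}. pinned (t k) \<xi> \<in> F k) \<and> pinned T \<xi> \<in> FT}
      = indicator (F0 \<times> FT) (a, b) * emeasure bridge_measure ?S"
    by (simp add: indicator_def)
  also have "\<dots> = (case (a, b) of (x, y) \<Rightarrow> indicator (F0 \<times> FT) (x, y) * ennreal (1 / g x T y) *
            (\<integral>\<^sup>+ \<xi>. (\<Prod>k\<in>{1..n}. indicator (F k) (\<xi> k) * ennreal (g (\<xi> k) (t k - t (k - 1)) ((\<xi>(0 := x)) (k - 1))))
                  * ennreal (g y (T - t n) ((\<xi>(0 := x)) n)) \<partial>Pi\<^sub>M {1..n} (\<lambda>_. lborel)))"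
    unfolding S case_prod_conv by (simp only: mult.assoc)
  also have "\<dots> = (\<integral>\<^sup>+ (x, y). indicator (F0 \<times> FT) (x, y) * ennreal (1 / g x T y) *
            (\<integral>\<^sup>+ \<xi>. (\<Prod>k\<in>{1..n}. indicator (F k) (\<xi> k) * ennreal (g (\<xi> k) (t k - t (k - 1)) ((\<xi>(0 := x)) (k - 1))))
                  * ennreal (g y (T - t n) ((\<xi>(0 := x)) n)) \<partial>Pi\<^sub>M {1..n} (\<lambda>_. lborel)) \<partial>return (borel \<Otimes>\<^sub>M borel) (a, b))"
    using pair_measureI[of "{a}" borel "{b}" borel] by (intro nn_integral_return_singleton[symmetric]) simp
  finally show "emeasure bridge_measure {\<xi> \<in> space bridge_measure. pinned 0 \<xi> \<in> F0 \<and> (\<forall>k\<in>{1..n}. pinned (t k) \<xi> \<in> F k) \<and> pinned T \<xi> \<in> FT}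
      = (\<integral>\<^sup>+ (x, y). indicator (F0 \<times> FT) (x, y) * ennreal (1 / g x T y) *
            (\<integral>\<^sup>+ \<xi>. (\<Prod>k\<in>{1..n}. indicator (F k) (\<xi> k) * ennreal (g (\<xi> k) (t k - t (k - 1)) ((\<xi>(0 := x)) (k - 1))))
                  * ennreal (g y (T - t n) ((\<xi>(0 := x)) n)) \<partial>Pi\<^sub>M {1..n} (\<lambda>_. lborel)) \<partial>return (borel \<Otimes>\<^sub>M borel) (a, b))" .
qed

lemma density_initial:
  "density (dirac datum_weight a) (\<lambda>x. ennreal (backward_solution g T (dirac datum_weight b) x 0)) = return borel a"
proof -
  have eq: "(\<lambda>x. ennreal (backward_solution g T (dirac datum_weight b) x 0)) = (\<lambda>x. ennreal (datum_weight * g x T b))"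
    using T_pos normalizer(1) by (simp add: backward_solution_dirac)
  show ?thesis
    unfolding eq using normalizer T_pos
    by (intro density_dirac_eq_return borel_measurable_times borel_measurable_const kernel_section_measurable) auto
qed

lemma density_final:
  "density (dirac datum_weight b) (\<lambda>x. ennreal (forward_solution g (dirac datum_weight a) x T)) = return borel b"
proof -
  have eq: "(\<lambda>x. ennreal (forward_solution g (dirac datum_weight a) x T)) = (\<lambda>x. ennreal (datum_weight * g a T x))"
    using T_pos normalizer(1) kernel_sym[of T a] by (simp add: forward_solution_dirac)
  show ?thesis
    unfolding eq using normalizer T_pos
    by (intro density_dirac_eq_return borel_measurable_times borel_measurable_const kernel_section_measurable) auto
qed

text \<open>
The quotients of \<open>v\<close> telescope to \<open>g x\<^sub>n (T - t\<^sub>n) b / g a T b\<close>, which is the last step of the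
bridge together with its normalization.
\<close>
lemma forward_finite_dimensional:
  assumes t: "t 0 = 0" "\<And>k. k < n \<Longrightarrow> t k < t (Suc k)" "t n < T"
    and F: "\<And>k. k \<in> {1..n} \<Longrightarrow> F k \<in> sets borel"
  shows "emeasure bridge_measure {\<xi> \<in> space bridge_measure. \<forall>k\<in>{1..n}. pinned (t k) \<xi> \<in> F k}
    = (\<integral>\<^sup>+ x. (\<integral>\<^sup>+ \<eta>. (\<Prod>k\<in>{1..n}. indicator (F k) (\<eta> k) *
          ennreal (forward_density g (backward_solution g T (dirac datum_weight b)) ((\<eta>(0 := x)) (k - 1)) (t (k - 1)) (\<eta> k) (t k)))
        \<partial>PiM {1..n} (\<lambda>_. lborel)) \<partial>density (dirac datum_weight a) (\<lambda>x. ennreal (backward_solution g T (dirac datum_weight b) x 0)))"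
proof -
  let ?v = "backward_solution g T (dirac datum_weight b)"
  let ?C = "\<lambda>\<xi>. (\<Prod>k\<in>{1..n}. indicator (F k) (\<xi> k)) :: ennreal"
  \<comment> \<open>The value of the grid beyond its last time is unspecified; it becomes the final time.\<close>
  define t' where "t' = t(Suc n := T)"
  have t': "t' 0 = 0" "\<And>k. k \<le> n \<Longrightarrow> t' k < t' (Suc k)" "t' (Suc n) = T"
    using t by (auto simp: t'_def le_less)
  then have p': "time_grid n t'"
    by (simp add: time_grid_def)
  have tt: "t' k = t k" if "k \<le> n" for k
    using that by (simp add: t'_def)
  have range: "0 \<le> t k" "t k < T" if "k \<le> n" for k
    using kernel_chain(1,2)[OF p' that] tt[OF that] by auto
  have v: "?v x (t k) = datum_weight * g x (T - t k) b" "0 < ?v x (t k)" if "k \<le> n" for x k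
  proof -
    show eq: "?v x (t k) = datum_weight * g x (T - t k) b"
      using range[OF that] normalizer(1) by (intro backward_solution_dirac) auto
    show "0 < ?v x (t k)"
      unfolding eq using range[OF that] normalizer(1) by (intro mult_pos_pos kernel_pos) auto
  qed
  have integrand: "(\<Prod>k\<in>{1..n}. indicator (F k) (\<eta> k) * ennreal (forward_density g ?v ((\<eta>(0 := a)) (k - 1)) (t (k - 1)) (\<eta> k) (t k)))
      = ?C \<eta> * ennreal (chain n t' \<eta> / g a T b)" for \<eta>
  proof -
    let ?y = "\<eta>(0 := a)"
    let ?q = "\<lambda>k. g (?y (k - 1)) (t k - t (k - 1)) (\<eta> k)" and ?w = "\<lambda>k. ?v (?y k) (t k)"
    have d: "forward_density g ?v (?y (k - 1)) (t (k - 1)) (\<eta> k) (t k) = ?q k * (?w k / ?w (k - 1))" if "k \<in> {1..n}" for k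
      using that by (auto simp: forward_density_def)
    have q: "0 < ?q k" if "k \<in> {1..n}" for k
      using kernel_chain(5)[OF p', of "k - 1" "?y (k - 1)" "\<eta> k"] that tt[of k] tt[of "k - 1"] by auto
    have "(\<Prod>k\<in>{1..n}. indicator (F k) (\<eta> k) * ennreal (forward_density g ?v (?y (k - 1)) (t (k - 1)) (\<eta> k) (t k)))
        = (\<Prod>k\<in>{1..n}. indicator (F k) (\<eta> k) * ennreal (?q k * (?w k / ?w (k - 1))))"
      using d by (intro prod.cong refl arg_cong2[where f = "(*)"] arg_cong[where f = ennreal])
    also have "\<dots> = ?C \<eta> * ennreal (\<Prod>k\<in>{1..n}. ?q k * (?w k / ?w (k - 1)))"
    proof (rule prod_indicator_ennreal)
      fix k assume k: "k \<in> {1..n}"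
      have "0 < ?w k"
        by (rule v(2)) (use k in simp)
      moreover have "0 < ?w (k - 1)"
        by (rule v(2)) (use k in auto)
      ultimately show "0 \<le> ?q k * (?w k / ?w (k - 1))"
        by (intro mult_nonneg_nonneg divide_nonneg_nonneg less_imp_le[OF q[OF k]] less_imp_le)
    qed
    also have "(\<Prod>k\<in>{1..n}. ?q k * (?w k / ?w (k - 1))) = (\<Prod>k\<in>{1..n}. ?q k) * (?w n / ?w 0)"
    proof (rule prod_telescope_forward)
      show "?w k \<noteq> 0" if "k \<le> n" for k
        using v(2)[OF that, of "?y k"] by (simp del: fun_upd_apply)
    qed
    also have "(\<Prod>k\<in>{1..n}. ?q k) = (\<Prod>k\<in>{1..n}. g (?y (k - 1)) (t' k - t' (k - 1)) (\<eta> k))"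
      using tt by (intro prod.cong) auto
    also have "?w n / ?w 0 = g (?y n) (T - t' n) b / g a T b"
      using v(1)[of n "?y n"] v(1)[of 0 "?y 0"] t(1) tt[of n] normalizer(1) by simp
    finally show ?thesis
      unfolding chain_split_last[OF p'] by (simp only: times_divide_eq_right)
  qed
  have "emeasure bridge_measure {\<xi> \<in> space bridge_measure. \<forall>k\<in>{1..n}. pinned (t k) \<xi> \<in> F k}
      = emeasure bridge_measure {\<xi> \<in> space bridge_measure. \<forall>k\<in>{1..n}. pinned (t' k) \<xi> \<in> F k}"
    using tt by (intro arg_cong2[where f = emeasure]) auto
  also have "\<dots> = (\<integral>\<^sup>+ \<eta>. ?C \<eta> * ennreal (chain n t' \<eta> / g a T b) \<partial>PiM {1..n} (\<lambda>_. lborel))"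
    using F by (intro bridge_finite_dimensional[OF p']) auto
  finally show ?thesis
    unfolding density_initial integrand[symmetric] by (subst nn_integral_return_singleton) simp_all
qed

text \<open>
The quotients of \<open>u\<close> telescope to \<open>g x\<^sub>1 t\<^sub>1 a / g b T a\<close>, which is the first step of the bridge
together with its normalization.
\<close>
lemma backward_finite_dimensional:
  assumes t: "0 < t 1" "\<And>k. k \<in> {1..n} \<Longrightarrow> t k < t (Suc k)" "t (Suc n) = T" and n: "1 \<le> n"
    and F: "\<And>k. k \<in> {1..n} \<Longrightarrow> F k \<in> sets borel"
  shows "emeasure bridge_measure {\<xi> \<in> space bridge_measure. \<forall>k\<in>{1..n}. pinned (t k) \<xi> \<in> F k}
    = (\<integral>\<^sup>+ x. (\<integral>\<^sup>+ \<eta>. (\<Prod>k\<in>{1..n}. indicator (F k) (\<eta> k) *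
          ennreal (backward_density g (forward_solution g (dirac datum_weight a)) ((\<eta>(Suc n := x)) (Suc k)) (t (Suc k)) (\<eta> k) (t k)))
        \<partial>PiM {1..n} (\<lambda>_. lborel)) \<partial>density (dirac datum_weight b) (\<lambda>x. ennreal (forward_solution g (dirac datum_weight a) x T)))"
proof -
  let ?u = "forward_solution g (dirac datum_weight a)"
  let ?C = "\<lambda>\<xi>. (\<Prod>k\<in>{1..n}. indicator (F k) (\<xi> k)) :: ennreal"
  \<comment> \<open>The value of the grid at index 0 is unspecified; it becomes the initial time.\<close>
  define t' where "t' = t(0 := 0)"
  have t': "t' 0 = 0" "\<And>k. k \<le> n \<Longrightarrow> t' k < t' (Suc k)" "t' (Suc n) = T"
    using t by (auto simp: t'_def)
  then have p': "time_grid n t'"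
    by (simp add: time_grid_def)
  have tt: "t' k = t k" if "1 \<le> k" for k
    using that by (simp add: t'_def)
  have range: "0 < t k" "t k \<le> T" if "k \<in> {1..Suc n}" for k
    using kernel_chain(3,4)[OF p', of "k - 1"] tt[of k] that by auto
  have u: "?u x (t k) = datum_weight * g x (t k) a" "0 < ?u x (t k)" if "k \<in> {1..Suc n}" for x k
  proof -
    show eq: "?u x (t k) = datum_weight * g x (t k) a"
      using range[OF that] normalizer(1) by (intro forward_solution_dirac) auto
    show "0 < ?u x (t k)"
      unfolding eq using range[OF that] normalizer(1) by (intro mult_pos_pos kernel_pos) auto
  qed
  have integrand: "(\<Prod>k\<in>{1..n}. indicator (F k) (\<eta> k) * ennreal (backward_density g ?u ((\<eta>(Suc n := b)) (Suc k)) (t (Suc k)) (\<eta> k) (t k)))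
      = ?C \<eta> * ennreal (chain n t' \<eta> / g a T b)" for \<eta>
  proof -
    let ?y = "\<eta>(Suc n := b)"
    let ?q = "\<lambda>k. g (\<eta> k) (t (Suc k) - t k) (?y (Suc k))" and ?w = "\<lambda>k. ?u (?y k) (t k)"
    have step: "0 < t (Suc k) - t k" "t (Suc k) - t k \<le> T" if "k \<in> {1..n}" for k
      using t(2)[OF that] range[of k] range[of "Suc k"] that by auto
    have d: "backward_density g ?u (?y (Suc k)) (t (Suc k)) (\<eta> k) (t k) = ?q k * (?w k / ?w (Suc k))" if "k \<in> {1..n}" for k
      using that kernel_sym[OF step[OF that], of "?y (Suc k)" "\<eta> k"] by (auto simp: backward_density_def)
    have q: "0 < ?q k" if "k \<in> {1..n}" for k
      using step[OF that] by (rule kernel_pos)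
    have "(\<Prod>k\<in>{1..n}. indicator (F k) (\<eta> k) * ennreal (backward_density g ?u (?y (Suc k)) (t (Suc k)) (\<eta> k) (t k)))
        = (\<Prod>k\<in>{1..n}. indicator (F k) (\<eta> k) * ennreal (?q k * (?w k / ?w (Suc k))))"
      using d by (intro prod.cong refl arg_cong2[where f = "(*)"] arg_cong[where f = ennreal])
    also have "\<dots> = ?C \<eta> * ennreal (\<Prod>k\<in>{1..n}. ?q k * (?w k / ?w (Suc k)))"
    proof (rule prod_indicator_ennreal)
      fix k assume k: "k \<in> {1..n}"
      then have "0 < ?w k" "0 < ?w (Suc k)"
        by (intro u(2), simp)+
      then show "0 \<le> ?q k * (?w k / ?w (Suc k))"
        by (intro mult_nonneg_nonneg divide_nonneg_nonneg less_imp_le[OF q[OF k]] less_imp_le)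
    qed
    also have "(\<Prod>k\<in>{1..n}. ?q k * (?w k / ?w (Suc k))) = (\<Prod>k\<in>{1..n}. ?q k) * (?w 1 / ?w (Suc n))"
    proof (rule prod_telescope_backward)
      show "?w k \<noteq> 0" if "1 \<le> k" "k \<le> Suc n" for k
        using u(2)[of k "?y k"] that by (simp del: fun_upd_apply)
    qed
    also have "(\<Prod>k\<in>{1..n}. ?q k) = (\<Prod>k\<in>{1..n}. g (\<eta> k) (t' (Suc k) - t' k) (?y (Suc k)))"
      using tt by (intro prod.cong) auto
    also have "?w 1 / ?w (Suc n) = g a (t' 1) (\<eta> 1) / g a T b"
      using u(1)[of 1 "?y 1"] u(1)[of "Suc n" "?y (Suc n)"] t(3) tt[of 1] normalizer(1) n range[of 1]
        kernel_sym[of "t 1" a "\<eta> 1"] kernel_sym[of T a b] T_pos by simp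
    finally show ?thesis
      unfolding chain_split_first[OF p' n] by (simp only: times_divide_eq_right times_divide_eq_left mult_ac)
  qed
  have "emeasure bridge_measure {\<xi> \<in> space bridge_measure. \<forall>k\<in>{1..n}. pinned (t k) \<xi> \<in> F k}
      = emeasure bridge_measure {\<xi> \<in> space bridge_measure. \<forall>k\<in>{1..n}. pinned (t' k) \<xi> \<in> F k}"
    using tt by (intro arg_cong2[where f = emeasure]) auto
  also have "\<dots> = (\<integral>\<^sup>+ \<eta>. ?C \<eta> * ennreal (chain n t' \<eta> / g a T b) \<partial>PiM {1..n} (\<lambda>_. lborel))"
    using F by (intro bridge_finite_dimensional[OF p']) auto
  finally show ?thesis
    unfolding density_final integrand[symmetric] by (subst nn_integral_return_singleton) simp_all
qed

lemma bridge_density_product: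
  assumes "0 < t" "t < T"
  shows "bridge_density 0 t T a b x = forward_solution g (dirac datum_weight a) x t * backward_solution g T (dirac datum_weight b) x t"
proof -
  have "forward_solution g (dirac datum_weight a) x t * backward_solution g T (dirac datum_weight b) x t
      = (datum_weight * datum_weight) * (g x t a * g x (T - t) b)"
    using assms normalizer(1) by (simp only: forward_solution_dirac backward_solution_dirac less_imp_le) (simp only: mult_ac)
  also have "datum_weight * datum_weight = 1 / g a T b"
    using normalizer(2) endpoint_kernel_pos by (simp add: field_simps)
  also have "g x t a = g a t x"
    using assms by (intro kernel_sym) auto
  finally show ?thesis
    by (simp add: bridge_density_def)
qed

lemma forward_solution_datum_pos:
  assumes "t \<in> {0<..T}"
  shows "0 < forward_solution g (dirac datum_weight a) x t"
proof -
  have "forward_solution g (dirac datum_weight a) x t = datum_weight * g x t a"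
    using normalizer(1) assms by (intro forward_solution_dirac) auto
  moreover have "0 < datum_weight * g x t a"
    using assms by (intro mult_pos_pos normalizer kernel_pos) auto
  ultimately show ?thesis
    by (simp only:)
qed

lemma backward_solution_datum_pos:
  assumes "t \<in> {0..<T}"
  shows "0 < backward_solution g T (dirac datum_weight b) x t"
proof -
  have "backward_solution g T (dirac datum_weight b) x t = datum_weight * g x (T - t) b"
    using normalizer(1) assms by (intro backward_solution_dirac) auto
  moreover have "0 < datum_weight * g x (T - t) b"
    using assms by (intro mult_pos_pos normalizer kernel_pos) auto
  ultimately show ?thesis
    by (simp only:)
qed

lemma pinned_endpoints:
  "measure bridge_measure {\<omega> \<in> space bridge_measure. pinned 0 \<omega> = a} = 1"
  "measure bridge_measure {\<omega> \<in> space bridge_measure. pinned T \<omega> = b} = 1"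
  using prob_space.prob_space[OF prob_space_bridge_measure] by simp_all

lemma pinned_marginal:
  assumes "t \<in> {0<..<T}" and F: "F \<in> sets borel"
  shows "emeasure bridge_measure {\<omega> \<in> space bridge_measure. pinned t \<omega> \<in> F}
    = (\<integral>\<^sup>+ x\<in>F. ennreal (forward_solution g (dirac datum_weight a) x t
        * backward_solution g T (dirac datum_weight b) x t) \<partial>lborel)"
proof -
  have t: "0 < t" "t < T"
    using assms by auto
  show ?thesis
    unfolding emeasure_pinned[OF t F] bridge_density_product[OF t] ..
qed

lemma pinned_expectation:
  fixes f :: "'a \<Rightarrow> complex"
  assumes "t \<in> {0<..<T}" and f: "f \<in> bounded_borel"
  shows "(LINT \<omega>|bridge_measure. f (pinned t \<omega>))
    = (LINT x|lborel. f x * of_real (forward_solution g (dirac datum_weight a) x t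
        * backward_solution g T (dirac datum_weight b) x t))"
proof -
  have t: "0 < t" "t < T"
    using assms by auto
  have [measurable]: "f \<in> borel_measurable borel"
    using f by (simp add: bounded_borel_def)
  have d [measurable]: "(\<lambda>z. bridge_density 0 t T a b z) \<in> borel_measurable borel"
    using t by (intro bridge_density_measurable) auto
  have "(LINT \<omega>|bridge_measure. f (pinned t \<omega>)) = (LINT x|distr bridge_measure borel (pinned t). f x)"
    by (rule integral_distr[symmetric]) (auto intro: pinned_process_measurable)
  also have "\<dots> = (LINT x|lborel. bridge_density 0 t T a b x *\<^sub>R f x)"
    unfolding distr_pinned[OF t] using t bridge_density_pos[of 0 t T a b]
    by (intro integral_density) (auto intro: less_imp_le)
  also have "\<dots> = (LINT x|lborel. f x * of_real (forward_solution g (dirac datum_weight a) x t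
        * backward_solution g T (dirac datum_weight b) x t))"
    unfolding bridge_density_product[OF t] scaleR_conv_of_real by (simp only: mult.commute)
  finally show ?thesis .
qed

end

theorem theorem1:
  fixes V :: "real ^ 'd \<Rightarrow> real"
    and T :: real
    and E :: "nat ^ 'd \<Rightarrow> real"
    and e :: "nat ^ 'd \<Rightarrow> real ^ 'd \<Rightarrow> complex"
    and g :: "real ^ 'd \<Rightarrow> real \<Rightarrow> real ^ 'd \<Rightarrow> real"
    and a b :: "nat ^ 'd \<Rightarrow> real ^ 'd"
    and \<phi> \<psi> :: "nat ^ 'd \<Rightarrow> (real ^ 'd) measure"
    and u v :: "nat ^ 'd \<Rightarrow> real ^ 'd \<Rightarrow> real \<Rightarrow> real"
  assumes T: "0 < T"
    and V: "hypothesis_H V"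
    and basis: "eigenbasis V E e"
    and trace: "\<And>t. 0 < t \<Longrightarrow> t \<le> T \<Longrightarrow> (\<lambda>m. exp (- t * E m)) summable_on UNIV"
    and g: "green_function E e T g"
  defines "\<phi> \<equiv> \<lambda>m. initial_datum g T (a m) (b m)"
    and "\<psi> \<equiv> \<lambda>m. final_datum g T (a m) (b m)"
    and "u \<equiv> \<lambda>m. forward_solution g (\<phi> m)"
    and "v \<equiv> \<lambda>m. backward_solution g T (\<psi> m)"
  shows "\<forall>m.
    (\<forall>x. \<forall>t\<in>{0<..T}. 0 < u m x t) \<and> (\<forall>x. \<forall>t\<in>{0..<T}. 0 < v m x t) \<and>
    (\<exists>(P :: (real \<Rightarrow> real ^ 'd) measure) (Z :: real \<Rightarrow> (real \<Rightarrow> real ^ 'd) \<Rightarrow> real ^ 'd).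
      bernstein_process_associated g T (joint_law g T (\<phi> m) (\<psi> m)) P Z \<and>
      \<not> stationary T P Z \<and>
      \<comment> \<open>(a)\<close>
      forward_markov_process T P Z \<and>
      forward_transition_function T P Z (forward_kernel g T (\<psi> m)) \<and>
      (\<forall>n t F. 1 \<le> n \<and> t 0 = 0 \<and> (\<forall>k<n. t k < t (Suc k)) \<and> t n < T \<and>
          (\<forall>k\<in>{1..n}. F k \<in> sets borel) \<longrightarrow>
          emeasure P {\<omega> \<in> space P. \<forall>k\<in>{1..n}. Z (t k) \<omega> \<in> F k}
          = (\<integral>\<^sup>+ x. (\<integral>\<^sup>+ \<xi>. (\<Prod>k\<in>{1..n}. indicator (F k) (\<xi> k) *
                ennreal (forward_density g (v m) ((\<xi>(0 := x)) (k - 1)) (t (k - 1)) (\<xi> k) (t k)))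
              \<partial>Pi\<^sub>M {1..n} (\<lambda>_. lborel)) \<partial>density (\<phi> m) (\<lambda>x. ennreal (v m x 0)))) \<and>
      \<comment> \<open>(b)\<close>
      backward_markov_process T P Z \<and>
      backward_transition_function T P Z (backward_kernel g (\<phi> m)) \<and>
      (\<forall>n t F. 1 \<le> n \<and> 0 < t 1 \<and> (\<forall>k\<in>{1..n}. t k < t (Suc k)) \<and> t (Suc n) = T \<and>
          (\<forall>k\<in>{1..n}. F k \<in> sets borel) \<longrightarrow>
          emeasure P {\<omega> \<in> space P. \<forall>k\<in>{1..n}. Z (t k) \<omega> \<in> F k}
          = (\<integral>\<^sup>+ x. (\<integral>\<^sup>+ \<xi>. (\<Prod>k\<in>{1..n}. indicator (F k) (\<xi> k) *
                ennreal (backward_density g (u m)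
                  ((\<xi>(Suc n := x)) (Suc k)) (t (Suc k)) (\<xi> k) (t k)))
              \<partial>Pi\<^sub>M {1..n} (\<lambda>_. lborel)) \<partial>density (\<psi> m) (\<lambda>x. ennreal (u m x T)))) \<and>
      \<comment> \<open>(c)\<close>
      measure P {\<omega> \<in> space P. Z 0 \<omega> = a m} = 1 \<and>
      measure P {\<omega> \<in> space P. Z T \<omega> = b m} = 1 \<and>
      (\<forall>t\<in>{0<..<T}. \<forall>F\<in>sets borel.
          emeasure P {\<omega> \<in> space P. Z t \<omega> \<in> F}
          = (\<integral>\<^sup>+ x\<in>F. ennreal (u m x t * v m x t) \<partial>lborel)) \<and>
      \<comment> \<open>(d)\<close>
      (\<forall>t\<in>{0<..<T}. \<forall>f\<in>bounded_borel.
          (LINT \<omega>|P. f (Z t \<omega>)) = (LINT x|lborel. f x * of_real (u m x t * v m x t))))"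
proof (rule allI, goal_cases)
  case (1 m)
  interpret pinned_bridge g T "a m" "b m"
  proof
    show "0 < T"
      by (rule T)
    show "(\<lambda>(x, y). g x t y) \<in> borel_measurable (borel \<Otimes>\<^sub>M borel)" if "0 < t" "t \<le> T" for t
      using that by (rule green_measurable[OF g])
    show "0 < g x t y" "g x t y = g y t x" if "0 < t" "t \<le> T" for x t y
      using that green_positive[OF basis g] green_symmetric[OF basis g] by blast+
    show "(\<integral>\<^sup>+ z. ennreal (g x s z) * ennreal (g z t y) \<partial>lborel) = ennreal (g x (s + t) y)"
      if "0 < s" "0 < t" "s + t \<le> T" for x s t y
      using that by (rule green_semigroup[OF basis g])
  qed
  have data: "\<phi> m = dirac datum_weight (a m)" "\<psi> m = dirac datum_weight (b m)"
      "u m = forward_solution g (dirac datum_weight (a m))"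
      "v m = backward_solution g T (dirac datum_weight (b m))"
    by (simp_all only: \<phi>_def \<psi>_def u_def v_def initial_datum_def final_datum_def)
  show ?case
    unfolding data
    by (intro conjI allI ballI impI exI[of _ bridge_measure] exI[of _ pinned]
        forward_solution_datum_pos backward_solution_datum_pos pinned_associated not_stationary
        pinned_forward_markov pinned_forward_transition forward_kernel_dirac forward_finite_dimensional
        pinned_backward_markov pinned_backward_transition backward_kernel_dirac backward_finite_dimensional
        pinned_endpoints pinned_marginal pinned_expectation normalizer(1)) auto
qed

end
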